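(* Let $r\ge 4$ and $\ell\ge 2$ be integers and let $0<\lambda<1$ satisfy $\lambda^3\ell>1$. Then there is an open dense subset of $C^r(S^1,\mathbb{R})$ such that, for every $f$ in this subset, the attractor $A$ of the map $$T:S^1\times\mathbb{R}\to S^1\times\mathbb{R},\qquad T(x,y)=(\ell x,\lambda y+f(x)),$$ has non-empty interior.
   Context: $S^1=\mathbb{R}/\mathbb{Z}$; $C^r(S^1,\mathbb{R})$ has the usual $C^r$ topology. For every $f\in C^r(S^1,\mathbb{R})$, the attractor $A$ of $T$ is the closed forward invariant subset $A\subset S^1\times\mathbb{R}$ such that the $\omega$-limit set satisfies $\omega(\mathbf{x})=A$ for Lebesgue almost every $\mathbf{x}\in S^1\times\mathbb{R}$. *)

theory Defs
  imports "HOL-Analysis.Analysis"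
begin

section \<open>The circle \<open>\<real>/\<int>\<close>\<close>

definition int_equiv :: "real \<Rightarrow> real \<Rightarrow> bool"
  where "int_equiv x y \<longleftrightarrow> x - y \<in> \<int>"

lemma equivp_int_equiv: "equivp int_equiv"
proof (rule equivpI)
  show "reflp int_equiv"
    by (simp add: reflp_def int_equiv_def)
  show "symp int_equiv"
    unfolding symp_def int_equiv_def by (metis Ints_minus minus_diff_eq)
  show "transp int_equiv"
  proof (rule transpI)
    fix x y z assume "int_equiv x y" "int_equiv y z"
    then have "(x - y) + (y - z) \<in> \<int>"
      unfolding int_equiv_def by (rule Ints_add)
    then show "int_equiv x z"
      by (simp add: int_equiv_def)
  qed
qed

quotient_type circle = real / int_equiv
  by (rule equivp_int_equiv)

lift_definition to_circle :: "real \<Rightarrow> circle" is "\<lambda>x. x" .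

lift_definition circle_times :: "nat \<Rightarrow> circle \<Rightarrow> circle" is "\<lambda>l x. of_nat l * x"
proof -
  fix l :: nat and x y :: real
  assume "int_equiv x y"
  then have "of_nat l * (x - y) \<in> \<int>"
    unfolding int_equiv_def by (intro Ints_mult) auto
  then show "int_equiv (of_nat l * x) (of_nat l * y)"
    by (simp add: int_equiv_def algebra_simps)
qed

lemma to_circle_eq_iff: "to_circle x = to_circle y \<longleftrightarrow> x - y \<in> \<int>"
  by transfer (simp add: int_equiv_def)

lemma surj_to_circle: "surj to_circle"
  unfolding surj_def
proof
  fix c :: circle
  show "\<exists>x. c = to_circle x"
    by transfer (metis equivp_int_equiv equivp_reflp)
qed

lemma circle_times_to_circle: "circle_times l (to_circle x) = to_circle (of_nat l * x)"
  by transfer (simp add: int_equiv_def)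

instantiation circle :: topological_space
begin

definition open_circle :: "circle set \<Rightarrow> bool"
  where "open_circle U \<longleftrightarrow> open (to_circle -` U)"

instance
  by standard (auto simp: open_circle_def vimage_Union)

end

lemma continuous_on_to_circle: "continuous_on UNIV to_circle"
  by (simp add: continuous_on_open_vimage open_circle_def)

definition circle_lebesgue :: "circle measure"
  where "circle_lebesgue = distr (restrict_space lborel {0..<1}) borel to_circle"

lemma measurable_to_circle: "to_circle \<in> restrict_space lborel {0..<1} \<rightarrow>\<^sub>M borel"
  using borel_measurable_continuous_onI[OF continuous_on_to_circle]
  by (intro measurable_restrict_space1) simp

lemma emeasure_circle_lebesgue_space: "emeasure circle_lebesgue (space circle_lebesgue) = 1"
  unfolding circle_lebesgue_def
  by (subst emeasure_distr[OF measurable_to_circle])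
     (auto simp: space_restrict_space emeasure_restrict_space)


section \<open>The space \<open>C\<^sup>r(S\<^sup>1, \<real>)\<close>\<close>

text \<open>Derivatives of a function on the circle are those of its 1-periodic lift to \<open>\<real>\<close>.\<close>

definition circle_deriv :: "nat \<Rightarrow> (circle \<Rightarrow> real) \<Rightarrow> real \<Rightarrow> real"
  where "circle_deriv k f = (deriv ^^ k) (\<lambda>x. f (to_circle x))"

definition Cr :: "nat \<Rightarrow> (circle \<Rightarrow> real) set"
  where "Cr r = {f. (\<forall>k<r. \<forall>x. circle_deriv k f differentiable (at x)) \<and>
                    continuous_on UNIV (circle_deriv r f)}"

definition Cr_near :: "nat \<Rightarrow> real \<Rightarrow> (circle \<Rightarrow> real) \<Rightarrow> (circle \<Rightarrow> real) \<Rightarrow> bool"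
  where "Cr_near r \<epsilon> f g \<longleftrightarrow> (\<forall>k\<le>r. \<forall>x. \<bar>circle_deriv k g x - circle_deriv k f x\<bar> < \<epsilon>)"

definition Cr_topology :: "nat \<Rightarrow> (circle \<Rightarrow> real) topology"
  where "Cr_topology r =
    topology (\<lambda>U. U \<subseteq> Cr r \<and> (\<forall>f\<in>U. \<exists>\<epsilon>>0. \<forall>g\<in>Cr r. Cr_near r \<epsilon> f g \<longrightarrow> g \<in> U))"

lemma openin_Cr_topology:
  "openin (Cr_topology r) U \<longleftrightarrow>
     U \<subseteq> Cr r \<and> (\<forall>f\<in>U. \<exists>\<epsilon>>0. \<forall>g\<in>Cr r. Cr_near r \<epsilon> f g \<longrightarrow> g \<in> U)"
proof -
  let ?P = "\<lambda>U. U \<subseteq> Cr r \<and> (\<forall>f\<in>U. \<exists>\<epsilon>>0. \<forall>g\<in>Cr r. Cr_near r \<epsilon> f g \<longrightarrow> g \<in> U)"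
  have "istopology ?P"
    unfolding istopology_def
  proof (intro conjI allI impI)
    fix S T assume S: "?P S" and T: "?P T"
    show "S \<inter> T \<subseteq> Cr r" using S by blast
    show "\<forall>f\<in>S \<inter> T. \<exists>\<epsilon>>0. \<forall>g\<in>Cr r. Cr_near r \<epsilon> f g \<longrightarrow> g \<in> S \<inter> T"
    proof
      fix f assume "f \<in> S \<inter> T"
      then obtain a b where "a > 0" "b > 0"
        and a: "\<And>g. g \<in> Cr r \<Longrightarrow> Cr_near r a f g \<Longrightarrow> g \<in> S"
        and b: "\<And>g. g \<in> Cr r \<Longrightarrow> Cr_near r b f g \<Longrightarrow> g \<in> T"
        using S T by (metis IntE)
      moreover have "Cr_near r a f g" "Cr_near r b f g" if "Cr_near r (min a b) f g" for g
        using that by (auto simp: Cr_near_def)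
      ultimately show "\<exists>\<epsilon>>0. \<forall>g\<in>Cr r. Cr_near r \<epsilon> f g \<longrightarrow> g \<in> S \<inter> T"
        by (intro exI[of _ "min a b"]) auto
    qed
  next
    fix K assume K: "\<forall>S\<in>K. ?P S"
    then show "\<Union> K \<subseteq> Cr r" by blast
    show "\<forall>f\<in>\<Union> K. \<exists>\<epsilon>>0. \<forall>g\<in>Cr r. Cr_near r \<epsilon> f g \<longrightarrow> g \<in> \<Union> K"
      using K by (meson UnionE UnionI)
  qed
  then show ?thesis
    by (simp add: Cr_topology_def topology_inverse')
qed

lemma topspace_Cr_topology: "topspace (Cr_topology r) = Cr r"
proof (rule antisym)
  show "topspace (Cr_topology r) \<subseteq> Cr r"
    using openin_topspace openin_Cr_topology by blast
  have "openin (Cr_topology r) (Cr r)"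
    unfolding openin_Cr_topology using zero_less_one by blast
  then show "Cr r \<subseteq> topspace (Cr_topology r)"
    by (rule openin_subset)
qed


section \<open>Dynamics on \<open>S\<^sup>1 \<times> \<real>\<close>\<close>

definition skew_map :: "nat \<Rightarrow> real \<Rightarrow> (circle \<Rightarrow> real) \<Rightarrow> circle \<times> real \<Rightarrow> circle \<times> real"
  where "skew_map l lam f = (\<lambda>(x, y). (circle_times l x, lam * y + f x))"

definition omega_limit :: "('a::topological_space \<Rightarrow> 'a) \<Rightarrow> 'a \<Rightarrow> 'a set"
  where "omega_limit T x = (\<Inter>N. closure {(T ^^ n) x |n. n \<ge> N})"

definition is_attractor :: "(circle \<times> real \<Rightarrow> circle \<times> real) \<Rightarrow> (circle \<times> real) set \<Rightarrow> bool"
  where "is_attractor T A \<longleftrightarrow> closed A \<and> T ` A \<subseteq> A \<and>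
    (AE p in circle_lebesgue \<Otimes>\<^sub>M lborel. omega_limit T p = A)"

lemma is_attractor_unique:
  assumes "is_attractor T A" "is_attractor T B"
  shows "A = B"
proof -
  let ?M = "circle_lebesgue \<Otimes>\<^sub>M (lborel :: real measure)"
  have "AE p in ?M. omega_limit T p = A" "AE p in ?M. omega_limit T p = B"
    using assms by (auto simp: is_attractor_def)
  then have ae: "AE p in ?M. A = B"
    by eventually_elim simp
  have "emeasure ?M (space ?M) = \<infinity>"
    using lborel.emeasure_pair_measure_Times[OF sets.top[of circle_lebesgue] sets.top[of lborel]]
    by (simp add: space_pair_measure emeasure_circle_lebesgue_space)
  then have "\<not> (AE p in ?M. False)"
    by (auto simp: AE_iff_measurable[OF sets.top])
  with ae show ?thesis
    by (cases "A = B") auto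
qed

end

theory Submission
  imports Defs
begin

text \<open>
  Iterating the map gives \<open>T\<^sup>n(z, y) = (l\<^sup>n z, lam\<^sup>n y + S\<^sub>n(z))\<close>, where \<open>S\<^sub>n\<close> is the
  \<open>cocycle\<close> below. A point over \<open>x\<close> has \<open>l\<^sup>n\<close> preimages under \<open>T\<^sup>n\<close>, over the points
  \<open>(x + w) / l\<^sup>n\<close>, and a bounded set \<open>K\<close> with \<open>K \<subseteq> T\<^sup>n(K)\<close> is contained in the attractor. For a
  box \<open>K\<close> centred at height \<open>y0\<close> this inclusion says that every \<open>y\<close> in its vertical side is, up to
  the shift \<open>lam\<^sup>n y0\<close>, at distance less than \<open>lam\<^sup>n \<eta>\<close> from one of the values
  \<open>S\<^sub>n((x + w) / l\<^sup>n)\<close>. With a margin, this condition survives \<open>C\<^sup>0\<close>-small changes of \<open>f\<close>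
  (\<open>recurrent_box_stable\<close>), and it forces interior (\<open>interior_maximal_attractor\<close>). So the open
  set consists of the functions that have such a \<open>recurrent_box\<close>, and the work is to show that it
  is dense.

  Density is a question of equidistribution of \<open>l\<^sup>m\<close> numbers at the scale \<open>lam\<^sup>m\<close>. Let \<open>c\<^sub>j(x)\<close> be
  the average over \<open>w\<close> of \<open>cis (j \<omega> S\<^sub>n((x + w) / l\<^sup>n))\<close>. A combination of two Poisson kernels that is
  positive only near 0 detects the numbers, so it suffices that the weighted sum of
  \<open>sup\<^sub>x |c\<^sub>j(x)|\<close> over \<open>j \<ge> J\<close> is small (\<open>ex_close_point\<close>). The finitely many lower
  frequencies are harmless: they form a trigonometric polynomial of mean 1, which is at least 1
  somewhere, and this place is where the box is put.

  Smallness of the high frequencies comes from averaging over the coefficients of a small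
  trigonometric perturbation of \<open>f\<close>. In the mean of \<open>|c\<^sub>j(x)|\<^sup>2\<close>, two branches with exactly \<open>k\<close>
  common digits have a phase difference that moves at speed \<open>j lam\<^sup>k\<close> with the coefficients, so
  these pairs contribute at most about \<open>l\<^sup>-\<^sup>k (j lam\<^sup>k)\<^sup>-\<^sup>s\<close>, where \<open>s \<le> 4\<close>. If
  \<open>lam\<^sup>s l > 1\<close>, the sum over \<open>k\<close> is of order \<open>j\<^sup>-\<^sup>s\<close>, apart from the diagonal \<open>l\<^sup>-\<^sup>m\<close>
  (\<open>mean_square_branch_sum\<close>). A one-dimensional Sobolev inequality replaces a fixed \<open>x\<close> by the
  supremum over \<open>x\<close> at the price of a factor \<open>j\<close>. Hence \<open>sup\<^sub>x |c\<^sub>j(x)|\<close> is of order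
  \<open>j\<close> to the power \<open>(1 - s) / 2\<close>, which is summable when \<open>s > 3\<close>; such an \<open>s\<close> exists exactly because
  \<open>lam\<^sup>3 l > 1\<close>. The same hypothesis makes the diagonal negligible at frequencies up to
  \<open>lam\<^sup>-\<^sup>m\<close>.

  The phases really move because of transversality (\<open>cocycle_fourier_transversal\<close>): two backward
  orbits that start at different preimages of one point cannot give the same sums
  \<open>S\<^sub>n\<close> for all trigonometric polynomials of a fixed degree, for otherwise each orbit would
  return close to the starting point of the other, and then both would follow one periodic orbit, on
  which multiplication by \<open>l\<close> is injective.

  The attractor itself is the intersection of the forward images of a band
  (\<open>is_attractor_maximal_attractor\<close>); almost every orbit accumulates on all of it because almost
  every orbit of multiplication by \<open>l\<close> is dense in the circle.
\<close>

section \<open>Iterates of the skew product\<close>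

definition cocycle :: "nat \<Rightarrow> real \<Rightarrow> (real \<Rightarrow> 'a::real_normed_vector) \<Rightarrow> nat \<Rightarrow> real \<Rightarrow> 'a"
  where "cocycle l lam F n z = (\<Sum>i<n. lam ^ (n - 1 - i) *\<^sub>R F (real l ^ i * z))"

abbreviation branch :: "nat \<Rightarrow> nat \<Rightarrow> real \<Rightarrow> nat \<Rightarrow> real"
  where "branch l n x w \<equiv> (x + real w) / real l ^ n"

lemma cocycle_0 [simp]: "cocycle l lam F 0 z = 0"
  by (simp add: cocycle_def)

lemma cocycle_Suc:
  "cocycle l lam F (Suc n) z = lam *\<^sub>R cocycle l lam F n z + F (real l ^ n * z)"
proof -
  have "(\<Sum>i<n. lam ^ (Suc n - 1 - i) *\<^sub>R F (real l ^ i * z))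
      = (\<Sum>i<n. lam *\<^sub>R (lam ^ (n - 1 - i) *\<^sub>R F (real l ^ i * z)))"
  proof (rule sum.cong)
    fix i assume "i \<in> {..<n}"
    then have "Suc n - 1 - i = Suc (n - 1 - i)" by auto
    then show "lam ^ (Suc n - 1 - i) *\<^sub>R F (real l ^ i * z) = lam *\<^sub>R (lam ^ (n - 1 - i) *\<^sub>R F (real l ^ i * z))"
      by simp
  qed simp
  then show ?thesis
    by (simp add: cocycle_def scaleR_right.sum)
qed

lemma skew_map_funpow:
  "(skew_map l lam f ^^ n) (to_circle z, y) =
     (to_circle (real l ^ n * z), lam ^ n * y + cocycle l lam (\<lambda>x. f (to_circle x)) n z)"
  by (induction n) (simp_all add: skew_map_def circle_times_to_circle cocycle_Suc algebra_simps)

lemma sum_geometric_reversed_le: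
  fixes lam :: real
  assumes "0 < lam" "lam < 1"
  shows "(\<Sum>i<n. lam ^ (n - 1 - i)) \<le> 1 / (1 - lam)"
proof -
  have "(\<Sum>i<n. lam ^ (n - 1 - i)) = (\<Sum>i<n. lam ^ i)"
    by (rule sum.reindex_bij_witness[where i="\<lambda>i. n - 1 - i" and j="\<lambda>i. n - 1 - i"]) auto
  also have "\<dots> = (1 - lam ^ n) / (1 - lam)"
    using assms by (simp add: sum_gp_strict)
  also have "\<dots> \<le> 1 / (1 - lam)"
    using assms by (intro divide_right_mono) auto
  finally show ?thesis .
qed

lemma norm_cocycle_le:
  assumes "0 < lam" "lam < 1" and M: "\<And>x. norm (F x) \<le> M"
  shows "norm (cocycle l lam F n z) \<le> M / (1 - lam)"
proof -
  have M0: "M \<ge> 0" using M[of 0] norm_ge_zero order_trans by blast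
  have "norm (cocycle l lam F n z) \<le> (\<Sum>i<n. lam ^ (n - 1 - i) * M)"
    unfolding cocycle_def using assms by (intro sum_norm_le) (simp add: mult_left_mono)
  also have "\<dots> = (\<Sum>i<n. lam ^ (n - 1 - i)) * M"
    by (simp add: sum_distrib_right)
  also have "\<dots> \<le> 1 / (1 - lam) * M"
    using sum_geometric_reversed_le[OF assms(1,2)] M0 by (intro mult_right_mono)
  finally show ?thesis by simp
qed

section \<open>Topology of the circle\<close>

lemma open_to_circle_image: "open V \<Longrightarrow> open (to_circle ` V)"
proof -
  assume V: "open V"
  have "to_circle -` (to_circle ` V) = (\<Union>k::int. (\<lambda>x. x + of_int k) ` V)"
  proof (intro equalityI subsetI)
    fix x assume "x \<in> to_circle -` (to_circle ` V)"
    then obtain v where v: "v \<in> V" "to_circle x = to_circle v" by auto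
    then obtain k where "x - v = of_int k"
      by (auto simp: to_circle_eq_iff elim: Ints_cases)
    then have "x = v + of_int k" by simp
    with v show "x \<in> (\<Union>k::int. (\<lambda>x. x + of_int k) ` V)" by blast
  next
    fix x assume "x \<in> (\<Union>k::int. (\<lambda>x. x + of_int k) ` V)"
    then obtain k :: int and v where "v \<in> V" "x = v + of_int k" by auto
    moreover from this have "to_circle x = to_circle v" by (simp add: to_circle_eq_iff)
    ultimately show "x \<in> to_circle -` (to_circle ` V)" by auto
  qed
  moreover have "open ((\<lambda>x. x + of_int k) ` V)" for k :: int
    using open_translation[OF V, of "of_int k"] by (simp only: add.commute)
  ultimately show ?thesis by (simp add: open_circle_def open_UN)
qed

lemma closed_cylinder_lift:
  fixes B :: "(circle \<times> real) set"
  assumes "closed {(x, y). (to_circle x, y) \<in> B}"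
  shows "closed B"
  unfolding closed_def open_prod_def
proof
  fix p assume p: "p \<in> - B"
  obtain x y where xy: "p = (to_circle x, y)"
    using surj_to_circle by (metis surj_def surj_pair)
  have "open (- {(x, y). (to_circle x, y) \<in> B})"
    using assms by (simp add: open_closed)
  moreover have "(x, y) \<in> - {(x, y). (to_circle x, y) \<in> B}" using p xy by auto
  ultimately obtain U V where UV: "open U" "open V" "(x, y) \<in> U \<times> V"
      "U \<times> V \<subseteq> - {(x, y). (to_circle x, y) \<in> B}"
    by (rule open_prod_elim)
  have "to_circle ` U \<times> V \<subseteq> - B" using UV(4) by auto
  then show "\<exists>A Ba. open A \<and> open Ba \<and> p \<in> A \<times> Ba \<and> A \<times> Ba \<subseteq> - B"
    using UV open_to_circle_image[OF UV(1)] xy by (intro exI[of _ "to_circle ` U"] exI[of _ V]) auto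
qed

lemma to_circle_add_int [simp]: "to_circle (x + of_int k) = to_circle x"
  by (simp add: to_circle_eq_iff)

lemma to_circle_add_nat [simp]: "to_circle (x + of_nat k) = to_circle x"
  by (simp add: to_circle_eq_iff)


section \<open>Almost every orbit of the expanding map is dense\<close>


text \<open>The points of \<open>[0, 1)\<close> whose orbit avoids \<open>U\<close> form a set \<open>C\<close>. It misses one of the
  \<open>l\<^sup>s\<close> intervals of length \<open>l\<^sup>-\<^sup>s\<close>, and multiplication by \<open>l\<^sup>s\<close> maps the part of \<open>C\<close> in each of the
  others injectively into \<open>C\<close>, modulo 1. So the measure of \<open>C\<close> is at most \<open>1 - l\<^sup>-\<^sup>s\<close> times itself.\<close>

lemma null_sets_avoiding_orbits:
  fixes l s j :: nat and U :: "real set"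
  assumes l: "l \<ge> 2" and U: "open U" "\<And>x k. x \<in> U \<Longrightarrow> x + of_int k \<in> U"
    and j: "j < l ^ s" and I: "{real j / real l ^ s ..< (real j + 1) / real l ^ s} \<subseteq> U"
  shows "{x::real. \<forall>n. real l ^ n * x \<notin> U} \<in> null_sets lborel"
proof -
  define E where "E = {x::real. \<forall>n. real l ^ n * x \<notin> U}"
  define L where "L = l ^ s"
  have L: "L > 0" using l by (simp add: L_def)
  have "E = (\<Inter>n. (\<lambda>x. real l ^ n * x) -` (- U))" by (auto simp: E_def)
  moreover have "closed ((\<lambda>x. real l ^ n * x) -` (- U))" for n
    using U(1) by (intro continuous_closed_vimage) (auto intro!: continuous_intros simp: open_closed)
  ultimately have closed_E: "closed E" by auto
  have E_period: "x + of_int k \<in> E" if "x \<in> E" for x and k :: int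
    unfolding E_def
  proof (intro CollectI allI notI)
    fix n assume "real l ^ n * (x + of_int k) \<in> U"
    then have "real l ^ n * (x + of_int k) + of_int (- (int l ^ n * k)) \<in> U" by (rule U(2))
    then have "real l ^ n * x \<in> U" by (simp add: algebra_simps)
    with that show False by (auto simp: E_def)
  qed
  have E_expand: "real L * x \<in> E" if "x \<in> E" for x
    using that unfolding E_def L_def
    by (auto simp: mult.assoc[symmetric] power_add[symmetric])
  define C where "C = E \<inter> {0..<1}"
  have C_bounded: "bounded C"
    by (rule bounded_subset[of "{0..1}"]) (auto simp: C_def)
  have C_borel: "C \<in> sets borel"
    unfolding C_def using closed_E by (auto intro: borel_closed)
  then have C: "C \<in> lmeasurable"
    using C_bounded by (intro bounded_set_imp_lmeasurable) auto
  define g where "g i x = (1 / real L) *\<^sub>R x + real i / real L" for i :: nat and x :: real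
  have C_sub: "C \<subseteq> (\<Union>i\<in>{..<L} - {j}. g i ` C)"
  proof
    fix x assume x: "x \<in> C"
    define i where "i = nat \<lfloor>real L * x\<rfloor>"
    have x01: "0 \<le> x" "x < 1" "x \<in> E" using x by (auto simp: C_def)
    have fl: "real i \<le> real L * x" "real L * x < real i + 1"
      using x01 L unfolding i_def by (auto simp: of_nat_nat)
    have iL: "i < L"
    proof -
      have "real i < real L" using fl(1) x01 L
        by (smt (verit) mult_less_cancel_left2 of_nat_0_less_iff)
      then show ?thesis by simp
    qed
    have "i \<noteq> j"
    proof
      assume "i = j"
      then have "x \<in> {real j / real l ^ s ..< (real j + 1) / real l ^ s}"
        using fl L by (auto simp: L_def field_simps)
      then have "x \<in> U" using I by blast
      moreover have "real l ^ 0 * x \<notin> U" using x01(3) unfolding E_def by blast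
      ultimately show False by simp
    qed
    moreover have "real L * x - real i \<in> C"
      using E_period[OF E_expand[OF x01(3)], of "- int i"] fl by (simp add: C_def)
    moreover have "x = g i (real L * x - real i)" using L by (simp add: g_def field_simps)
    ultimately show "x \<in> (\<Union>i\<in>{..<L} - {j}. g i ` C)" using iL by blast
  qed
  have gC: "g i ` C \<in> lmeasurable" "measure lebesgue (g i ` C) = measure lebesgue C / real L" for i
  proof -
    have "g i ` C = (\<lambda>x. real L * x - real i) -` C"
    proof (intro equalityI subsetI)
      fix x assume "x \<in> (\<lambda>x. real L * x - real i) -` C"
      then show "x \<in> g i ` C"
        using L by (intro image_eqI[of _ _ "real L * x - real i"]) (auto simp: g_def field_simps)
    qed (use L in \<open>auto simp: g_def field_simps\<close>)
    moreover have "(\<lambda>x. real L * x - real i) -` C \<in> sets borel"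
      using C_borel by (intro measurable_sets_borel[of _ borel]) auto
    moreover have "bounded (g i ` C)"
    proof -
      have "bounded ((+) (real i / real L) ` (\<lambda>x. (1 / real L) *\<^sub>R x) ` C)"
        using C_bounded by (intro bounded_translation bounded_scaling)
      then show ?thesis by (simp add: g_def[abs_def] image_image add.commute)
    qed
    ultimately show "g i ` C \<in> lmeasurable"
      by (intro bounded_set_imp_lmeasurable) auto
    show "measure lebesgue (g i ` C) = measure lebesgue C / real L"
      using measure_lebesgue_affine[of "1 / real L" "real i / real L" C] by (simp add: g_def)
  qed
  have "measure lebesgue C \<le> measure lebesgue (\<Union>i\<in>{..<L} - {j}. g i ` C)"
    using C C_sub gC by (intro measure_mono_fmeasurable) (auto intro: fmeasurableD)
  also have "\<dots> \<le> (\<Sum>i\<in>{..<L} - {j}. measure lebesgue (g i ` C))"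
    using gC by (intro measure_UNION_le) (auto intro: fmeasurableD)
  also have "\<dots> = (real L - 1) * (measure lebesgue C / real L)"
    using gC j by (simp add: L_def of_nat_diff)
  finally have "measure lebesgue C \<le> 0"
    using L by (simp add: field_simps)
  then have "measure lebesgue C = 0" by (simp add: antisym)
  then have "negligible C" using C by (simp add: negligible_iff_measure)
  moreover have "E \<subseteq> (\<Union>k::int. (\<lambda>x. of_int k + x) ` C)"
  proof
    fix x assume x: "x \<in> E"
    have "x + of_int (- \<lfloor>x\<rfloor>) \<in> E" by (rule E_period[OF x])
    moreover have "0 \<le> x - of_int \<lfloor>x\<rfloor>" "x - of_int \<lfloor>x\<rfloor> < 1" by linarith+
    ultimately have "x - of_int \<lfloor>x\<rfloor> \<in> C" by (auto simp: C_def)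
    then show "x \<in> (\<Union>k::int. (\<lambda>x. of_int k + x) ` C)"
      by (auto intro!: exI[of _ "\<lfloor>x\<rfloor>"] image_eqI[of _ _ "x - of_int \<lfloor>x\<rfloor>"])
  qed
  moreover have "negligible (\<Union>k::int. (\<lambda>x. of_int k + x) ` C)" if "negligible C"
    using that by (intro negligible_countable_Union) (auto intro: negligible_translation)
  ultimately have "negligible E" using negligible_subset by blast
  then have "emeasure lebesgue E = 0" by (simp add: negligible_iff_emeasure0 borel_closed closed_E)
  then show ?thesis
    using closed_E unfolding E_def[symmetric] by (intro null_setsI) (auto simp: borel_closed)
qed

definition dense_orbit :: "nat \<Rightarrow> real \<Rightarrow> bool"
  where "dense_orbit l x \<longleftrightarrow> (\<forall>U. open U \<longrightarrow> U \<noteq> {} \<longrightarrow> (\<exists>n. \<exists>u\<in>U. real l ^ n * x - u \<in> \<int>))"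

text \<open>Countably many intervals \<open>[j / l\<^sup>s, (j + 1) / l\<^sup>s)\<close> suffice to test density. Each is
  enlarged to an open interval, so that the exceptional set is closed and hence Borel on the circle.\<close>

lemma AE_dense_orbit:
  assumes l: "l \<ge> 2"
  shows "AE p in circle_lebesgue \<Otimes>\<^sub>M (lborel :: real measure). \<exists>x y. p = (to_circle x, y) \<and> dense_orbit l x"
proof -
  define U where "U s j = to_circle -` (to_circle ` {(real j - 1) / real l ^ s <..< (real j + 2) / real l ^ s})" for s j :: nat
  define C where "C s j = {c. \<forall>n. \<forall>x. c = to_circle x \<longrightarrow> real l ^ n * x \<notin> U s j}" for s j :: nat
  have openU: "open (U s j)" for s j
    unfolding U_def using open_to_circle_image[of "{(real j - 1) / real l ^ s <..< (real j + 2) / real l ^ s}"]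
    by (simp add: open_circle_def)
  have Uper: "x + of_int k \<in> U s j" if "x \<in> U s j" for x k s j
    using that by (simp add: U_def)
  have lift: "to_circle -` C s j = {x. \<forall>n. real l ^ n * x \<notin> U s j}" for s j
  proof (intro equalityI subsetI)
    fix x assume x: "x \<in> {x. \<forall>n. real l ^ n * x \<notin> U s j}"
    show "x \<in> to_circle -` C s j"
      unfolding C_def
    proof (intro vimageI CollectI allI impI notI)
      fix n x' assume x': "to_circle x = to_circle x'" "real l ^ n * x' \<in> U s j"
      from x'(1) obtain k where "x - x' = of_int k" by (auto simp: to_circle_eq_iff elim: Ints_cases)
      then have "real l ^ n * x = real l ^ n * x' + of_int (int l ^ n * k)"
        by (simp add: algebra_simps flip: distrib_left)
      then show False using x Uper[OF x'(2)] by (metis mem_Collect_eq)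
    qed simp_all
  qed (auto simp: C_def)
  have null: "C s j \<in> null_sets circle_lebesgue" if j: "j < l ^ s" for s j
  proof -
    have nl: "to_circle -` C s j \<in> null_sets lborel"
      unfolding lift
    proof (rule null_sets_avoiding_orbits[OF l openU Uper j])
      have "{real j / real l ^ s..<(real j + 1) / real l ^ s} \<subseteq> {(real j - 1) / real l ^ s <..< (real j + 2) / real l ^ s}"
        using l by (auto simp: field_simps)
      then show "{real j / real l ^ s..<(real j + 1) / real l ^ s} \<subseteq> U s j"
        by (auto simp: U_def)
    qed
    have "- (to_circle -` C s j) = (\<Union>n. (\<lambda>x. real l ^ n * x) -` U s j)"
      unfolding lift by auto
    moreover have "open ((\<lambda>x. real l ^ n * x) -` U s j)" for n
      using openU by (intro continuous_open_vimage) (auto intro!: continuous_intros)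
    ultimately have "open (- C s j)"
      by (auto simp: open_circle_def vimage_Compl)
    then have C: "C s j \<in> sets borel"
      by (simp add: borel_closed closed_def)
    have "emeasure circle_lebesgue (C s j) = emeasure (restrict_space lborel {0..<1}) (to_circle -` C s j \<inter> {0..<1})"
      unfolding circle_lebesgue_def using C
      by (subst emeasure_distr[OF measurable_to_circle]) (auto simp: space_restrict_space)
    also have "\<dots> = emeasure lborel (to_circle -` C s j \<inter> {0..<1})"
      by (intro emeasure_restrict_space) auto
    also have "\<dots> = 0"
      using nl null_set_Int2[OF nl, of "{0..<1}"] by (simp add: Int_commute null_setsD1)
    finally show ?thesis using C by (auto simp: circle_lebesgue_def)
  qed
  define B where "B = (\<Union>s. \<Union>j\<in>{..<l ^ s}. C s j)"
  have B: "B \<in> null_sets circle_lebesgue"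
    unfolding B_def using null by (intro null_sets_UN' null_sets_UN) (auto intro: countable_finite)
  have dense: "dense_orbit l x" if x: "to_circle x \<notin> B" for x
    unfolding dense_orbit_def
  proof (intro allI impI)
    fix V :: "real set" assume V: "open V" "V \<noteq> {}"
    then obtain v e where v: "v \<in> V" "e > 0" "ball v e \<subseteq> V" by (meson all_not_in_conv openE)
    obtain s where s: "2 / e < real l ^ s"
      using real_arch_pow[of "real l" "2 / e"] l by auto
    define u where "u = v - of_int \<lfloor>v\<rfloor>"
    have u: "0 \<le> u" "u < 1" unfolding u_def by linarith+
    define j where "j = nat \<lfloor>real l ^ s * u\<rfloor>"
    have ls: "real l ^ s > 0" using l by simp
    have fl: "real j \<le> real l ^ s * u" "real l ^ s * u < real j + 1"
      using u ls unfolding j_def by (auto simp: of_nat_nat)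
    have "real j < real l ^ s"
      using fl(1) u ls by (smt (verit) mult_less_cancel_left2)
    then have "j < l ^ s" by (metis of_nat_less_iff of_nat_power)
    then have "to_circle x \<notin> C s j" using x by (auto simp: B_def)
    then have "x \<notin> to_circle -` C s j" by simp
    then obtain n where "real l ^ n * x \<in> U s j" unfolding lift by auto
    then obtain w where w: "(real j - 1) / real l ^ s < w" "w < (real j + 2) / real l ^ s"
        "to_circle (real l ^ n * x) = to_circle w" by (auto simp: U_def)
    have "\<bar>real l ^ s * w - real l ^ s * u\<bar> < 2"
      using w(1,2) fl ls by (simp add: field_simps abs_less_iff)
    then have "real l ^ s * \<bar>w - u\<bar> < 2"
      using ls by (simp add: abs_mult flip: right_diff_distrib)
    then have "\<bar>w - u\<bar> < e"
      using s v(2) ls by (smt (verit, best) mult_less_cancel_left_pos pos_divide_less_eq mult.commute)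
    then have "w + of_int \<lfloor>v\<rfloor> \<in> ball v e" by (simp add: u_def dist_real_def)
    moreover have "real l ^ n * x - (w + of_int \<lfloor>v\<rfloor>) \<in> \<int>"
    proof -
      have "real l ^ n * x - w \<in> \<int>" using w(3) by (simp add: to_circle_eq_iff)
      then have "real l ^ n * x - w - of_int \<lfloor>v\<rfloor> \<in> \<int>" by (rule Ints_diff) simp
      then show ?thesis by (simp add: algebra_simps)
    qed
    ultimately show "\<exists>n. \<exists>u\<in>V. real l ^ n * x - u \<in> \<int>" using v(3) by blast
  qed
  have "B \<times> (UNIV::real set) \<in> null_sets (circle_lebesgue \<Otimes>\<^sub>M lborel)"
    using null_setsD1[OF B] null_setsD2[OF B] lborel.emeasure_pair_measure_Times[of B circle_lebesgue UNIV]
    by (intro null_setsI) (auto intro: pair_measureI)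
  then show ?thesis
  proof (rule AE_I', intro subsetI)
    fix p assume "p \<in> {p \<in> space (circle_lebesgue \<Otimes>\<^sub>M lborel). \<not> (\<exists>x y. p = (to_circle x, y) \<and> dense_orbit l x)}"
    then have p: "\<not> (\<exists>x y. p = (to_circle x, y) \<and> dense_orbit l x)" by blast
    obtain x y where "p = (to_circle x, y)"
      using surj_to_circle by (metis surj_def surj_pair)
    with p dense show "p \<in> B \<times> UNIV" by auto
  qed
qed

section \<open>The attractor\<close>

definition maximal_attractor :: "nat \<Rightarrow> real \<Rightarrow> (circle \<Rightarrow> real) \<Rightarrow> real \<Rightarrow> (circle \<times> real) set"
  where "maximal_attractor l lam f R = (\<Inter>n. (skew_map l lam f ^^ n) ` (UNIV \<times> {-R..R}))"

text \<open>Over \<open>x\<close> the image is a union of \<open>l\<^sup>n\<close> vertical intervals whose endpoints depend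
  continuously on the lift of \<open>x\<close>. The branches \<open>(x + w) / l\<^sup>n\<close> with \<open>w < l\<^sup>n\<close> represent all preimages
  of \<open>x\<close> for every real \<open>x\<close>, so the lift need not be reduced modulo 1, which would not be
  continuous.\<close>

lemma closed_funpow_band:
  assumes l: "l \<ge> 2" and lam: "0 < lam" and f: "continuous_on UNIV (\<lambda>x. f (to_circle x))"
  shows "closed ((skew_map l lam f ^^ n) ` (UNIV \<times> {-R..R}))" (is "closed ?B")
proof (rule closed_cylinder_lift)
  define F where "F = (\<lambda>x. f (to_circle x))"
  have F: "continuous_on UNIV F" using f by (simp add: F_def)
  have contF: "continuous_on S (\<lambda>x. F (g x))" if "continuous_on S g" for S :: "(real \<times> real) set" and g
    by (rule continuous_on_compose2[OF F that]) auto
  define L where "L = l ^ n"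
  have L: "L > 0" using l by (simp add: L_def)
  have "{(x, y). (to_circle x, y) \<in> ?B} =
      (\<Union>w\<in>{..<L}. {p. \<bar>snd p - cocycle l lam F n ((fst p + real w) / real L)\<bar> \<le> lam ^ n * R})"
    (is "_ = ?C")
  proof (intro equalityI subsetI)
    fix p assume "p \<in> {(x, y). (to_circle x, y) \<in> ?B}"
    then obtain x y c y' where p: "p = (x, y)" "(to_circle x, y) = (skew_map l lam f ^^ n) (c, y')" "\<bar>y'\<bar> \<le> R"
      by auto
    obtain z where z: "c = to_circle z" using surj_to_circle by (meson surjD)
    have "to_circle (real L * z) = to_circle x" using p(2) by (simp add: z skew_map_funpow L_def)
    then obtain k where k: "real L * z - x = of_int k" by (auto simp: to_circle_eq_iff elim: Ints_cases)
    define w where "w = nat (k mod int L)"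
    have w: "w < L" "int w = k mod int L" using L by (auto simp: w_def nat_less_iff)
    have "k = k mod int L + int L * (k div int L)" by simp
    then have "real_of_int k = real w + real L * of_int (k div int L)"
      using w(2) by (metis of_int_add of_int_mult of_int_of_nat_eq)
    then have "z = (x + real w) / real L + of_int (k div int L)"
      using k L by (simp add: field_simps)
    then have "c = to_circle ((x + real w) / real L)" by (simp add: z)
    then have "y = lam ^ n * y' + cocycle l lam F n ((x + real w) / real L)"
      using p(2) by (simp add: skew_map_funpow F_def)
    then have "\<bar>snd p - cocycle l lam F n ((fst p + real w) / real L)\<bar> \<le> lam ^ n * R"
      using p lam by (simp add: abs_mult)
    with w(1) show "p \<in> ?C" by blast
  next
    fix p assume "p \<in> ?C"
    then obtain x y w where p: "p = (x, y)" "w < L"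
        "\<bar>y - cocycle l lam F n ((x + real w) / real L)\<bar> \<le> lam ^ n * R" by (cases p) auto
    define y' where "y' = (y - cocycle l lam F n ((x + real w) / real L)) / lam ^ n"
    have "\<bar>y'\<bar> \<le> R" using p(3) lam by (simp add: y'_def abs_mult divide_le_eq mult.commute)
    moreover have "(skew_map l lam f ^^ n) (to_circle ((x + real w) / real L), y') = (to_circle x, y)"
      using L lam by (simp add: skew_map_funpow F_def y'_def L_def)
    ultimately show "p \<in> {(x, y). (to_circle x, y) \<in> ?B}"
      unfolding p(1) by (auto intro!: image_eqI[of _ _ "(to_circle ((x + real w) / real L), y')"])
  qed
  moreover have "closed ?C"
    using L unfolding cocycle_def
    by (intro closed_UN closed_Collect_le ballI continuous_intros contF) auto
  ultimately show "closed {(x, y). (to_circle x, y) \<in> ?B}" by simp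
qed

lemma band_invariant:
  assumes "0 < lam" "lam < 1" and M: "\<And>c. \<bar>f c\<bar> \<le> M" and R: "M / (1 - lam) \<le> R"
  shows "skew_map l lam f ` (UNIV \<times> {-R..R}) \<subseteq> UNIV \<times> {-R..R}"
proof (clarsimp simp: skew_map_def)
  fix c :: circle and y assume y: "- R \<le> y" "y \<le> R"
  have "\<bar>lam * y + f c\<bar> \<le> lam * R + M"
  proof -
    have "\<bar>lam * y\<bar> \<le> lam * R"
      using y assms(1) by (simp add: abs_mult abs_le_iff)
    then show ?thesis using M[of c] by linarith
  qed
  also have "\<dots> \<le> R" using R assms(2) by (simp add: divide_le_eq algebra_simps)
  finally show "- R \<le> lam * y + f c \<and> lam * y + f c \<le> R" by linarith
qed

lemma open_vimage_mult: "open S \<Longrightarrow> open ((\<lambda>u::real. a * u) -` S)"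
  by (erule continuous_open_vimage) (auto intro: continuous_intros)

lemma funpow_image_antimono:
  assumes "T ` B \<subseteq> B" and "m \<le> n"
  shows "(T ^^ n) ` B \<subseteq> (T ^^ m) ` B"
  using assms(2)
proof (induction n rule: dec_induct)
  case (step n)
  have "(T ^^ Suc n) ` B = (T ^^ n) ` (T ` B)"
    by (simp add: image_image funpow_swap1)
  then show ?case using step.IH assms(1) image_mono by blast
qed simp

text \<open>Every orbit enters the band, so all limit points lie in the intersection. Conversely a point
  of the intersection is \<open>T\<^sup>n(z, y0)\<close> for arbitrarily large \<open>n\<close>; a dense orbit passes near
  \<open>z\<close> at late times, at some other bounded height, and \<open>T\<^sup>n\<close> contracts the height error to
  \<open>lam\<^sup>n 2 R\<close>.\<close>

theorem is_attractor_maximal_attractor: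
  assumes l: "l \<ge> 2" and lam: "0 < lam" "lam < 1"
    and f: "continuous_on UNIV (\<lambda>x. f (to_circle x))"
    and M: "\<And>c. \<bar>f c\<bar> \<le> M" and R: "M / (1 - lam) < R"
  shows "is_attractor (skew_map l lam f) (maximal_attractor l lam f R)"
proof -
  define T where "T = skew_map l lam f"
  define B where "B = (UNIV :: circle set) \<times> {-R..R}"
  define F where "F = (\<lambda>x. f (to_circle x))"
  let ?A = "maximal_attractor l lam f R"
  have A: "?A = (\<Inter>n. (T ^^ n) ` B)" by (simp add: maximal_attractor_def T_def B_def)
  have closedB: "closed ((T ^^ n) ` B)" for n
    unfolding T_def B_def by (rule closed_funpow_band[OF l lam(1) f])
  have TB: "T ` B \<subseteq> B"
    unfolding T_def B_def using band_invariant[OF lam M] R by simp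
  have "closed ?A" unfolding A using closedB by auto
  moreover have "T ` ?A \<subseteq> ?A"
  proof -
    have "T ` ?A \<subseteq> (T ^^ n) ` B" for n
    proof -
      have "T ` ?A \<subseteq> T ` ((T ^^ n) ` B)" unfolding A by (intro image_mono) auto
      also have "\<dots> = (T ^^ Suc n) ` B" by (simp add: image_comp comp_def)
      also have "\<dots> \<subseteq> (T ^^ n) ` B" by (rule funpow_image_antimono[OF TB]) simp
      finally show ?thesis .
    qed
    then show ?thesis unfolding A by blast
  qed
  moreover
  have "omega_limit T (to_circle x, y) = ?A" if x: "dense_orbit l x" for x y
  proof
    have M0: "\<bar>cocycle l lam F n x\<bar> \<le> M / (1 - lam)" for n
      using norm_cocycle_le[of lam F M] lam M by (simp add: F_def)
    have "(\<lambda>n. lam ^ n * \<bar>y\<bar>) \<longlonglongrightarrow> 0 * \<bar>y\<bar>"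
      using lam by (intro tendsto_intros LIMSEQ_power_zero) auto
    then have "eventually (\<lambda>n. lam ^ n * \<bar>y\<bar> < R - M / (1 - lam)) sequentially"
      using R by (intro order_tendstoD(2)) auto
    then obtain N0 where N0: "\<And>n. n \<ge> N0 \<Longrightarrow> lam ^ n * \<bar>y\<bar> < R - M / (1 - lam)"
      by (auto simp: eventually_sequentially)
    have inB: "(T ^^ n) (to_circle x, y) \<in> B" if "n \<ge> N0" for n
    proof -
      have "\<bar>lam ^ n * y + cocycle l lam F n x\<bar> \<le> R"
        using N0[OF that] M0[of n] abs_triangle_ineq[of "lam ^ n * y" "cocycle l lam F n x"] lam
        by (simp add: abs_mult)
      then show ?thesis unfolding T_def B_def skew_map_funpow F_def[symmetric] by auto
    qed
    show "omega_limit T (to_circle x, y) \<subseteq> ?A"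
      unfolding A
    proof (rule INT_greatest)
      fix n
      have "{(T ^^ k) (to_circle x, y) |k. k \<ge> N0 + n} \<subseteq> (T ^^ n) ` B"
      proof
        fix p assume "p \<in> {(T ^^ k) (to_circle x, y) |k. k \<ge> N0 + n}"
        then obtain k where pk: "p = (T ^^ k) (to_circle x, y)" and k: "N0 + n \<le> k" by blast
        have "(T ^^ k) (to_circle x, y) = (T ^^ n) ((T ^^ (k - n)) (to_circle x, y))"
          using k by (metis add_leD2 funpow_add comp_apply le_add_diff_inverse)
        moreover have "(T ^^ (k - n)) (to_circle x, y) \<in> B" using k by (intro inB) simp
        ultimately show "p \<in> (T ^^ n) ` B" unfolding pk by simp
      qed
      then have "closure {(T ^^ k) (to_circle x, y) |k. k \<ge> N0 + n} \<subseteq> (T ^^ n) ` B"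
        using closedB by (rule closure_minimal)
      then show "omega_limit T (to_circle x, y) \<subseteq> (T ^^ n) ` B"
        unfolding omega_limit_def by blast
    qed
    show "?A \<subseteq> omega_limit T (to_circle x, y)"
      unfolding omega_limit_def
    proof (rule INT_greatest, rule subsetI)
      fix N p assume p: "p \<in> ?A"
      show "p \<in> closure {(T ^^ n) (to_circle x, y) |n. n \<ge> N}" (is "_ \<in> closure ?O")
      proof (rule ccontr)
        assume "p \<notin> closure ?O"
        then have "open (- closure ?O)" "p \<in> - closure ?O" by auto
        then obtain V W where VW: "open V" "open W" "p \<in> V \<times> W" "V \<times> W \<subseteq> - closure ?O"
          by (rule open_prod_elim)
        obtain c y' where cy: "p = (c, y')" by (cases p)
        then obtain e where e: "e > 0" "ball y' e \<subseteq> W" using VW by (meson mem_Sigma_iff openE)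
        have "(\<lambda>n. lam ^ n * (2 * R)) \<longlonglongrightarrow> 0 * (2 * R)"
          using lam by (intro tendsto_intros LIMSEQ_power_zero) auto
        then have "eventually (\<lambda>n. lam ^ n * (2 * R) < e / 2) sequentially"
          using e by (intro order_tendstoD(2)) auto
        then obtain n where n: "lam ^ n * (2 * R) < e / 2"
          by (auto simp: eventually_sequentially)
        have "p \<in> (T ^^ n) ` B" using p unfolding A by blast
        then obtain c' y0 where c': "p = (T ^^ n) (c', y0)" "\<bar>y0\<bar> \<le> R" by (auto simp: B_def)
        obtain z where z: "c' = to_circle z" using surj_to_circle by (meson surjD)
        have p2: "c = to_circle (real l ^ n * z)" "y' = lam ^ n * y0 + cocycle l lam F n z"
          using c' cy by (auto simp: z T_def skew_map_funpow F_def)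
        define U where "U = {u. to_circle (real l ^ n * u) \<in> V \<and> \<bar>cocycle l lam F n u - cocycle l lam F n z\<bar> < e / 2}"
        have "continuous_on UNIV (\<lambda>u. F (real l ^ i * u))" for i
          using f unfolding F_def[symmetric] by (rule continuous_on_compose2) (auto intro!: continuous_intros)
        then have "open {u. \<bar>cocycle l lam F n u - cocycle l lam F n z\<bar> < e / 2}"
          unfolding cocycle_def by (intro open_Collect_less continuous_intros) auto
        moreover have "open ((\<lambda>u. real l ^ n * u) -` (to_circle -` V))"
          using VW(1) unfolding open_circle_def by (rule open_vimage_mult)
        ultimately have "open (((\<lambda>u. real l ^ n * u) -` (to_circle -` V)) \<inter> {u. \<bar>cocycle l lam F n u - cocycle l lam F n z\<bar> < e / 2})"
          by (intro open_Int)
        then have openU: "open U" by (simp add: U_def vimage_def Collect_conj_eq)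
        have zU: "z \<in> U" using VW(3) p2(1) cy e by (simp add: U_def)
        \<comment> \<open>Asking that the orbit visits the preimage of \<open>U\<close> under multiplication by \<open>l\<^sup>K\<close> yields a visit to \<open>U\<close> after time \<open>K\<close>.\<close>
        define K where "K = N + N0"
        have "open ((\<lambda>u. real l ^ K * u) -` (to_circle -` (to_circle ` U)))"
          using open_to_circle_image[OF openU] unfolding open_circle_def by (rule open_vimage_mult)
        moreover have "z / real l ^ K \<in> (\<lambda>u. real l ^ K * u) -` (to_circle -` (to_circle ` U))"
          using zU l by simp
        ultimately obtain k u where u: "to_circle (real l ^ K * u) \<in> to_circle ` U" "real l ^ k * x - u \<in> \<int>"
          using x unfolding dense_orbit_def by blast
        have "to_circle (real l ^ k * x) = to_circle u" using u(2) by (simp add: to_circle_eq_iff)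
        then have "circle_times (l ^ K) (to_circle (real l ^ k * x)) = circle_times (l ^ K) (to_circle u)" by simp
        then have "to_circle (real l ^ (K + k) * x) = to_circle (real l ^ K * u)"
          by (simp add: circle_times_to_circle power_add mult.assoc)
        then obtain v where v: "v \<in> U" "to_circle (real l ^ (K + k) * x) = to_circle v" using u(1) by auto
        obtain y2 where y2: "(T ^^ (K + k)) (to_circle x, y) = (to_circle v, y2)"
          using v(2) by (simp add: T_def skew_map_funpow)
        have y2R: "\<bar>y2\<bar> \<le> R" using inB[of "K + k"] y2 by (auto simp: B_def K_def)
        have "(T ^^ (n + (K + k))) (to_circle x, y) = (T ^^ n) (to_circle v, y2)"
          by (subst funpow_add) (simp add: y2)
        also have "\<dots> = (to_circle (real l ^ n * v), lam ^ n * y2 + cocycle l lam F n v)"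
          by (simp add: T_def skew_map_funpow F_def)
        finally have orb: "(to_circle (real l ^ n * v), lam ^ n * y2 + cocycle l lam F n v) \<in> ?O"
          by (intro CollectI exI[of _ "n + (K + k)"]) (simp add: K_def)
        have "\<bar>lam ^ n * y2 - lam ^ n * y0\<bar> \<le> lam ^ n * (2 * R)"
          using y2R c'(2) lam by (simp add: abs_mult flip: right_diff_distrib)
        then have "\<bar>(lam ^ n * y2 + cocycle l lam F n v) - y'\<bar> < e"
        proof -
          assume 1: "\<bar>lam ^ n * y2 - lam ^ n * y0\<bar> \<le> lam ^ n * (2 * R)"
          have "\<bar>cocycle l lam F n v - cocycle l lam F n z\<bar> < e / 2" using v(1) by (simp add: U_def)
          with 1 show ?thesis using n p2(2) by linarith
        qed
        then have "lam ^ n * y2 + cocycle l lam F n v \<in> W"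
          using e(2) by (auto simp: dist_real_def)
        moreover have "to_circle (real l ^ n * v) \<in> V" using v(1) by (simp add: U_def)
        ultimately show False using orb VW(4) closure_subset[of ?O] by blast
      qed
    qed
  qed
  then have omega: "omega_limit T p = ?A" if "\<exists>x y. p = (to_circle x, y) \<and> dense_orbit l x" for p
    using that by blast
  have "AE p in circle_lebesgue \<Otimes>\<^sub>M lborel. omega_limit T p = ?A"
    using AE_dense_orbit[OF l] by (rule eventually_mono) (rule omega)
  ultimately show ?thesis unfolding is_attractor_def T_def by blast
qed

section \<open>A stable mechanism for interior\<close>

text \<open>For the box over \<open>[0, l\<^sup>-\<^sup>q]\<close> of height \<open>2 \<eta>\<close> around \<open>y0\<close>: each of its points has a
  preimage under \<open>T\<^sup>m\<^sup>+\<^sup>q\<close> in the box at distance at most \<open>\<kappa> \<eta>\<close> from the height \<open>y0\<close>. The base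
  points \<open>(x + w) / l\<^sup>m\<^sup>+\<^sup>q\<close> with \<open>w < l\<^sup>m\<close> are preimages of \<open>x\<close> in \<open>[0, l\<^sup>-\<^sup>q]\<close>;
  they do not depend on \<open>f\<close>, which is why only the heights need a margin.\<close>

definition box_cover :: "nat \<Rightarrow> real \<Rightarrow> (real \<Rightarrow> real) \<Rightarrow> nat \<Rightarrow> nat \<Rightarrow> real \<Rightarrow> real \<Rightarrow> real \<Rightarrow> bool"
  where "box_cover l lam F m q \<eta> y0 \<kappa> \<longleftrightarrow>
    (\<forall>x\<in>{0..1 / real l ^ q}. \<forall>y\<in>{y0 - \<eta>..y0 + \<eta>}. \<exists>w<l ^ m.
        \<bar>y - cocycle l lam F (m + q) (branch l (m + q) x w) - lam ^ (m + q) * y0\<bar>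
          \<le> \<kappa> * lam ^ (m + q) * \<eta>)"

definition recurrent_box :: "nat \<Rightarrow> real \<Rightarrow> (real \<Rightarrow> real) \<Rightarrow> bool"
  where "recurrent_box l lam F \<longleftrightarrow>
    (\<exists>m q \<eta> y0 \<kappa>. 0 < \<eta> \<and> \<kappa> < 1 \<and> 0 < m + q \<and> box_cover l lam F m q \<eta> y0 \<kappa>)"

text \<open>The box is contained in its own image under a power of \<open>T\<close>, hence in all forward images of a
  band that contains it. Enlarging the band does no harm, since the attractor does not depend on
  it.\<close>

lemma interior_maximal_attractor:
  assumes l: "l \<ge> 2" and lam: "0 < lam" "lam < 1"
    and rec: "recurrent_box l lam (\<lambda>x. f (to_circle x))" and M: "\<And>c. \<bar>f c\<bar> \<le> M"
  shows "\<exists>R>M / (1 - lam). interior (maximal_attractor l lam f R) \<noteq> {}"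
proof -
  define T where "T = skew_map l lam f"
  define F where "F = (\<lambda>x. f (to_circle x))"
  obtain m q \<eta> y0 \<kappa> where "0 < \<eta> \<and> \<kappa> < 1 \<and> 0 < m + q \<and> box_cover l lam F m q \<eta> y0 \<kappa>"
    using rec unfolding recurrent_box_def F_def by meson
  then have \<eta>: "0 < \<eta>" and \<kappa>: "\<kappa> < 1" and mq: "0 < m + q"
    and cover: "box_cover l lam F m q \<eta> y0 \<kappa>" by simp_all
  define n where "n = m + q"
  define K where "K = to_circle ` {0..1 / real l ^ q} \<times> {y0 - \<eta>..y0 + \<eta>}"
  have K_step: "K \<subseteq> (T ^^ n) ` K"
  proof
    fix p assume "p \<in> K"
    then obtain x y where p: "p = (to_circle x, y)" "x \<in> {0..1 / real l ^ q}" "y \<in> {y0 - \<eta>..y0 + \<eta>}"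
      by (auto simp: K_def)
    obtain w where w: "w < l ^ m"
        "\<bar>y - cocycle l lam F n (branch l n x w) - lam ^ n * y0\<bar> \<le> \<kappa> * lam ^ n * \<eta>"
      using cover p(2,3) unfolding box_cover_def n_def by blast
    define z where "z = branch l n x w"
    define y' where "y' = (y - cocycle l lam F n z) / lam ^ n"
    have "\<bar>y' - y0\<bar> = \<bar>y - cocycle l lam F n z - lam ^ n * y0\<bar> / lam ^ n"
    proof -
      have "y' - y0 = (y - cocycle l lam F n z - lam ^ n * y0) / lam ^ n"
        using lam by (simp add: y'_def diff_divide_distrib)
      then show ?thesis using lam by (simp add: abs_divide)
    qed
    also have "\<dots> \<le> \<kappa> * \<eta>"
      using w(2) lam by (simp add: z_def field_simps)
    also have "\<dots> \<le> \<eta>" using \<kappa> \<eta> by (simp add: mult_le_cancel_right1)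
    finally have y': "y' \<in> {y0 - \<eta>..y0 + \<eta>}" by auto
    have "x \<le> 1" using p(2) l by (auto intro: order_trans simp: divide_le_eq)
    moreover have "real w + 1 \<le> real l ^ m"
      using w(1) by (metis Suc_leI of_nat_Suc of_nat_le_iff of_nat_power add.commute)
    ultimately have "branch l n x w \<le> real l ^ m / real l ^ n"
      using l by (intro divide_right_mono) auto
    then have "z \<in> {0..1 / real l ^ q}"
      using p(2) l by (auto simp: z_def n_def power_add)
    with y' have "(to_circle z, y') \<in> K" by (auto simp: K_def)
    moreover have "(T ^^ n) (to_circle z, y') = p"
      using l lam by (simp add: T_def skew_map_funpow p(1) y'_def F_def z_def)
    ultimately show "p \<in> (T ^^ n) ` K" by blast
  qed
  have K_iter: "K \<subseteq> (T ^^ (i * n)) ` K" for i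
  proof (induction i)
    case (Suc i)
    have "K \<subseteq> (T ^^ n) ` K" by (rule K_step)
    also have "\<dots> \<subseteq> (T ^^ n) ` (T ^^ (i * n)) ` K" using Suc by blast
    also have "\<dots> = (T ^^ (Suc i * n)) ` K" by (simp add: funpow_add image_comp)
    finally show ?case .
  qed simp
  define R where "R = max (M / (1 - lam) + 1) (\<bar>y0\<bar> + \<eta>)"
  define B where "B = (UNIV :: circle set) \<times> {-R..R}"
  have KB: "K \<subseteq> B" by (auto simp: K_def B_def R_def)
  have TB: "T ` B \<subseteq> B"
    unfolding T_def B_def using lam M by (intro band_invariant) (auto simp: R_def)
  have "K \<subseteq> (T ^^ i) ` B" for i
  proof -
    have "K \<subseteq> (T ^^ (i * n)) ` B" using K_iter[of i] KB by blast
    also have "\<dots> \<subseteq> (T ^^ i) ` B"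
    proof (rule funpow_image_antimono[OF TB])
      have "n \<ge> 1" using mq unfolding n_def by linarith
      then show "i \<le> i * n" by simp
    qed
    finally show ?thesis .
  qed
  then have "K \<subseteq> maximal_attractor l lam f R"
    by (auto simp: maximal_attractor_def T_def B_def)
  moreover have "open (to_circle ` {0<..<1 / real l ^ q} \<times> {y0 - \<eta><..<y0 + \<eta>})"
    by (intro open_Times open_to_circle_image) auto
  moreover have "to_circle ` {0<..<1 / real l ^ q} \<times> {y0 - \<eta><..<y0 + \<eta>} \<subseteq> K"
    by (auto simp: K_def)
  ultimately have "to_circle ` {0<..<1 / real l ^ q} \<times> {y0 - \<eta><..<y0 + \<eta>} \<subseteq> interior (maximal_attractor l lam f R)"
    by (meson interior_maximal subset_trans)
  moreover have "to_circle ` {0<..<1 / real l ^ q} \<times> {y0 - \<eta><..<y0 + \<eta>} \<noteq> {}"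
  proof -
    have "0 < 1 / real l ^ q" using l by simp
    then have "{0<..<1 / real l ^ q} \<noteq> {}" by (simp only: greaterThanLessThan_empty_iff not_le)
    moreover have "y0 \<in> {y0 - \<eta><..<y0 + \<eta>}" using \<eta> by auto
    ultimately show ?thesis by blast
  qed
  ultimately show ?thesis
    by (intro exI[of _ R]) (auto simp: R_def)
qed

lemma recurrent_box_stable:
  assumes lam: "0 < lam" "lam < 1" and rec: "recurrent_box l lam F"
  shows "\<exists>\<epsilon>>0. \<forall>G. (\<forall>x. \<bar>G x - F x\<bar> \<le> \<epsilon>) \<longrightarrow> recurrent_box l lam G"
proof -
  obtain m q \<eta> y0 \<kappa> where "0 < \<eta> \<and> \<kappa> < 1 \<and> 0 < m + q \<and> box_cover l lam F m q \<eta> y0 \<kappa>"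
    using rec unfolding recurrent_box_def by meson
  then have \<eta>: "0 < \<eta>" and \<kappa>: "\<kappa> < 1" and mq: "0 < m + q"
    and cover: "box_cover l lam F m q \<eta> y0 \<kappa>" by simp_all
  define \<epsilon> where "\<epsilon> = (1 - lam) * ((1 - \<kappa>) / 2 * lam ^ (m + q) * \<eta>)"
  have "\<epsilon> > 0" using \<eta> \<kappa> lam by (simp add: \<epsilon>_def)
  moreover have "recurrent_box l lam G" if G: "\<forall>x. \<bar>G x - F x\<bar> \<le> \<epsilon>" for G
    unfolding recurrent_box_def
  proof (intro exI conjI)
    show "0 < \<eta>" "(1 + \<kappa>) / 2 < 1" "0 < m + q" using \<eta> \<kappa> mq by auto
    show "box_cover l lam G m q \<eta> y0 ((1 + \<kappa>) / 2)"
      unfolding box_cover_def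
    proof (intro ballI)
      fix x y assume xy: "x \<in> {0..1 / real l ^ q}" "y \<in> {y0 - \<eta>..y0 + \<eta>}"
      then obtain w where w: "w < l ^ m" "\<bar>y - cocycle l lam F (m + q) (branch l (m + q) x w) - lam ^ (m + q) * y0\<bar>
            \<le> \<kappa> * lam ^ (m + q) * \<eta>" using cover unfolding box_cover_def by blast
      have "cocycle l lam G n z - cocycle l lam F n z = cocycle l lam (\<lambda>x. G x - F x) n z" for n z
        by (simp add: cocycle_def sum_subtractf right_diff_distrib)
      then have "\<bar>cocycle l lam G n z - cocycle l lam F n z\<bar> \<le> \<epsilon> / (1 - lam)" for n z
        using norm_cocycle_le[of lam "\<lambda>x. G x - F x" \<epsilon>] lam G by simp
      moreover have "\<epsilon> / (1 - lam) = (1 - \<kappa>) / 2 * lam ^ (m + q) * \<eta>" using lam unfolding \<epsilon>_def by (subst nonzero_mult_div_cancel_left) auto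
      ultimately have "\<bar>cocycle l lam G n z - cocycle l lam F n z\<bar> \<le> (1 - \<kappa>) / 2 * lam ^ (m + q) * \<eta>" for n z
        by metis
      note this[of "m + q" "branch l (m + q) x w"]
      moreover have "(1 + \<kappa>) / 2 * lam ^ (m + q) * \<eta> = \<kappa> * lam ^ (m + q) * \<eta> + (1 - \<kappa>) / 2 * lam ^ (m + q) * \<eta>"
        by (simp add: field_simps)
      ultimately have "\<bar>y - cocycle l lam G (m + q) (branch l (m + q) x w) - lam ^ (m + q) * y0\<bar>
            \<le> (1 + \<kappa>) / 2 * lam ^ (m + q) * \<eta>" using w(2) by linarith
      then show "\<exists>w<l ^ m. \<bar>y - cocycle l lam G (m + q) (branch l (m + q) x w) - lam ^ (m + q) * y0\<bar>
            \<le> (1 + \<kappa>) / 2 * lam ^ (m + q) * \<eta>" using w(1) by blast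
    qed
  qed
  ultimately show ?thesis by blast
qed

section \<open>Transversality of trigonometric cocycles\<close>

text \<open>Returns of orbits on the circle are expressed on the real line as closeness to an integer.\<close>

definition near_int :: "real \<Rightarrow> real \<Rightarrow> bool"
  where "near_int e x \<longleftrightarrow> (\<exists>k::int. \<bar>x - of_int k\<bar> \<le> e)"

lemma near_int_add: "near_int a x \<Longrightarrow> near_int b y \<Longrightarrow> near_int (a + b) (x + y)"
proof -
  assume "near_int a x" "near_int b y"
  then obtain i j :: int where "\<bar>x - of_int i\<bar> \<le> a" "\<bar>y - of_int j\<bar> \<le> b"
    by (auto simp: near_int_def)
  then have "\<bar>(x + y) - of_int (i + j)\<bar> \<le> a + b" by simp
  then show ?thesis unfolding near_int_def by blast
qed

lemma near_int_minus: "near_int a x \<Longrightarrow> near_int a (- x)"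
proof -
  assume "near_int a x"
  then obtain i :: int where "\<bar>x - of_int i\<bar> \<le> a" by (auto simp: near_int_def)
  then have "\<bar>- x - of_int (- i)\<bar> \<le> a" by simp
  then show ?thesis unfolding near_int_def by blast
qed

lemma near_int_mult: "near_int a x \<Longrightarrow> near_int (real n * a) (real n * x)"
proof -
  assume "near_int a x"
  then obtain i :: int where "\<bar>x - of_int i\<bar> \<le> a" by (auto simp: near_int_def)
  then have "real n * \<bar>x - of_int i\<bar> \<le> real n * a" by (intro mult_left_mono) auto
  then have "\<bar>real n * x - of_int (int n * i)\<bar> \<le> real n * a"
    by (simp add: abs_mult flip: right_diff_distrib)
  then show ?thesis unfolding near_int_def by blast
qed

lemma near_int_mono: "near_int a x \<Longrightarrow> a \<le> b \<Longrightarrow> near_int b x"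
  by (auto simp: near_int_def intro: order_trans)

lemma near_int_Ints: "x \<in> \<int> \<Longrightarrow> near_int 0 x"
  by (auto simp: near_int_def elim: Ints_cases)

lemma near_int_iterate:
  assumes "near_int a (real l ^ p * x - x)" "a \<ge> 0" "l \<ge> 1"
  shows "near_int (real h * real l ^ (p * h) * a) (real l ^ (p * h) * x - x)"
proof (induction h)
  case 0
  show ?case by (simp add: near_int_Ints)
next
  case (Suc h)
  have "near_int (real (l ^ (p * h)) * a) (real (l ^ (p * h)) * (real l ^ p * x - x))"
    by (rule near_int_mult[OF assms(1)])
  from near_int_add[OF this Suc]
  have "near_int (real l ^ (p * h) * a + real h * real l ^ (p * h) * a) (real l ^ (p * Suc h) * x - x)"
    by (simp add: algebra_simps power_add)
  then show ?case
  proof (rule near_int_mono)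
    have "real l ^ (p * h) \<le> real l ^ (p * Suc h)"
      using assms(3) by (intro power_increasing) auto
    then have "(real h + 1) * a * real l ^ (p * h) \<le> (real h + 1) * a * real l ^ (p * Suc h)"
      using assms(2) by (intro mult_left_mono) auto
    then show "real l ^ (p * h) * a + real h * real l ^ (p * h) * a \<le> real (Suc h) * real l ^ (p * Suc h) * a"
      by (simp add: algebra_simps)
  qed
qed

text \<open>From \<open>l z = l z'\<close> modulo 1 it follows that \<open>z'\<close> is almost fixed by multiplication by
  \<open>l\<^sup>p\<close> and \<open>z\<close> by multiplication by \<open>l\<^sup>p\<^sup>'\<close>. Both are then almost fixed by multiplication by
  \<open>l\<close> to the power \<open>p p'\<close>, which sends them to the same point. So \<open>z\<close> and \<open>z'\<close> are close, whereas
  distinct preimages of a point are at distance at least \<open>1 / l\<close>.\<close>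

lemma no_mutual_return:
  assumes l: "l \<ge> 2" and p: "p \<ge> 1" "p \<le> P" "p' \<ge> 1" "p' \<le> P"
    and z: "real l * (z - z') \<in> \<int>" "z - z' \<notin> \<int>"
    and a: "a \<ge> 0" and ret: "near_int a (real l ^ p * z - z')" "near_int a (real l ^ p' * z' - z)"
  shows "1 \<le> 2 * real P * real l ^ (P * P + 1) * a"
proof -
  have same: "real l ^ q * (z - z') \<in> \<int>" if "q \<ge> 1" for q
  proof -
    have "real l ^ q * (z - z') = real (l ^ (q - 1)) * (real l * (z - z'))"
      using that by (cases q) auto
    then show ?thesis using z(1) by (metis Ints_mult Ints_of_nat)
  qed
  have 1: "near_int a (real l ^ p * z' - z')"
    using near_int_add[OF ret(1) near_int_minus[OF near_int_Ints[OF same[OF p(1)]]]]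
    by (simp add: algebra_simps)
  have 2: "near_int a (real l ^ p' * z - z)"
    using near_int_add[OF ret(2) near_int_Ints[OF same[OF p(3)]]]
    by (simp add: algebra_simps)
  let ?b = "real P * real l ^ (P * P) * a"
  have mono: "real h * real l ^ (i * h) * a \<le> ?b" if "h \<le> P" "i \<le> P" for h i
  proof -
    have "real l ^ (i * h) \<le> real l ^ (P * P)"
      using l that by (intro power_increasing mult_le_mono) auto
    then show ?thesis using that a by (intro mult_mono mult_right_mono) auto
  qed
  have "near_int ?b (real l ^ (p * p') * z' - z')"
    using near_int_iterate[OF 1 a, of p'] l mono[OF p(4) p(2)] near_int_mono by auto
  moreover have "near_int ?b (real l ^ (p * p') * z - z)"
    using near_int_iterate[OF 2 a, of p] l mono[OF p(2) p(4)] near_int_mono by (auto simp: mult.commute)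
  moreover have "real l ^ (p * p') * (z - z') \<in> \<int>"
    using p by (intro same) (simp add: Suc_leI)
  ultimately have "near_int (?b + (?b + 0)) (real l ^ (p * p') * z' - z' + (- (real l ^ (p * p') * z - z) + real l ^ (p * p') * (z - z')))"
    by (intro near_int_add near_int_minus near_int_Ints)
  then have "near_int (2 * ?b) (z - z')" by (simp add: algebra_simps)
  then obtain k :: int where k: "\<bar>(z - z') - of_int k\<bar> \<le> 2 * ?b" by (auto simp: near_int_def)
  obtain i where i: "real l * (z - z') = of_int i" using z(1) by (auto elim: Ints_cases)
  have "i - int l * k \<noteq> 0"
  proof
    assume "i - int l * k = 0"
    then have "i = int l * k" by simp
    then have "real l * (z - z') = real l * of_int k" using i by simp
    then have "z - z' = of_int k" using l by simp
    with z(2) show False by simp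
  qed
  then have "1 \<le> \<bar>real_of_int (i - int l * k)\<bar>" by linarith
  also have "real_of_int (i - int l * k) = real l * ((z - z') - of_int k)"
    using i by (simp add: algebra_simps)
  also have "\<bar>real l * ((z - z') - of_int k)\<bar> \<le> real l * (2 * ?b)"
    using k by (simp add: abs_mult mult_left_mono)
  finally show ?thesis by (simp add: algebra_simps)
qed

definition fourier_mode :: "int \<Rightarrow> real \<Rightarrow> complex"
  where "fourier_mode q x = cis (2 * pi * of_int q * x)"

text \<open>The even powers of \<open>cos (\<pi> x)\<close> are a bump at the integers, and a convex combination of
  Fourier modes. Convexity is what allows a gap for the bump to be passed on to one of the modes.\<close>

lemma cos_power_expansion:
  "complex_of_real (cos (pi * x) ^ (2 * N)) =
     (\<Sum>j\<le>2 * N. of_real (real (2 * N choose j) / 4 ^ N) * fourier_mode (int j - int N) x)"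
proof -
  have c: "complex_of_real (cos (pi * x)) = (cis (pi * x) + cis (- (pi * x))) / 2"
    by (simp add: complex_eq_iff)
  have "complex_of_real (cos (pi * x) ^ (2 * N)) = (cis (pi * x) + cis (- (pi * x))) ^ (2 * N) / 2 ^ (2 * N)"
    by (simp add: c power_divide)
  also have "(cis (pi * x) + cis (- (pi * x))) ^ (2 * N) =
      (\<Sum>j\<le>2 * N. of_nat (2 * N choose j) * cis (pi * x) ^ j * cis (- (pi * x)) ^ (2 * N - j))"
    by (rule binomial_ring)
  also have "\<dots> = (\<Sum>j\<le>2 * N. of_nat (2 * N choose j) * fourier_mode (int j - int N) x)"
  proof (rule sum.cong)
    fix j assume "j \<in> {..2 * N}"
    then have j: "real (2 * N - j) = 2 * real N - real j" by (simp add: of_nat_diff)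
    have "cis (pi * x) ^ j * cis (- (pi * x)) ^ (2 * N - j) = fourier_mode (int j - int N) x"
    proof -
      have "cis (pi * x) ^ j * cis (- (pi * x)) ^ (2 * N - j) = cis (real j * (pi * x) + real (2 * N - j) * - (pi * x))"
        by (simp only: Complex.DeMoivre cis_mult)
      also have "real j * (pi * x) + real (2 * N - j) * - (pi * x) = 2 * pi * of_int (int j - int N) * x"
        unfolding j by (simp add: algebra_simps)
      finally show ?thesis unfolding fourier_mode_def .
    qed
    then show "of_nat (2 * N choose j) * cis (pi * x) ^ j * cis (- (pi * x)) ^ (2 * N - j) =
        of_nat (2 * N choose j) * fourier_mode (int j - int N) x"
      by (simp add: mult.assoc)
  qed simp
  finally show ?thesis
    by (simp add: sum_divide_distrib power_mult)
qed

lemma sum_central_binomial: "(\<Sum>j\<le>2 * N. real (2 * N choose j) / 4 ^ N) = 1"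
proof -
  have "(\<Sum>j\<le>2 * N. real (2 * N choose j)) = 4 ^ N"
    using choose_row_sum[of "2 * N"] by (simp add: power_mult flip: of_nat_sum)
  then show ?thesis by (simp flip: sum_divide_distrib)
qed

lemma cos_power_small_off_int:
  assumes "0 < e" "e \<le> 1 / 2" "\<not> near_int e x"
  shows "cos (pi * x) ^ (2 * N) \<le> cos (pi * e) ^ (2 * N)"
proof -
  define y where "y = \<bar>x - of_int (round x)\<bar>"
  have y: "e < y" "y \<le> 1 / 2"
    using assms(3) of_int_round_abs_le[of x] unfolding near_int_def y_def
    by (auto simp: not_le abs_minus_commute)
  have "sin (pi * of_int (round x)) = 0" "\<bar>cos (pi * of_int (round x))\<bar> = 1"
    using sin_int_times_real
    by (auto simp: sin_zero_iff_int2 mult.commute cos_int_times_real)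
  then have "\<bar>cos (pi * x)\<bar> = \<bar>cos (pi * (x - of_int (round x)))\<bar>"
    by (simp add: right_diff_distrib cos_diff abs_mult)
  also have "\<dots> = \<bar>cos (pi * y)\<bar>" unfolding y_def by (cases "x - of_int (round x) \<ge> 0") (auto simp: right_diff_distrib cos_diff)
  also have "\<dots> = cos (pi * y)" using y assms by (intro abs_of_nonneg cos_ge_zero) (auto intro: order_trans[of _ 0])
  also have "\<dots> \<le> cos (pi * e)"
    using y assms by (intro cos_monotone_0_pi_le) auto
  finally have "\<bar>cos (pi * x)\<bar> ^ (2 * N) \<le> cos (pi * e) ^ (2 * N)"
    by (intro power_mono) auto
  then show ?thesis by (simp add: power_mult)
qed


text \<open>The bump is centred at \<open>z\<^sub>1\<close>, the last point of the orbit of \<open>z\<close>. The term of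
  \<open>z\<^sub>1\<close> contributes 1 to the first cocycle and all other terms are nonnegative. In the second cocycle
  the last \<open>P\<close> terms are small as their points are far from \<open>z\<^sub>1\<close>, and the earlier ones have
  total weight at most \<open>1 / 4\<close>.\<close>

lemma cocycle_cos_power_gap:
  assumes l: "l \<ge> 2" and lam: "0 < lam" "lam < 1"
    and P: "lam ^ P / (1 - lam) \<le> 1 / 4"
    and e: "0 < e" "e \<le> 1 / 2" and N: "cos (pi * e) ^ (2 * N) / (1 - lam) \<le> 1 / 4"
    and m: "m \<ge> 1" and far: "\<And>p. p < P \<Longrightarrow> p < m \<Longrightarrow> \<not> near_int e (real l ^ (m - 1 - p) * z' - real l ^ (m - 1) * z)"
  defines "G \<equiv> (\<lambda>x. cos (pi * (x - real l ^ (m - 1) * z)) ^ (2 * N))"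
  shows "1 / 2 \<le> cocycle l lam G m z - cocycle l lam G m z'"
proof -
  have G0: "0 \<le> G x" "G x \<le> 1" for x
  proof -
    have sq: "G x = ((cos (pi * (x - real l ^ (m - 1) * z)))\<^sup>2) ^ N" by (simp add: G_def power_mult)
    show "0 \<le> G x" unfolding sq by (rule zero_le_power) simp
    show "G x \<le> 1" unfolding sq by (rule power_le_one) (simp_all add: abs_square_le_1)
  qed
  have "lam ^ (m - 1 - (m - 1)) *\<^sub>R G (real l ^ (m - 1) * z) \<le> cocycle l lam G m z"
    unfolding cocycle_def using m lam G0
    by (intro member_le_sum) auto
  then have 1: "1 \<le> cocycle l lam G m z" by (simp add: G_def)
  have "cocycle l lam G m z' \<le> (\<Sum>i<m. lam ^ (m - 1 - i) * (cos (pi * e) ^ (2 * N)) + (if i < m - P then lam ^ (m - 1 - i) else 0))"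
    unfolding cocycle_def real_scaleR_def
  proof (rule sum_mono)
    fix i assume i: "i \<in> {..<m}"
    show "lam ^ (m - 1 - i) * G (real l ^ i * z') \<le> lam ^ (m - 1 - i) * (cos (pi * e) ^ (2 * N)) + (if i < m - P then lam ^ (m - 1 - i) else 0)"
    proof (cases "i < m - P")
      case True
      have "lam ^ (m - 1 - i) * G (real l ^ i * z') \<le> lam ^ (m - 1 - i) * 1"
        using lam G0 by (intro mult_left_mono) auto
      moreover have "0 \<le> lam ^ (m - 1 - i) * (cos (pi * e) ^ (2 * N))"
        using lam by (intro mult_nonneg_nonneg) (auto simp: power_mult)
      ultimately show ?thesis using True by simp
    next
      case False
      have "m - 1 - (m - 1 - i) = i" "m - 1 - i < P" "m - 1 - i < m" using False i by auto
      then have "\<not> near_int e (real l ^ i * z' - real l ^ (m - 1) * z)"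
        using far[of "m - 1 - i"] by simp
      then have "G (real l ^ i * z') \<le> cos (pi * e) ^ (2 * N)"
        unfolding G_def using e by (intro cos_power_small_off_int) auto
      then show ?thesis using False lam by (simp add: mult_left_mono)
    qed
  qed
  also have "\<dots> = (\<Sum>i<m. lam ^ (m - 1 - i)) * cos (pi * e) ^ (2 * N) + (\<Sum>i<m - P. lam ^ (m - 1 - i))"
  proof -
    have "(\<Sum>i<m. if i < m - P then lam ^ (m - 1 - i) else 0) = (\<Sum>i<m - P. lam ^ (m - 1 - i))"
      by (rule sum.mono_neutral_cong_right) auto
    then show ?thesis by (simp add: sum.distrib sum_distrib_right)
  qed
  also have "(\<Sum>i<m - P. lam ^ (m - 1 - i)) = lam ^ P * (\<Sum>i<m - P. lam ^ (m - P - 1 - i))"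
    unfolding sum_distrib_left
  proof (rule sum.cong)
    fix i assume "i \<in> {..<m - P}"
    then have "m - 1 - i = P + (m - P - 1 - i)" by auto
    then show "lam ^ (m - 1 - i) = lam ^ P * lam ^ (m - P - 1 - i)" by (simp add: power_add)
  qed simp
  also have "(\<Sum>i<m. lam ^ (m - 1 - i)) * cos (pi * e) ^ (2 * N) + lam ^ P * (\<Sum>i<m - P. lam ^ (m - P - 1 - i))
      \<le> 1 / (1 - lam) * cos (pi * e) ^ (2 * N) + lam ^ P * (1 / (1 - lam))"
    using lam
    by (intro add_mono mult_right_mono mult_left_mono sum_geometric_reversed_le) (auto simp: power_mult)
  also have "\<dots> = cos (pi * e) ^ (2 * N) / (1 - lam) + lam ^ P / (1 - lam)" by simp
  also have "\<dots> \<le> 1 / 2" using P N by linarith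
  finally show ?thesis using 1 by simp
qed

lemma ex_mode_gap_of_kernel_gap:
  assumes gap: "1 / 2 \<le> cocycle l lam (\<lambda>x. cos (pi * (x - c)) ^ (2 * N)) m z - cocycle l lam (\<lambda>x. cos (pi * (x - c)) ^ (2 * N)) m z'"
  shows "\<exists>q. \<bar>q\<bar> \<le> int N \<and> 1 / 2 \<le> cmod (cocycle l lam (fourier_mode q) m z - cocycle l lam (fourier_mode q) m z')"
proof (rule ccontr)
  assume *: "\<not> ?thesis"
  define b where "b j = real (2 * N choose j) / 4 ^ N" for j
  define D where "D q = cocycle l lam (fourier_mode q) m z - cocycle l lam (fourier_mode q) m z'" for q
  have mode: "fourier_mode q (x - c) = fourier_mode q x * fourier_mode q (- c)" for q x
    by (simp add: fourier_mode_def cis_mult algebra_simps)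
  have exp: "complex_of_real (cocycle l lam (\<lambda>x. cos (pi * (x - c)) ^ (2 * N)) m z) =
      (\<Sum>j\<le>2 * N. of_real (b j) * fourier_mode (int j - int N) (- c) * cocycle l lam (fourier_mode (int j - int N)) m z)" for z
  proof -
    have "complex_of_real (cocycle l lam (\<lambda>x. cos (pi * (x - c)) ^ (2 * N)) m z) =
       (\<Sum>i<m. \<Sum>j\<le>2 * N. of_real (lam ^ (m - 1 - i)) * (of_real (b j) * (fourier_mode (int j - int N) (real l ^ i * z) * fourier_mode (int j - int N) (- c))))"
      unfolding cocycle_def of_real_sum real_scaleR_def of_real_mult cos_power_expansion b_def[symmetric] mode sum_distrib_left ..
    also have "\<dots> = (\<Sum>j\<le>2 * N. \<Sum>i<m. of_real (lam ^ (m - 1 - i)) * (of_real (b j) * (fourier_mode (int j - int N) (real l ^ i * z) * fourier_mode (int j - int N) (- c))))"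
      by (rule sum.swap)
    finally show ?thesis
      by (simp add: cocycle_def sum_distrib_left scaleR_conv_of_real mult_ac)
  qed
  have "1 / 2 \<le> cmod (complex_of_real (cocycle l lam (\<lambda>x. cos (pi * (x - c)) ^ (2 * N)) m z) - complex_of_real (cocycle l lam (\<lambda>x. cos (pi * (x - c)) ^ (2 * N)) m z'))"
    using gap by (simp flip: of_real_diff)
  also have "\<dots> = cmod (\<Sum>j\<le>2 * N. of_real (b j) * fourier_mode (int j - int N) (- c) * D (int j - int N))"
    unfolding exp D_def by (simp add: sum_subtractf right_diff_distrib)
  also have "\<dots> \<le> (\<Sum>j\<le>2 * N. b j * cmod (D (int j - int N)))"
    by (rule sum_norm_le) (simp add: norm_mult norm_divide norm_power b_def fourier_mode_def)
  also have "\<dots> < (\<Sum>j\<le>2 * N. b j * (1 / 2))"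
  proof (rule sum_strict_mono)
    fix j assume "j \<in> {..2 * N}"
    then have "\<bar>int j - int N\<bar> \<le> int N" "b j > 0" by (auto simp: b_def)
    moreover have "cmod (D q) < 1 / 2" if "\<bar>q\<bar> \<le> int N" for q
      using that * unfolding D_def by (meson not_le)
    ultimately show "b j * cmod (D (int j - int N)) < b j * (1 / 2)"
      by (intro mult_strict_left_mono)
  qed auto
  also have "\<dots> = (\<Sum>j\<le>2 * N. b j) * (1 / 2)" by (rule sum_distrib_right[symmetric])
  also have "\<dots> = 1 / 2" using sum_central_binomial[of N] unfolding b_def by simp
  finally show False by simp
qed

text \<open>A bump centred at the last point of one of the two orbits shows a gap unless the other orbit
  recently came close to this point. If this fails for both orbits, they return to each other's
  end points, which is excluded by \<open>no_mutual_return\<close>.\<close>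

theorem cocycle_fourier_transversal:
  assumes l: "l \<ge> 2" and lam: "0 < lam" "lam < 1"
  shows "\<exists>N. \<forall>m z z'. m \<ge> 1 \<longrightarrow> real l ^ m * (z - z') \<in> \<int> \<longrightarrow> real l ^ (m - 1) * (z - z') \<notin> \<int> \<longrightarrow>
    (\<exists>q. \<bar>q\<bar> \<le> int N \<and> 1 / 2 \<le> cmod (cocycle l lam (fourier_mode q) m z - cocycle l lam (fourier_mode q) m z'))"
proof -
  have "(\<lambda>P. lam ^ P) \<longlonglongrightarrow> 0" using lam by (intro LIMSEQ_power_zero) auto
  then have "eventually (\<lambda>P. lam ^ P < (1 - lam) / 4) sequentially"
    using lam by (intro order_tendstoD) auto
  then obtain P where "lam ^ P < (1 - lam) / 4" by (auto simp: eventually_sequentially)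
  then have P: "lam ^ P / (1 - lam) \<le> 1 / 4" using lam by (simp add: field_simps)
  \<comment> \<open>The radius \<open>e = 1 / (2 Q)\<close> is small enough for \<open>no_mutual_return\<close> (first term) and to exclude a return at time 0 (second term).\<close>
  define Q where "Q = real l ^ P * (2 * real (P + 1) * real l ^ (P * P + 1)) + 2 * real l"
  have Q: "Q \<ge> 4" using l by (simp add: Q_def add_increasing)
  define e where "e = 1 / (2 * Q)"
  have e: "0 < e" "e \<le> 1 / 2" using Q by (auto simp: e_def divide_le_eq)
  have Qe: "Q * e = 1 / 2" using Q by (simp add: e_def)
  have "\<bar>cos (pi * e)\<bar> < 1"
  proof -
    have "cos (pi * e) < cos 0" using e by (intro cos_monotone_0_pi) (auto intro: order.trans[of _ "pi * (1/2)"])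
    moreover have "cos (pi * e) \<ge> 0"
      using e by (intro cos_ge_zero) (auto intro: order_trans[of _ 0])
    ultimately show ?thesis by simp
  qed
  then have "(\<lambda>N. ((cos (pi * e))\<^sup>2) ^ N) \<longlonglongrightarrow> 0"
    by (intro LIMSEQ_power_zero) (simp add: power_abs[symmetric] abs_square_less_1)
  then have "eventually (\<lambda>N. ((cos (pi * e))\<^sup>2) ^ N < (1 - lam) / 4) sequentially"
    using lam by (intro order_tendstoD) auto
  then obtain N where "((cos (pi * e))\<^sup>2) ^ N < (1 - lam) / 4" by (auto simp: eventually_sequentially)
  then have N: "cos (pi * e) ^ (2 * N) / (1 - lam) \<le> 1 / 4"
    using lam unfolding power_mult by (simp add: divide_le_eq)
  show ?thesis
  proof (intro exI[of _ N] allI impI)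
    fix m :: nat and z z' :: real
    assume m: "m \<ge> 1" and zz: "real l ^ m * (z - z') \<in> \<int>" "real l ^ (m - 1) * (z - z') \<notin> \<int>"
    let ?goal = "\<exists>q. \<bar>q\<bar> \<le> int N \<and> 1 / 2 \<le> cmod (cocycle l lam (fourier_mode q) m z - cocycle l lam (fourier_mode q) m z')"
    define u u' where "u = real l ^ (m - 1) * z" and "u' = real l ^ (m - 1) * z'"
    have u: "real l * (u - u') \<in> \<int>" "u - u' \<notin> \<int>"
    proof -
      obtain k where k: "m = Suc k" using m by (cases m) auto
      have eq: "real l * (u - u') = real l ^ m * (z - z')" "u - u' = real l ^ (m - 1) * (z - z')"
        by (simp_all add: u_def u'_def k algebra_simps)
      show "real l * (u - u') \<in> \<int>" unfolding eq(1) by (rule zz(1))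
      show "u - u' \<notin> \<int>" unfolding eq(2) by (rule zz(2))
    qed
    have return: "p \<ge> 1 \<and> near_int (real l ^ P * e) (real l ^ p * w - w')"
      if near: "near_int e (real l ^ (m - 1 - p) * v - real l ^ (m - 1) * v')" and p: "p < P" "p < m"
        and w: "w = real l ^ (m - 1) * v'" "w' = real l ^ (m - 1) * v"
        and w': "real l * (w - w') \<in> \<int>" "w - w' \<notin> \<int>" for p v v' w w'
    proof -
      have "near_int (real (l ^ p) * e) (real (l ^ p) * (real l ^ (m - 1 - p) * v - real l ^ (m - 1) * v'))"
        using near by (rule near_int_mult)
      moreover have "real (l ^ p) * (real l ^ (m - 1 - p) * v - real l ^ (m - 1) * v') = w' - real l ^ p * w"
      proof -
        have "real l ^ p * real l ^ (m - 1 - p) = real l ^ (m - 1)"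
          using p by (simp flip: power_add)
        then show ?thesis using w by (simp add: right_diff_distrib mult.assoc[symmetric])
      qed
      ultimately have ni: "near_int (real l ^ p * e) (w' - real l ^ p * w)" by simp
      have "near_int (real l ^ p * e) (real l ^ p * w - w')"
        using near_int_minus[OF ni] by simp
      moreover have "real l ^ p * e \<le> real l ^ P * e"
        using p l e by (intro mult_right_mono power_increasing) auto
      ultimately have "near_int (real l ^ P * e) (real l ^ p * w - w')" by (rule near_int_mono)
      moreover have "p \<noteq> 0"
      proof
        assume "p = 0"
        then have "near_int e (w - w')" using near_int_minus[OF near] w by simp
        then obtain k :: int where k: "\<bar>w - w' - of_int k\<bar> \<le> e" by (auto simp: near_int_def)
        obtain i where i: "real l * (w - w') = of_int i" using w'(1) by (auto elim: Ints_cases)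
        have "i \<noteq> int l * k"
        proof
          assume "i = int l * k"
          then have "real l * (w - w') = real l * of_int k" using i by simp
          then have "w - w' = of_int k" using l by simp
          with w'(2) show False by simp
        qed
        then have "1 \<le> \<bar>real_of_int (i - int l * k)\<bar>" by linarith
        also have "real_of_int (i - int l * k) = real l * (w - w' - of_int k)"
          using i by (simp add: algebra_simps)
        also have "\<bar>real l * (w - w' - of_int k)\<bar> \<le> real l * e"
          using k by (simp add: abs_mult mult_left_mono)
        finally have "1 \<le> real l * e" .
        moreover have "2 * real l * e \<le> Q * e"
          using e by (intro mult_right_mono) (auto simp: Q_def)
        ultimately show False using Qe by simp
      qed
      ultimately show ?thesis by simp
    qed
    show ?goal
    proof (cases "\<forall>p. p < P \<longrightarrow> p < m \<longrightarrow> \<not> near_int e (real l ^ (m - 1 - p) * z' - real l ^ (m - 1) * z)")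
      case True
      then show ?thesis
        by (intro ex_mode_gap_of_kernel_gap[OF cocycle_cos_power_gap[OF l lam P e N m]]) blast
    next
      case False
      then obtain p where p: "p < P" "p < m" "near_int e (real l ^ (m - 1 - p) * z' - real l ^ (m - 1) * z)" by blast
      show ?thesis
      proof (cases "\<forall>p. p < P \<longrightarrow> p < m \<longrightarrow> \<not> near_int e (real l ^ (m - 1 - p) * z - real l ^ (m - 1) * z')")
        case True
        then have "\<exists>q. \<bar>q\<bar> \<le> int N \<and> 1 / 2 \<le> cmod (cocycle l lam (fourier_mode q) m z' - cocycle l lam (fourier_mode q) m z)"
          by (intro ex_mode_gap_of_kernel_gap[OF cocycle_cos_power_gap[OF l lam P e N m]]) blast
        then show ?thesis by (simp add: norm_minus_commute)
      next
        case False
        then obtain p' where p': "p' < P" "p' < m" "near_int e (real l ^ (m - 1 - p') * z - real l ^ (m - 1) * z')" by blast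
        have u'': "real l * (u' - u) \<in> \<int>" "u' - u \<notin> \<int>"
          using u Ints_minus[of "real l * (u - u')"] Ints_minus[of "u' - u"] by (auto simp: algebra_simps)
        have r: "p \<ge> 1" "near_int (real l ^ P * e) (real l ^ p * u - u')"
          using return[OF p(3,1,2) u_def u'_def u] by auto
        have r': "p' \<ge> 1" "near_int (real l ^ P * e) (real l ^ p' * u' - u)"
          using return[OF p'(3,1,2) u'_def u_def u''] by auto
        have "1 \<le> 2 * real P * real l ^ (P * P + 1) * (real l ^ P * e)"
          using p p' r r' e by (intro no_mutual_return[OF l r(1) _ r'(1) _ u]) auto
        also have "\<dots> \<le> Q * e"
          using e by (simp add: Q_def algebra_simps)
        finally show ?thesis using Qe by simp
      qed
    qed
  qed
qed

section \<open>A Sobolev bound\<close>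

text \<open>The weight \<open>\<theta>\<close> balances a function of frequency \<open>\<theta>\<close>: its derivative is of order \<open>\<theta>\<close>, so
  that both terms of the integrand have order \<open>\<theta> |c|\<^sup>2\<close>.\<close>

lemma sobolev_sup_bound:
  fixes c c' :: "real \<Rightarrow> complex"
  assumes c: "\<And>x. (c has_vector_derivative c' x) (at x)"
    and cont: "continuous_on UNIV c'" and \<theta>: "\<theta> > 0" and x: "x \<in> {0..1}"
  shows "(cmod (c x))\<^sup>2 \<le> integral {0..1} (\<lambda>s. (1 + \<theta>) * (cmod (c s))\<^sup>2 + (cmod (c' s))\<^sup>2 / \<theta>)"
proof -
  have contc: "continuous_on UNIV c"
    by (intro continuous_at_imp_continuous_on ballI has_vector_derivative_continuous[OF c])
  note cc[continuous_intros] = continuous_on_subset[OF contc subset_UNIV] continuous_on_subset[OF cont subset_UNIV]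
  define g where "g s = (cmod (c s))\<^sup>2" for s
  define g' where "g' s = 2 * (c s \<bullet> c' s)" for s
  define h where "h s = \<theta> * (cmod (c s))\<^sup>2 + (cmod (c' s))\<^sup>2 / \<theta>" for s
  have g': "(g has_real_derivative g' s) (at s)" for s
  proof -
    have "((\<lambda>s. c s \<bullet> c s) has_derivative (\<lambda>h. c s \<bullet> (h *\<^sub>R c' s) + (h *\<^sub>R c' s) \<bullet> c s)) (at s)"
      using c[of s, unfolded has_vector_derivative_def] by (intro has_derivative_inner)
    moreover have "g = (\<lambda>s. c s \<bullet> c s)" by (simp add: g_def[abs_def] power2_norm_eq_inner)
    moreover have "(\<lambda>h. c s \<bullet> (h *\<^sub>R c' s) + (h *\<^sub>R c' s) \<bullet> c s) = (*) (g' s)"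
      by (simp add: fun_eq_iff g'_def inner_commute)
    ultimately show ?thesis by (simp add: has_field_derivative_def)
  qed
  have g'h: "\<bar>g' s\<bar> \<le> h s" for s
  proof -
    have "\<bar>g' s\<bar> \<le> 2 * (cmod (c s) * cmod (c' s))"
      using Cauchy_Schwarz_ineq2[of "c s" "c' s"] by (simp add: g'_def)
    also have "\<dots> \<le> h s"
    proof -
      have "0 \<le> (\<theta> * cmod (c s) - cmod (c' s))\<^sup>2 / \<theta>" using \<theta> by simp
      also have "\<dots> = h s - 2 * (cmod (c s) * cmod (c' s))"
        using \<theta> by (simp add: h_def power2_eq_square field_simps)
      finally show ?thesis by simp
    qed
    finally show ?thesis .
  qed
  have h0: "h s \<ge> 0" for s using \<theta> by (simp add: h_def)
  have int_h: "h integrable_on {a..b}" for a b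
    unfolding h_def using \<theta> by (intro integrable_continuous_interval continuous_intros) auto
  have int_g: "g integrable_on {a..b}" for a b
    unfolding g_def by (intro integrable_continuous_interval continuous_intros)
  have step: "g x \<le> g s + integral {0..1} h" if s: "s \<in> {0..1}" for s
  proof -
    have ftc: "\<bar>g b - g a\<bar> \<le> integral {0..1} h" if ab: "a \<le> b" "0 \<le> a" "b \<le> 1" for a b
    proof -
      have "(g' has_integral (g b - g a)) {a..b}"
        using ab g' by (intro fundamental_theorem_of_calculus)
          (auto simp: has_real_derivative_iff_has_vector_derivative[symmetric] intro: has_field_derivative_at_within)
      then have "norm (g b - g a) \<le> integral {a..b} h"
        using int_h g'h by (metis has_integral_iff integral_norm_bound_integral real_norm_def)
      also have "\<dots> \<le> integral {0..1} h"
        using ab int_h h0 by (intro integral_subset_le) auto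
      finally show ?thesis by simp
    qed
    show ?thesis using ftc[of s x] ftc[of x s] s x by (cases "s \<le> x") auto
  qed
  have "integral {0..1} (\<lambda>s::real. g x) \<le> integral {0..1} (\<lambda>s. g s + integral {0..1} h)"
  proof (rule Henstock_Kurzweil_Integration.integral_le)
    show "(\<lambda>s. g s + integral {0..1} h) integrable_on {0..1}"
      using int_g by (intro Henstock_Kurzweil_Integration.integrable_add) auto
  qed (use step in auto)
  also have "\<dots> = integral {0..1} g + integral {0..1} (\<lambda>s::real. integral {0..1} h)"
    using int_g by (intro Henstock_Kurzweil_Integration.integral_add) auto
  finally have "g x \<le> integral {0..1} g + integral {0..1} h" by simp
  also have "\<dots> = integral {0..1} (\<lambda>s. g s + h s)"
    using int_g int_h by (simp add: Henstock_Kurzweil_Integration.integral_add)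
  finally show ?thesis by (simp add: g_def h_def algebra_simps)
qed

section \<open>Exponential sums over a parameter grid\<close>

lemma abs_sin_ge_half:
  assumes "\<bar>x\<bar> \<le> pi / 2"
  shows "\<bar>x\<bar> / 2 \<le> \<bar>sin x\<bar>"
proof -
  have pos: "y / 2 \<le> sin y" if y: "0 \<le> y" "y \<le> pi / 2" for y
  proof (cases "y \<le> pi / 3")
    case True
    show ?thesis
    proof (cases "y = 0")
      case False
      then have "\<exists>z. 0 < z \<and> z < y \<and> sin y - sin 0 = (y - 0) * cos z"
        using y by (intro MVT2) (auto intro!: derivative_eq_intros)
      then obtain z where z: "0 < z" "z < y" "sin y = y * cos z" by auto
      have "cos (pi / 3) \<le> cos z" using z True by (intro cos_monotone_0_pi_le) auto
      then have "1 / 2 \<le> cos z" by (simp add: cos_60)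
      then have "y * (1 / 2) \<le> y * cos z" using y by (intro mult_left_mono)
      then show ?thesis using z by simp
    qed simp
  next
    case False
    then have "sin (pi / 3) \<le> sin y" using y by (intro sin_monotone_2pi_le) auto
    then have "sqrt 3 / 2 \<le> sin y" by (simp add: sin_60)
    moreover have "17 / 10 \<le> sqrt 3" by (rule real_le_rsqrt) (simp add: power2_eq_square)
    moreover have "pi \<le> 32 / 10" using pi_approx by simp
    ultimately show ?thesis using y by linarith
  qed
  show ?thesis
    using pos[of "\<bar>x\<bar>"] assms by (cases "x \<ge> 0") auto
qed

lemma norm_one_minus_cis: "cmod (1 - cis b) = 2 * \<bar>sin (b / 2)\<bar>"
proof -
  have "(cmod (1 - cis b))\<^sup>2 = (1 - cos b)\<^sup>2 + (sin b)\<^sup>2" by (simp add: cmod_power2)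
  also have "\<dots> = 2 - 2 * cos b" using sin_cos_squared_add[of b] by (simp add: power2_eq_square algebra_simps)
  also have "\<dots> = (2 * \<bar>sin (b / 2)\<bar>)\<^sup>2"
    using cos_double_sin[of "b / 2"] by (simp add: power_mult_distrib)
  finally show ?thesis by (rule power2_eq_imp_eq) auto
qed

lemma norm_sum_cis_le:
  assumes "0 < \<bar>b\<bar>" "\<bar>b\<bar> \<le> pi"
  shows "cmod (\<Sum>h<H. cis (real h * b)) \<le> 4 / \<bar>b\<bar>"
proof -
  have gap: "\<bar>b\<bar> / 2 \<le> cmod (1 - cis b)"
    using abs_sin_ge_half[of "b / 2"] assms by (simp add: norm_one_minus_cis)
  then have ne: "cis b \<noteq> 1" using assms by auto
  have "(\<Sum>h<H. cis (real h * b)) = (\<Sum>h<H. cis b ^ h)" by (simp add: Complex.DeMoivre)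
  also have "\<dots> = (1 - cis b ^ H) / (1 - cis b)"
    using ne by (simp add: sum_gp_strict)
  finally have "cmod (\<Sum>h<H. cis (real h * b)) = cmod (1 - cis b ^ H) / cmod (1 - cis b)"
    by (simp add: norm_divide)
  also have "\<dots> \<le> 2 / (\<bar>b\<bar> / 2)"
  proof (rule frac_le)
    show "cmod (1 - cis b ^ H) \<le> 2"
      using norm_triangle_ineq4[of 1 "cis b ^ H"] by (simp add: norm_power)
  qed (use gap assms in auto)
  finally show ?thesis by simp
qed

text \<open>The mean of a phase that is affine in independent uniform parameters is a product over the
  parameters. Only those in \<open>J\<close> are used, the other factors are at most 1. Uniform distribution on
  a finite grid serves as well as on an interval as long as the step \<open>b i\<close> is at most \<open>\<pi>\<close>.\<close>

lemma norm_sum_PiE_cis_le: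
  fixes b :: "'i \<Rightarrow> real"
  assumes I: "finite I" "J \<subseteq> I" and H: "H > 0" and b: "\<And>i. i \<in> J \<Longrightarrow> 0 < \<bar>b i\<bar> \<and> \<bar>b i\<bar> \<le> pi"
  shows "cmod (\<Sum>t\<in>PiE I (\<lambda>_. {..<H}). cis (D + (\<Sum>i\<in>I. real (t i) * b i)))
       \<le> real H ^ card I * (\<Prod>i\<in>J. 4 / (real H * \<bar>b i\<bar>))"
proof -
  have cis_sum: "cis (\<Sum>i\<in>I. g i) = (\<Prod>i\<in>I. cis (g i))" for g :: "'i \<Rightarrow> real"
    using I(1) by (induction rule: finite_induct) (simp_all add: cis_mult[symmetric])
  have "(\<Sum>t\<in>PiE I (\<lambda>_. {..<H}). cis (D + (\<Sum>i\<in>I. real (t i) * b i)))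
      = cis D * (\<Sum>t\<in>PiE I (\<lambda>_. {..<H}). \<Prod>i\<in>I. cis (real (t i) * b i))"
    by (simp add: cis_mult[symmetric] cis_sum sum_distrib_left)
  also have "(\<Sum>t\<in>PiE I (\<lambda>_. {..<H}). \<Prod>i\<in>I. cis (real (t i) * b i)) = (\<Prod>i\<in>I. \<Sum>h<H. cis (real h * b i))"
    using I(1) by (subst prod_sum_PiE) auto
  finally have "cmod (\<Sum>t\<in>PiE I (\<lambda>_. {..<H}). cis (D + (\<Sum>i\<in>I. real (t i) * b i)))
      = (\<Prod>i\<in>I. cmod (\<Sum>h<H. cis (real h * b i)))"
    by (simp add: norm_mult prod_norm)
  also have "\<dots> \<le> (\<Prod>i\<in>I. real H * (if i \<in> J then 4 / (real H * \<bar>b i\<bar>) else 1))"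
  proof (rule prod_mono)
    fix i assume "i \<in> I"
    show "0 \<le> cmod (\<Sum>h<H. cis (real h * b i)) \<and> cmod (\<Sum>h<H. cis (real h * b i)) \<le> real H * (if i \<in> J then 4 / (real H * \<bar>b i\<bar>) else 1)"
    proof (cases "i \<in> J")
      case True
      then show ?thesis using norm_sum_cis_le[of "b i" H] b[of i] H by simp
    next
      case False
      then show ?thesis using norm_sum[of "\<lambda>h. cis (real h * b i)" "{..<H}"] by simp
    qed
  qed
  also have "\<dots> = real H ^ card I * (\<Prod>i\<in>J. 4 / (real H * \<bar>b i\<bar>))"
    using I by (simp add: prod.distrib prod.If_cases Int_absorb1)
  finally show ?thesis .
qed

section \<open>Counting pairs of inverse branches\<close>

lemma card_residue_class_le:
  fixes l m k r :: nat
  assumes "l > 0" "k \<le> m"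
  shows "card {v. v < l ^ m \<and> v mod l ^ k = r} \<le> l ^ (m - k)"
proof -
  let ?A = "{v. v < l ^ m \<and> v mod l ^ k = r}"
  have "inj_on (\<lambda>v. v div l ^ k) ?A"
  proof (rule inj_onI)
    fix v w assume "v \<in> ?A" "w \<in> ?A" and div: "v div l ^ k = w div l ^ k"
    then have "v mod l ^ k = r" "w mod l ^ k = r" by blast+
    then show "v = w" using div_mult_mod_eq[of v "l ^ k"] div_mult_mod_eq[of w "l ^ k"] div by metis
  qed
  moreover have "(\<lambda>v. v div l ^ k) ` ?A \<subseteq> {..<l ^ (m - k)}"
  proof (rule image_subsetI)
    fix v assume "v \<in> ?A"
    then have "v < l ^ (m - k) * l ^ k" using assms(2) by (simp flip: power_add)
    then show "v div l ^ k \<in> {..<l ^ (m - k)}" by (simp add: less_mult_imp_div_less)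
  qed
  ultimately have "card ?A \<le> card {..<l ^ (m - k)}"
    by (intro card_inj_on_le) auto
  then show ?thesis by simp
qed

text \<open>Here \<open>k\<close> is the number of common digits of \<open>v\<close> and \<open>w\<close> to the base \<open>l\<close>, counted from the
  last one: the branches of \<open>v\<close> and \<open>w\<close> follow the same inverse branches for the first \<open>k\<close> steps
  backward and then separate.\<close>

lemma ex_common_digits:
  fixes l m v w :: nat
  assumes "v < l ^ m" "w < l ^ m" "v \<noteq> w"
  shows "\<exists>k<m. v mod l ^ k = w mod l ^ k \<and> v mod l ^ Suc k \<noteq> w mod l ^ Suc k"
proof -
  have "v mod l ^ m \<noteq> w mod l ^ m" using assms by simp
  then obtain k where k: "k \<le> m" "\<forall>i<k. v mod l ^ i = w mod l ^ i" "v mod l ^ k \<noteq> w mod l ^ k"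
    using ex_least_nat_le[of "\<lambda>k. v mod l ^ k \<noteq> w mod l ^ k" m] by auto
  then obtain j where j: "k = Suc j" by (cases k) auto
  then show ?thesis using k by (intro exI[of _ j]) auto
qed

text \<open>Expanding the square gives a sum over pairs of branches. Among the \<open>l\<^sup>m\<close> branches, at most
  \<open>l\<^sup>m\<^sup>-\<^sup>k\<close> share \<open>k\<close> digits with a given one.\<close>

lemma second_moment_le:
  fixes S :: "'t \<Rightarrow> nat \<Rightarrow> real" and a :: "nat \<Rightarrow> complex"
  assumes T: "finite T" and l: "l > 0" and a: "\<And>w. w < l ^ m \<Longrightarrow> cmod (a w) \<le> 1"
    and \<beta>: "\<And>k. 0 \<le> \<beta> k"
    and pair: "\<And>v w k. v < l ^ m \<Longrightarrow> w < l ^ m \<Longrightarrow> k < m \<Longrightarrow> v mod l ^ k = w mod l ^ k \<Longrightarrow>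
      v mod l ^ Suc k \<noteq> w mod l ^ Suc k \<Longrightarrow> cmod (\<Sum>t\<in>T. cis (S t v - S t w)) \<le> real (card T) * \<beta> k"
  shows "(\<Sum>t\<in>T. (cmod (\<Sum>w<l ^ m. a w * cis (S t w)))\<^sup>2)
    \<le> real (card T) * (real l ^ m * (1 + (\<Sum>k<m. real l ^ (m - k) * \<beta> k)))"
proof -
  define \<gamma> where "\<gamma> v w = (if v = w then 1 else 0) + (\<Sum>k<m. if w mod l ^ k = v mod l ^ k then \<beta> k else 0)" for v w :: nat
  have \<gamma>: "cmod (\<Sum>t\<in>T. cis (S t v - S t w)) \<le> real (card T) * \<gamma> v w" if vw: "v < l ^ m" "w < l ^ m" for v w
  proof (cases "v = w")
    case True
    have "0 \<le> (\<Sum>k<m. if w mod l ^ k = v mod l ^ k then \<beta> k else 0)" using \<beta> by (intro sum_nonneg) auto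
    then have "1 \<le> \<gamma> v w" using True by (simp add: \<gamma>_def)
    then show ?thesis using True mult_left_mono[of 1 "\<gamma> v w" "real (card T)"] by simp
  next
    case False
    then obtain k where k: "k < m" "v mod l ^ k = w mod l ^ k" "v mod l ^ Suc k \<noteq> w mod l ^ Suc k"
      using ex_common_digits[OF vw] by blast
    have "\<beta> k \<le> (\<Sum>k<m. if w mod l ^ k = v mod l ^ k then \<beta> k else 0)"
      using member_le_sum[of k "{..<m}" "\<lambda>k. if w mod l ^ k = v mod l ^ k then \<beta> k else 0"] k \<beta> by auto
    then have "\<beta> k \<le> \<gamma> v w" using False by (simp add: \<gamma>_def)
    then show ?thesis
      using pair[OF vw k] by (meson mult_left_mono of_nat_0_le_iff order_trans)
  qed
  have sq: "(cmod z)\<^sup>2 = Re (z * cnj z)" for z by (simp add: complex_mult_cnj cmod_power2)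
  have "(\<Sum>t\<in>T. (cmod (\<Sum>w<l ^ m. a w * cis (S t w)))\<^sup>2)
      = Re (\<Sum>t\<in>T. \<Sum>v<l ^ m. \<Sum>w<l ^ m. a v * cnj (a w) * cis (S t v - S t w))"
  proof -
    have trm: "a v * cis (S t v) * cnj (a w * cis (S t w)) = a v * cnj (a w) * cis (S t v - S t w)" for t v w
    proof -
      have "cis (S t v) * cnj (cis (S t w)) = cis (S t v - S t w)"
        by (simp add: cis_cnj cis_mult)
      then show ?thesis by (metis complex_cnj_mult mult.assoc mult.left_commute)
    qed
    have "(cmod (\<Sum>w<l ^ m. a w * cis (S t w)))\<^sup>2 = Re (\<Sum>v<l ^ m. \<Sum>w<l ^ m. a v * cnj (a w) * cis (S t v - S t w))" for t
      unfolding sq cnj_sum sum_product trm ..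
    then show ?thesis by (simp only: Re_sum)
  qed
  also have "(\<Sum>t\<in>T. \<Sum>v<l ^ m. \<Sum>w<l ^ m. a v * cnj (a w) * cis (S t v - S t w))
      = (\<Sum>v<l ^ m. \<Sum>w<l ^ m. \<Sum>t\<in>T. a v * cnj (a w) * cis (S t v - S t w))"
    by (subst sum.swap, rule sum.cong[OF refl], rule sum.swap)
  also have "\<dots> = (\<Sum>v<l ^ m. \<Sum>w<l ^ m. a v * cnj (a w) * (\<Sum>t\<in>T. cis (S t v - S t w)))"
    by (simp add: sum_distrib_left)
  also have "Re \<dots> \<le> cmod \<dots>" by (rule complex_Re_le_cmod)
  also have "\<dots> \<le> (\<Sum>v<l ^ m. \<Sum>w<l ^ m. real (card T) * \<gamma> v w)"
  proof (intro sum_norm_le)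
    fix v w assume "v \<in> {..<l ^ m}" "w \<in> {..<l ^ m}"
    then have vw: "v < l ^ m" "w < l ^ m" by auto
    have "cmod (a v * cnj (a w) * (\<Sum>t\<in>T. cis (S t v - S t w))) \<le> (1 * 1) * cmod (\<Sum>t\<in>T. cis (S t v - S t w))"
      unfolding norm_mult using a[OF vw(1)] a[OF vw(2)] by (intro mult_right_mono mult_mono) auto
    then show "cmod (a v * cnj (a w) * (\<Sum>t\<in>T. cis (S t v - S t w))) \<le> real (card T) * \<gamma> v w"
      using \<gamma>[OF vw] by simp
  qed
  also have "\<dots> = real (card T) * (\<Sum>v<l ^ m. \<Sum>w<l ^ m. \<gamma> v w)"
    by (simp add: sum_distrib_left)
  also have "\<dots> \<le> real (card T) * (\<Sum>v<l ^ m. 1 + (\<Sum>k<m. real l ^ (m - k) * \<beta> k))"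
  proof (intro mult_left_mono sum_mono)
    fix v assume v: "v \<in> {..<l ^ m}"
    have "(\<Sum>w<l ^ m. \<gamma> v w) = 1 + (\<Sum>k<m. \<Sum>w<l ^ m. if w mod l ^ k = v mod l ^ k then \<beta> k else 0)"
      using v by (simp add: \<gamma>_def sum.distrib sum.swap[of _ "{..<m}"])
    also have "(\<Sum>k<m. \<Sum>w<l ^ m. if w mod l ^ k = v mod l ^ k then \<beta> k else 0) \<le> (\<Sum>k<m. real l ^ (m - k) * \<beta> k)"
    proof (rule sum_mono)
      fix k assume k: "k \<in> {..<m}"
      have "(\<Sum>w<l ^ m. if w mod l ^ k = v mod l ^ k then \<beta> k else 0)
          = real (card {w. w < l ^ m \<and> w mod l ^ k = v mod l ^ k}) * \<beta> k"
        by (simp add: sum.If_cases Int_def)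
      also have "\<dots> \<le> real (l ^ (m - k)) * \<beta> k"
        using card_residue_class_le[OF l, of k m] k \<beta> by (intro mult_right_mono) (auto intro: of_nat_mono)
      finally show "(\<Sum>w<l ^ m. if w mod l ^ k = v mod l ^ k then \<beta> k else 0) \<le> real l ^ (m - k) * \<beta> k" by simp
    qed
    finally show "(\<Sum>w<l ^ m. \<gamma> v w) \<le> 1 + (\<Sum>k<m. real l ^ (m - k) * \<beta> k)" by simp
  qed simp
  finally show ?thesis by simp
qed

section \<open>Trigonometric perturbations\<close>

text \<open>The parameter \<open>b\<close> counts quarter-turns, so that differentiation just increases it:
  \<open>b = 0\<close> is the cosine and \<open>b = 1\<close> is minus the sine.\<close>

definition wave :: "nat \<Rightarrow> nat \<Rightarrow> real \<Rightarrow> real"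
  where "wave q b x = cos (2 * pi * real q * x + real b * pi / 2)"

lemma abs_wave_le: "\<bar>wave q b x\<bar> \<le> 1"
  by (simp add: wave_def)

lemma wave_periodic: "wave q b (x + of_int k) = wave q b x"
proof -
  have "2 * pi * real q * (x + of_int k) + real b * pi / 2
      = (2 * pi * real q * x + real b * pi / 2) + 2 * pi * of_int (int q * k)"
    by (simp add: algebra_simps)
  then show ?thesis
    unfolding wave_def by (simp only: cos_add cos_int_2pin sin_int_2pin) simp
qed

lemma wave_has_derivative:
  "(wave q b has_real_derivative 2 * pi * real q * wave q (Suc b) x) (at x)"
proof -
  have "wave q (Suc b) x = - sin (2 * pi * real q * x + real b * pi / 2)"
    by (simp add: wave_def cos_add sin_add add_divide_distrib distrib_right)
  then show ?thesis
    unfolding wave_def by (auto intro!: derivative_eq_intros)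
qed

text \<open>The third component only serves to repeat each wave four times, with independent
  coefficients. Each copy contributes one factor of decay, so the mean of a phase decays like the
  inverse fourth power of the frequency; an exponent above 3 is needed.\<close>

definition wave_index :: "nat \<Rightarrow> (nat \<times> nat \<times> nat) set"
  where "wave_index N = {..N} \<times> {..<2} \<times> {..<4}"

definition wave_at :: "nat \<times> nat \<times> nat \<Rightarrow> real \<Rightarrow> real"
  where "wave_at i = wave (fst i) (fst (snd i))"

definition perturb :: "(real \<Rightarrow> real) \<Rightarrow> nat \<Rightarrow> (nat \<times> nat \<times> nat \<Rightarrow> real) \<Rightarrow> real \<Rightarrow> real"
  where "perturb F N a x = F x + (\<Sum>i\<in>wave_index N. a i * wave_at i x)"

lemma finite_wave_index: "finite (wave_index N)"
  by (simp add: wave_index_def)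

lemma cocycle_perturb:
  "cocycle l lam (perturb F N a) n z = cocycle l lam F n z + (\<Sum>i\<in>wave_index N. a i * cocycle l lam (wave_at i) n z)"
proof -
  have "cocycle l lam (perturb F N a) n z = cocycle l lam F n z +
      (\<Sum>k<n. \<Sum>i\<in>wave_index N. lam ^ (n - 1 - k) * (a i * wave_at i (real l ^ k * z)))"
    by (simp add: cocycle_def perturb_def distrib_left sum.distrib sum_distrib_left)
  also have "(\<Sum>k<n. \<Sum>i\<in>wave_index N. lam ^ (n - 1 - k) * (a i * wave_at i (real l ^ k * z)))
      = (\<Sum>i\<in>wave_index N. a i * cocycle l lam (wave_at i) n z)"
    by (subst sum.swap) (simp add: cocycle_def sum_distrib_left mult.left_commute)
  finally show ?thesis .
qed

definition transversal_degree :: "nat \<Rightarrow> real \<Rightarrow> nat \<Rightarrow> bool"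
  where "transversal_degree l lam N \<longleftrightarrow> (\<forall>m z z'. m \<ge> 1 \<longrightarrow> real l ^ m * (z - z') \<in> \<int> \<longrightarrow> real l ^ (m - 1) * (z - z') \<notin> \<int> \<longrightarrow>
    (\<exists>q\<le>N. \<exists>b<2. 1 / 4 \<le> \<bar>cocycle l lam (wave q b) m z - cocycle l lam (wave q b) m z'\<bar>))"

lemma ex_transversal_degree:
  assumes l: "l \<ge> 2" and lam: "0 < lam" "lam < 1"
  shows "\<exists>N. transversal_degree l lam N"
proof -
  obtain N where N: "\<And>m z z'. m \<ge> 1 \<Longrightarrow> real l ^ m * (z - z') \<in> \<int> \<Longrightarrow> real l ^ (m - 1) * (z - z') \<notin> \<int> \<Longrightarrow>
    \<exists>q. \<bar>q\<bar> \<le> int N \<and> 1 / 2 \<le> cmod (cocycle l lam (fourier_mode q) m z - cocycle l lam (fourier_mode q) m z')"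
    using cocycle_fourier_transversal[OF l lam] by blast
  show ?thesis
    unfolding transversal_degree_def
  proof (rule exI[of _ N], intro allI impI)
    fix m :: nat and z z' :: real
    assume "m \<ge> 1" "real l ^ m * (z - z') \<in> \<int>" "real l ^ (m - 1) * (z - z') \<notin> \<int>"
    then obtain q where q: "\<bar>q\<bar> \<le> int N"
        "1 / 2 \<le> cmod (cocycle l lam (fourier_mode q) m z - cocycle l lam (fourier_mode q) m z')"
      using N by blast
    define n where "n = nat \<bar>q\<bar>"
    define \<sigma> :: real where "\<sigma> = (if q \<ge> 0 then -1 else 1)"
    have "real n = (if q \<ge> 0 then of_int q else - of_int q)" by (simp add: n_def)
    then have modes: "Re (fourier_mode q x) = wave n 0 x" "Im (fourier_mode q x) = \<sigma> * wave n 1 x" for x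
      by (auto simp: fourier_mode_def wave_def \<sigma>_def cos_add)
    have "Re (cocycle l lam (fourier_mode q) m z) = cocycle l lam (wave n 0) m z"
      "Im (cocycle l lam (fourier_mode q) m z) = \<sigma> * cocycle l lam (wave n 1) m z" for z
      by (simp_all add: cocycle_def modes sum_distrib_left mult.left_commute)
    then have "cmod (cocycle l lam (fourier_mode q) m z - cocycle l lam (fourier_mode q) m z')
        \<le> \<bar>cocycle l lam (wave n 0) m z - cocycle l lam (wave n 0) m z'\<bar>
         + \<bar>\<sigma> * (cocycle l lam (wave n 1) m z - cocycle l lam (wave n 1) m z')\<bar>"
      using cmod_le[of "cocycle l lam (fourier_mode q) m z - cocycle l lam (fourier_mode q) m z'"]
      by (simp add: right_diff_distrib)
    also have "\<bar>\<sigma> * (cocycle l lam (wave n 1) m z - cocycle l lam (wave n 1) m z')\<bar>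
        = \<bar>cocycle l lam (wave n 1) m z - cocycle l lam (wave n 1) m z'\<bar>"
      by (simp add: \<sigma>_def abs_mult)
    finally have "1 / 4 \<le> \<bar>cocycle l lam (wave n 0) m z - cocycle l lam (wave n 0) m z'\<bar>
        \<or> 1 / 4 \<le> \<bar>cocycle l lam (wave n 1) m z - cocycle l lam (wave n 1) m z'\<bar>"
      using q(2) by linarith
    moreover have "n \<le> N" using q(1) by (simp add: n_def)
    ultimately show "\<exists>q\<le>N. \<exists>b<2. 1 / 4 \<le> \<bar>cocycle l lam (wave q b) m z - cocycle l lam (wave q b) m z'\<bar>"
      by (metis one_less_numeral_iff semiring_norm(76) zero_less_numeral)
  qed
qed

lemma cocycle_common_tail:
  assumes F: "\<And>x k. F (x + of_int k) = F x" and z: "real l ^ j * (z - z') \<in> \<int>"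
  shows "cocycle l lam F (j + k) z - cocycle l lam F (j + k) z' = lam ^ k *\<^sub>R (cocycle l lam F j z - cocycle l lam F j z')"
proof (induction k)
  case (Suc k)
  have "real l ^ (j + k) * (z - z') = real (l ^ k) * (real l ^ j * (z - z'))"
    by (simp add: power_add)
  then have "real l ^ (j + k) * (z - z') \<in> \<int>" using z by (metis Ints_mult Ints_of_nat)
  then obtain i where "real l ^ (j + k) * (z - z') = of_int i" by (auto elim: Ints_cases)
  then have "real l ^ (j + k) * z = real l ^ (j + k) * z' + of_int i" by (simp add: algebra_simps)
  then have "F (real l ^ (j + k) * z) = F (real l ^ (j + k) * z')" using F by simp
  then have "cocycle l lam F (j + Suc k) z - cocycle l lam F (j + Suc k) z'
      = lam *\<^sub>R (cocycle l lam F (j + k) z - cocycle l lam F (j + k) z')"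
    by (simp add: cocycle_Suc scaleR_diff_right)
  then show ?case using Suc by simp
qed simp

lemma branch_difference_int:
  fixes l v w n k :: nat and x :: real
  assumes l: "l > 0" and k: "k \<le> n"
  shows "real l ^ (n - k) * (branch l n x v - branch l n x w) \<in> \<int> \<longleftrightarrow> v mod l ^ k = w mod l ^ k"
proof -
  have "real l ^ n = real l ^ (n - k) * real l ^ k" using k by (simp flip: power_add)
  then have "real l ^ (n - k) * (branch l n x v - branch l n x w)
      = real_of_int (int v - int w) / real_of_int (int l ^ k)"
    using l by (simp add: field_simps)
  also have "\<dots> \<in> \<int> \<longleftrightarrow> int l ^ k dvd (int v - int w)"
  proof
    assume "real_of_int (int v - int w) / real_of_int (int l ^ k) \<in> \<int>"
    then obtain i where "real_of_int (int v - int w) / real_of_int (int l ^ k) = of_int i" by (auto elim: Ints_cases)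
    then have "real_of_int (int v - int w) = of_int (i * int l ^ k)" using l by (simp add: field_simps)
    then have "int v - int w = i * int l ^ k" by (simp only: of_int_eq_iff)
    then show "int l ^ k dvd (int v - int w)" by simp
  next
    assume "int l ^ k dvd (int v - int w)"
    then obtain i where "int v - int w = int l ^ k * i" by (auto elim: dvdE)
    then have "real_of_int (int v - int w) / real_of_int (int l ^ k) = of_int i"
      using l by (simp only: of_int_mult) simp
    then show "real_of_int (int v - int w) / real_of_int (int l ^ k) \<in> \<int>" by (simp only: Ints_of_int)
  qed
  also have "\<dots> \<longleftrightarrow> int v mod int l ^ k = int w mod int l ^ k" by (rule mod_eq_dvd_iff[symmetric])
  also have "\<dots> \<longleftrightarrow> v mod l ^ k = w mod l ^ k" by (metis of_nat_eq_iff of_nat_mod of_nat_power)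
  finally show ?thesis .
qed

text \<open>After \<open>k\<close> common digits the phase difference is \<open>\<theta> lam\<^sup>k\<close> times a difference of two
  cocycles whose last points are distinct preimages of one point. By transversality, four of
  the coefficients, which range over \<open>[0, \<epsilon>)\<close>, change it with slope at least \<open>\<theta> lam\<^sup>k / 4\<close>. The lower bound on \<open>H\<close> keeps the steps of
  the grid below \<open>\<pi>\<close>.\<close>

lemma perturb_pair_bound:
  fixes l m q H :: nat and \<epsilon> \<theta> lam s x :: real
  assumes l: "l \<ge> 2" and lam: "0 < lam" "lam < 1" and N: "transversal_degree l lam N"
    and F: "\<And>x k. F (x + of_int k) = F x" and \<epsilon>: "\<epsilon> > 0" and \<theta>: "\<theta> > 0" and s: "0 \<le> s" "s \<le> 4"
    and H: "H > 0" "2 * \<theta> * \<epsilon> / (1 - lam) \<le> real H"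
    and k: "k < m" "v mod l ^ k = w mod l ^ k" "v mod l ^ Suc k \<noteq> w mod l ^ Suc k"
  defines "T \<equiv> PiE (wave_index N) (\<lambda>_. {..<H})"
  defines "S \<equiv> (\<lambda>t w. \<theta> * cocycle l lam (perturb F N (\<lambda>i. \<epsilon> / real H * real (t i))) (m + q) (branch l (m + q) x w))"
  shows "cmod (\<Sum>t\<in>T. cis (S t v - S t w)) \<le> real (card T) * (16 / (\<epsilon> * \<theta> * lam ^ k)) powr s"
proof -
  define n where "n = m + q"
  define z z' where "z = branch l n x v" and "z' = branch l n x w"
  have l0: "l > 0" using l by simp
  have kn: "k < n" using k(1) by (simp add: n_def)
  have int1: "real l ^ (n - k) * (z - z') \<in> \<int>"
    using branch_difference_int[OF l0, of k n] k(2) kn by (simp add: z_def z'_def)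
  have int2: "real l ^ (n - k - 1) * (z - z') \<notin> \<int>"
    using branch_difference_int[OF l0, of "Suc k" n x v w] k(3) kn by (simp add: z_def z'_def)
  define d where "d i = cocycle l lam (wave_at i) (n - k) z - cocycle l lam (wave_at i) (n - k) z'" for i
  obtain p b where pb: "p \<le> N" "b < 2" "1 / 4 \<le> \<bar>cocycle l lam (wave p b) (n - k) z - cocycle l lam (wave p b) (n - k) z'\<bar>"
    using N int1 int2 kn unfolding transversal_degree_def by (metis Suc_leI One_nat_def zero_less_diff)
  define J where "J = {p} \<times> {b} \<times> {..<4::nat}"
  have J: "J \<subseteq> wave_index N" "card J = 4" using pb by (auto simp: J_def wave_index_def card_cartesian_product)
  have dJ: "1 / 4 \<le> \<bar>d i\<bar>" if "i \<in> J" for i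
    using that pb(3) by (auto simp: J_def d_def wave_at_def)
  have d2: "\<bar>d i\<bar> \<le> 2 / (1 - lam)" for i
  proof -
    have "norm (cocycle l lam (wave_at i) (n - k) u) \<le> 1 / (1 - lam)" for u
      using lam by (intro norm_cocycle_le) (auto simp: wave_at_def abs_wave_le)
    from this[of z] this[of z'] show ?thesis by (simp add: d_def)
  qed
  define c where "c = \<theta> * lam ^ k * (\<epsilon> / real H)"
  have c: "c > 0" using \<theta> lam \<epsilon> H by (simp add: c_def)
  define D where "D = \<theta> * lam ^ k * (cocycle l lam F (n - k) z - cocycle l lam F (n - k) z')"
  have tail: "cocycle l lam G n z - cocycle l lam G n z' = lam ^ k * (cocycle l lam G (n - k) z - cocycle l lam G (n - k) z')"
    if "\<And>x k. G (x + of_int k) = G x" for G :: "real \<Rightarrow> real"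
    using cocycle_common_tail[OF that int1, of lam k] kn by simp
  have S: "S t v - S t w = D + (\<Sum>i\<in>wave_index N. real (t i) * (c * d i))" for t
  proof -
    have "perturb F N a (x + of_int k) = perturb F N a x" for a x k
      by (simp add: perturb_def F wave_at_def wave_periodic)
    then have "S t v - S t w = \<theta> * (lam ^ k * (cocycle l lam (perturb F N (\<lambda>i. \<epsilon> / real H * real (t i))) (n - k) z
        - cocycle l lam (perturb F N (\<lambda>i. \<epsilon> / real H * real (t i))) (n - k) z'))"
      using tail[of "perturb F N (\<lambda>i. \<epsilon> / real H * real (t i))"]
      by (simp add: S_def n_def[symmetric] z_def[symmetric] z'_def[symmetric] flip: right_diff_distrib)
    also have "\<dots> = D + \<theta> * lam ^ k * (\<Sum>i\<in>wave_index N. \<epsilon> / real H * real (t i) * d i)"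
      by (simp add: cocycle_perturb D_def d_def right_diff_distrib sum_subtractf algebra_simps)
    also have "\<theta> * lam ^ k * (\<Sum>i\<in>wave_index N. \<epsilon> / real H * real (t i) * d i) = (\<Sum>i\<in>wave_index N. real (t i) * (c * d i))"
      by (simp add: sum_distrib_left c_def mult_ac)
    finally show ?thesis .
  qed
  have cardT: "real (card T) = real H ^ card (wave_index N)"
    by (simp add: T_def card_PiE finite_wave_index)
  have bounds: "0 < \<bar>c * d i\<bar> \<and> \<bar>c * d i\<bar> \<le> pi" if "i \<in> J" for i
  proof -
    have "\<bar>c * d i\<bar> \<le> c * (2 / (1 - lam))" using c mult_left_mono[OF d2[of i], of c] by (simp add: abs_mult)
    also have "\<dots> = lam ^ k * (2 * \<theta> * \<epsilon> / (1 - lam) / real H)" by (simp add: c_def mult_ac)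
    also have "\<dots> \<le> 1 * 1"
      using H lam \<theta> \<epsilon> by (intro mult_mono power_le_one) (auto simp: divide_le_eq mult.commute)
    also have "\<dots> \<le> pi" using pi_gt3 by simp
    finally show ?thesis using c dJ[OF that] by auto
  qed
  define X where "X = 16 / (\<epsilon> * \<theta> * lam ^ k)"
  have X: "X > 0" using \<epsilon> \<theta> lam by (simp add: X_def)
  have "cmod (\<Sum>t\<in>T. cis (S t v - S t w)) \<le> real (card T) * (\<Prod>i\<in>J. 4 / (real H * \<bar>c * d i\<bar>))"
    unfolding S cardT unfolding T_def using J bounds H(1) by (intro norm_sum_PiE_cis_le finite_wave_index) auto
  also have "(\<Prod>i\<in>J. 4 / (real H * \<bar>c * d i\<bar>)) \<le> (\<Prod>i\<in>J. X)"
  proof (rule prod_mono)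
    fix i assume i: "i \<in> J"
    have "real H * (c * (1 / 4)) \<le> real H * \<bar>c * d i\<bar>"
      using dJ[OF i] c by (intro mult_left_mono) (auto simp: abs_mult)
    then have "4 / (real H * \<bar>c * d i\<bar>) \<le> 4 / (real H * (c * (1 / 4)))"
      using c H by (intro divide_left_mono mult_pos_pos) (use bounds[OF i] in auto)
    also have "\<dots> = X" using H by (simp add: X_def c_def)
    finally show "0 \<le> 4 / (real H * \<bar>c * d i\<bar>) \<and> 4 / (real H * \<bar>c * d i\<bar>) \<le> X" by simp
  qed
  also have "(\<Prod>i\<in>J. X) = X ^ 4" using J by simp
  finally have 1: "cmod (\<Sum>t\<in>T. cis (S t v - S t w)) \<le> real (card T) * X ^ 4" by (simp add: mult_left_mono)
  have 2: "cmod (\<Sum>t\<in>T. cis (S t v - S t w)) \<le> real (card T) * 1"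
    using norm_sum[of "\<lambda>t. cis (S t v - S t w)" T] by simp
  \<comment> \<open>Trading the fourth power and the trivial bound for an exponent \<open>s\<close> makes the sum over \<open>k\<close> geometric.\<close>
  have "min 1 (X ^ 4) \<le> X powr s"
  proof (cases "X \<ge> 1")
    case True
    then have "1 \<le> X powr s" using s by (simp add: ge_one_powr_ge_zero)
    then show ?thesis by simp
  next
    case False
    then have "X powr 4 \<le> X powr s" using s X by (intro powr_mono') auto
    then show ?thesis using X by (simp add: powr_numeral)
  qed
  then have "real (card T) * min 1 (X ^ 4) \<le> real (card T) * X powr s" by (intro mult_left_mono) auto
  then show ?thesis using 1 2 unfolding X_def[symmetric] by (cases "X ^ 4 \<le> 1") (auto simp: min_def)
qed

section \<open>Mean squares of branch sums\<close>

text \<open>With weights 1 this is the \<open>c\<^sub>j(x)\<close> of the introduction, for \<open>\<theta> = j \<omega>\<close>. Other weights occur in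
  its derivative.\<close>

definition branch_sum :: "nat \<Rightarrow> real \<Rightarrow> (real \<Rightarrow> real) \<Rightarrow> nat \<Rightarrow> nat \<Rightarrow> (nat \<Rightarrow> complex) \<Rightarrow> real \<Rightarrow> real \<Rightarrow> complex"
  where "branch_sum l lam G m q a \<theta> x =
    (\<Sum>w<l ^ m. a w * cis (\<theta> * cocycle l lam G (m + q) (branch l (m + q) x w))) / of_nat (l ^ m)"

definition grid_perturb :: "(real \<Rightarrow> real) \<Rightarrow> nat \<Rightarrow> real \<Rightarrow> nat \<Rightarrow> (nat \<times> nat \<times> nat \<Rightarrow> nat) \<Rightarrow> real \<Rightarrow> real"
  where "grid_perturb F N \<epsilon> H t = perturb F N (\<lambda>i. \<epsilon> / real H * real (t i))"

abbreviation moment_bound :: "nat \<Rightarrow> real \<Rightarrow> real \<Rightarrow> real \<Rightarrow> nat \<Rightarrow> real \<Rightarrow> real"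
  where "moment_bound l lam \<epsilon> s m \<theta> \<equiv>
    1 / real l ^ m + (16 / \<epsilon>) powr s / (1 - 1 / (real l * lam powr s)) * \<theta> powr - s"

text \<open>The geometric series over the number of common digits has ratio \<open>1 / (l lam\<^sup>s)\<close>.\<close>

lemma mean_square_branch_sum:
  fixes l m q H :: nat and \<epsilon> \<theta> lam s x K :: real
  assumes l: "l \<ge> 2" and lam: "0 < lam" "lam < 1" and N: "transversal_degree l lam N"
    and F: "\<And>x k. F (x + of_int k) = F x" and \<epsilon>: "\<epsilon> > 0" and \<theta>: "\<theta> > 0" and s: "0 \<le> s" "s \<le> 4" "1 < real l * lam powr s"
    and H: "H > 0" "2 * \<theta> * \<epsilon> / (1 - lam) \<le> real H"
    and a: "\<And>w. w < l ^ m \<Longrightarrow> cmod (a w) \<le> K"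
  defines "T \<equiv> PiE (wave_index N) (\<lambda>_. {..<H})"
  shows "(\<Sum>t\<in>T. (cmod (branch_sum l lam (grid_perturb F N \<epsilon> H t) m q a \<theta> x))\<^sup>2)
    \<le> real (card T) * (K\<^sup>2 * moment_bound l lam \<epsilon> s m \<theta>)"
proof (cases "K = 0")
  case True
  then have "branch_sum l lam (grid_perturb F N \<epsilon> H t) m q a \<theta> x = 0" for t
    using a unfolding branch_sum_def by (simp add: sum.neutral)
  then show ?thesis using True by simp
next
  case False
  have "0 < l ^ m" using l by simp
  then have K: "K > 0" using False a[of 0] norm_ge_zero[of "a 0"] by linarith
  define L where "L = real l ^ m"
  have L: "L > 0" using l by (simp add: L_def)
  define S where "S t w = \<theta> * cocycle l lam (grid_perturb F N \<epsilon> H t) (m + q) (branch l (m + q) x w)" for t w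
  define \<beta> where "\<beta> k = (16 / (\<epsilon> * \<theta> * lam ^ k)) powr s" for k :: nat
  define r where "r = 1 / (real l * lam powr s)"
  have r: "0 < r" "r < 1" using l lam s by (auto simp: r_def)
  have finT: "finite T" unfolding T_def by (intro finite_PiE finite_wave_index) auto
  have powr_mult3: "(a * b * c) powr s = a powr s * b powr s * c powr s" if "0 < a" "0 < b" "0 < c" for a b c :: real
    using that by (simp add: powr_mult)
  have "(\<Sum>t\<in>T. (cmod (\<Sum>w<l ^ m. (a w / of_real K) * cis (S t w)))\<^sup>2)
      \<le> real (card T) * (L * (1 + (\<Sum>k<m. real l ^ (m - k) * \<beta> k)))"
    unfolding L_def
  proof (rule second_moment_le[OF finT])
    show "l > 0" using l by simp
    show "cmod (a w / of_real K) \<le> 1" if "w < l ^ m" for w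
      using a[OF that] K by (simp add: norm_divide)
    show "0 \<le> \<beta> k" for k by (simp add: \<beta>_def)
    show "cmod (\<Sum>t\<in>T. cis (S t v - S t w)) \<le> real (card T) * \<beta> k"
      if "k < m" "v mod l ^ k = w mod l ^ k" "v mod l ^ Suc k \<noteq> w mod l ^ Suc k" for v w k
      unfolding S_def T_def \<beta>_def grid_perturb_def
      by (rule perturb_pair_bound[OF l lam N F \<epsilon> \<theta> s(1,2) H that])
  qed
  also have "(\<Sum>k<m. real l ^ (m - k) * \<beta> k) = L * ((16 / \<epsilon>) powr s * \<theta> powr - s) * (\<Sum>k<m. r ^ k)"
    unfolding sum_distrib_left
  proof (rule sum.cong)
    fix k assume "k \<in> {..<m}"
    then have "real l ^ m = real l ^ (m - k) * real l ^ k" by (simp flip: power_add)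
    then have "real l ^ (m - k) = L / real l ^ k" using l by (simp add: L_def)
    moreover have "\<beta> k = (16 / \<epsilon>) powr s * \<theta> powr - s * (1 / (lam powr s) ^ k)"
    proof -
      have "\<beta> k = (16 / \<epsilon> * (1 / \<theta>) * (1 / lam ^ k)) powr s" by (simp add: \<beta>_def)
      also have "\<dots> = (16 / \<epsilon>) powr s * (1 / \<theta>) powr s * (1 / lam ^ k) powr s"
        using \<epsilon> \<theta> lam by (intro powr_mult3) auto
      also have "(1 / \<theta>) powr s = \<theta> powr - s" using \<theta> by (simp add: powr_divide powr_minus_divide)
      also have "(1 / lam ^ k) powr s = 1 / (lam powr s) ^ k"
      proof -
        have "(lam ^ k) powr s = (lam powr s) ^ k"
          using lam by (simp add: powr_powr mult.commute flip: powr_realpow)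
        then show ?thesis using lam by (simp add: powr_divide)
      qed
      finally show ?thesis .
    qed
    ultimately show "real l ^ (m - k) * \<beta> k = L * ((16 / \<epsilon>) powr s * \<theta> powr - s) * r ^ k"
      by (simp add: r_def power_divide power_mult_distrib)
  qed simp
  also have "L * (1 + L * ((16 / \<epsilon>) powr s * \<theta> powr - s) * (\<Sum>k<m. r ^ k))
      \<le> L * (1 + L * ((16 / \<epsilon>) powr s * \<theta> powr - s) * (1 / (1 - r)))"
  proof -
    have "(\<Sum>k<m. r ^ k) = (1 - r ^ m) / (1 - r)" using r by (simp add: sum_gp_strict)
    also have "\<dots> \<le> 1 / (1 - r)" using r by (intro divide_right_mono) auto
    finally show ?thesis using L by (intro mult_left_mono add_left_mono) auto
  qed
  finally have main: "(\<Sum>t\<in>T. (cmod (\<Sum>w<l ^ m. (a w / of_real K) * cis (S t w)))\<^sup>2)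
      \<le> real (card T) * (L * (1 + L * ((16 / \<epsilon>) powr s * \<theta> powr - s) * (1 / (1 - r))))"
    by (simp add: mult_left_mono)
  have sum_K: "(\<Sum>w<l ^ m. (a w / of_real K) * cis (S t w)) = (\<Sum>w<l ^ m. a w * cis (S t w)) / of_real K" for t
    by (simp add: sum_divide_distrib)
  have br: "branch_sum l lam (grid_perturb F N \<epsilon> H t) m q a \<theta> x = of_real (K / L) * (\<Sum>w<l ^ m. (a w / of_real K) * cis (S t w))" for t
    unfolding sum_K using K by (simp add: branch_sum_def S_def L_def)
  have "(\<Sum>t\<in>T. (cmod (branch_sum l lam (grid_perturb F N \<epsilon> H t) m q a \<theta> x))\<^sup>2)
      = (K / L)\<^sup>2 * (\<Sum>t\<in>T. (cmod (\<Sum>w<l ^ m. (a w / of_real K) * cis (S t w)))\<^sup>2)"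
    unfolding br norm_mult norm_of_real power_mult_distrib power2_abs sum_distrib_left[symmetric] ..
  also have "\<dots> \<le> (K / L)\<^sup>2 * (real (card T) * (L * (1 + L * ((16 / \<epsilon>) powr s * \<theta> powr - s) * (1 / (1 - r)))))"
    using main by (intro mult_left_mono) auto
  also have "\<dots> = real (card T) * (K\<^sup>2 * (1 / L + (16 / \<epsilon>) powr s / (1 - r) * \<theta> powr - s))"
    using L r by (simp add: power2_eq_square field_simps)
  finally show ?thesis by (simp add: L_def r_def)
qed

section \<open>Derivatives of branch sums\<close>

definition cocycle_slope :: "nat \<Rightarrow> real \<Rightarrow> (real \<Rightarrow> real) \<Rightarrow> nat \<Rightarrow> real \<Rightarrow> real"
  where "cocycle_slope l lam G n z = (\<Sum>i<n. lam ^ (n - 1 - i) * (real l ^ i / real l ^ n * G (real l ^ i * z)))"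

lemma cocycle_branch_has_derivative:
  assumes G: "\<And>x. (G has_real_derivative G' x) (at x)"
  shows "((\<lambda>x. cocycle l lam G n ((x + c) / real l ^ n)) has_real_derivative cocycle_slope l lam G' n ((x + c) / real l ^ n)) (at x)"
proof -
  have "((\<lambda>x. G (real l ^ i * ((x + c) / real l ^ n))) has_real_derivative
      G' (real l ^ i * ((x + c) / real l ^ n)) * (real l ^ i / real l ^ n)) (at x)" for i
  proof (rule DERIV_chain2[OF G])
    show "((\<lambda>x. real l ^ i * ((x + c) / real l ^ n)) has_real_derivative real l ^ i / real l ^ n) (at x)"
    proof -
      have "((\<lambda>x. (x + c) / real l ^ n) has_real_derivative 1 / real l ^ n) (at x)"
        by (rule DERIV_cdivide) (auto intro!: derivative_eq_intros)
      from DERIV_cmult[OF this, of "real l ^ i"] show ?thesis by simp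
    qed
  qed
  then show ?thesis
    unfolding cocycle_def cocycle_slope_def real_scaleR_def
    by (intro DERIV_sum DERIV_cmult) (simp add: mult.commute)
qed

lemma abs_cocycle_slope_le:
  assumes l: "l \<ge> 1" and lam: "0 < lam" "lam < 1" and M: "\<And>x. \<bar>G x\<bar> \<le> M"
  shows "\<bar>cocycle_slope l lam G n z\<bar> \<le> M / (1 - lam)"
proof -
  have M0: "M \<ge> 0" using M[of 0] by linarith
  have "\<bar>cocycle_slope l lam G n z\<bar> \<le> (\<Sum>i<n. lam ^ (n - 1 - i) * M)"
    unfolding cocycle_slope_def
  proof (rule order_trans[OF sum_abs sum_mono])
    fix i assume i: "i \<in> {..<n}"
    have "real l ^ i / real l ^ n \<le> 1" using l i by (simp add: power_increasing)
    then have 1: "real l ^ i / real l ^ n * \<bar>G (real l ^ i * z)\<bar> \<le> 1 * M"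
      using M M0 by (intro mult_mono) auto
    have "\<bar>lam ^ (n - 1 - i) * (real l ^ i / real l ^ n * G (real l ^ i * z))\<bar>
        = lam ^ (n - 1 - i) * (real l ^ i / real l ^ n * \<bar>G (real l ^ i * z)\<bar>)"
      using lam by (simp add: abs_mult)
    also have "\<dots> \<le> lam ^ (n - 1 - i) * M"
      using 1 lam by (intro mult_left_mono) auto
    finally show "\<bar>lam ^ (n - 1 - i) * (real l ^ i / real l ^ n * G (real l ^ i * z))\<bar> \<le> lam ^ (n - 1 - i) * M" .
  qed
  also have "\<dots> = (\<Sum>i<n. lam ^ (n - 1 - i)) * M" by (simp add: sum_distrib_right)
  also have "\<dots> \<le> 1 / (1 - lam) * M" using sum_geometric_reversed_le[OF lam] M0 by (intro mult_right_mono)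
  finally show ?thesis by simp
qed

lemma cis_has_vector_derivative:
  assumes "(g has_real_derivative g') (at x)"
  shows "((\<lambda>x. cis (g x)) has_vector_derivative \<i> * of_real g' * cis (g x)) (at x)"
proof -
  have "((\<lambda>x. exp (\<i> * of_real (g x))) has_vector_derivative (\<i> * of_real g') * exp (\<i> * of_real (g x))) (at x)"
  proof -
    have 1: "((\<lambda>x. \<i> * of_real (g x)) has_vector_derivative \<i> * of_real g') (at x)"
      using assms by (intro has_vector_derivative_mult_right has_vector_derivative_of_real) (simp add: has_real_derivative_iff_has_vector_derivative)
    show ?thesis
      using field_vector_diff_chain_at[OF 1, of exp "exp (\<i> * of_real (g x))"] by (simp add: o_def DERIV_exp)
  qed
  then show ?thesis by (simp add: cis_conv_exp)
qed

lemma branch_sum_has_derivative: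
  assumes G: "\<And>x. (G has_real_derivative G' x) (at x)"
  shows "(branch_sum l lam G m q (\<lambda>_. 1) \<theta> has_vector_derivative
    \<i> * of_real \<theta> * branch_sum l lam G m q (\<lambda>w. of_real (cocycle_slope l lam G' (m + q) (branch l (m + q) x w))) \<theta> x) (at x)"
proof -
  let ?g = "\<lambda>w x. \<theta> * cocycle l lam G (m + q) (branch l (m + q) x w)"
  let ?d = "\<lambda>w. cocycle_slope l lam G' (m + q) (branch l (m + q) x w)"
  have "((\<lambda>x. (\<Sum>w<l ^ m. cis (?g w x)) / of_nat (l ^ m)) has_vector_derivative
      (\<Sum>w<l ^ m. \<i> * of_real (\<theta> * ?d w) * cis (?g w x)) / of_nat (l ^ m)) (at x)"
    by (intro has_vector_derivative_divide has_vector_derivative_sum cis_has_vector_derivative DERIV_cmult cocycle_branch_has_derivative G)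
  then show ?thesis
    by (simp add: branch_sum_def[abs_def] sum_distrib_left mult_ac)
qed


lemma continuous_on_branch_sum:
  assumes G: "continuous_on UNIV G" and a: "\<And>w. continuous_on UNIV (\<lambda>x. a x w)"
  shows "continuous_on UNIV (\<lambda>x. branch_sum l lam G m q (a x) \<theta> x)"
proof -
  have "continuous_on UNIV (\<lambda>x. G (real l ^ i * ((x + c) / real l ^ n)))" for i c n
    by (rule continuous_on_compose2[OF G]) (auto intro!: continuous_intros simp: divide_inverse)
  moreover have "continuous_on UNIV cis"
    by (simp add: cis_conv_exp[abs_def] continuous_intros)
  note cc = continuous_on_compose2[OF this]
  ultimately show ?thesis
    using a unfolding branch_sum_def cocycle_def divide_inverse
    by (intro continuous_intros cc) (auto simp: divide_inverse)
qed

lemma continuous_on_cocycle_slope: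
  assumes G: "continuous_on UNIV G"
  shows "continuous_on UNIV (\<lambda>x. cocycle_slope l lam G n ((x + c) / real l ^ n))"
proof -
  have "continuous_on UNIV (\<lambda>x. G (real l ^ i * ((x + c) / real l ^ n)))" for i
    by (rule continuous_on_compose2[OF G]) (auto intro!: continuous_intros simp: divide_inverse)
  then show ?thesis unfolding cocycle_slope_def by (intro continuous_intros)
qed

definition perturb_slope :: "(real \<Rightarrow> real) \<Rightarrow> nat \<Rightarrow> (nat \<times> nat \<times> nat \<Rightarrow> real) \<Rightarrow> real \<Rightarrow> real"
  where "perturb_slope F' N a x = F' x + (\<Sum>i\<in>wave_index N. a i * (2 * pi * real (fst i) * wave (fst i) (Suc (fst (snd i))) x))"

lemma perturb_has_derivative:
  assumes "\<And>x. (F has_real_derivative F' x) (at x)"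
  shows "(perturb F N a has_real_derivative perturb_slope F' N a x) (at x)"
  unfolding perturb_def[abs_def] perturb_slope_def wave_at_def
  by (intro DERIV_add DERIV_sum DERIV_cmult wave_has_derivative assms)

lemma cocycle_slope_perturb:
  "cocycle_slope l lam (perturb_slope F' N a) n z = cocycle_slope l lam F' n z +
    (\<Sum>i\<in>wave_index N. a i * cocycle_slope l lam (\<lambda>x. 2 * pi * real (fst i) * wave (fst i) (Suc (fst (snd i))) x) n z)"
proof -
  let ?W = "\<lambda>i x. 2 * pi * real (fst i) * wave (fst i) (Suc (fst (snd i))) x"
  have "cocycle_slope l lam (perturb_slope F' N a) n z = cocycle_slope l lam F' n z +
      (\<Sum>k<n. \<Sum>i\<in>wave_index N. lam ^ (n - 1 - k) * (real l ^ k / real l ^ n * (a i * ?W i (real l ^ k * z))))"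
    unfolding cocycle_slope_def perturb_slope_def distrib_left sum.distrib sum_distrib_left ..
  also have "(\<Sum>k<n. \<Sum>i\<in>wave_index N. lam ^ (n - 1 - k) * (real l ^ k / real l ^ n * (a i * ?W i (real l ^ k * z))))
      = (\<Sum>i\<in>wave_index N. \<Sum>k<n. a i * (lam ^ (n - 1 - k) * (real l ^ k / real l ^ n * ?W i (real l ^ k * z))))"
    by (subst sum.swap) (simp only: mult_ac)
  finally show ?thesis by (simp only: cocycle_slope_def sum_distrib_left)
qed

lemma cmod_sum_square_le:
  fixes f :: "'i \<Rightarrow> complex"
  assumes "finite I"
  shows "(cmod (g + (\<Sum>i\<in>I. f i)))\<^sup>2 \<le> (1 + real (card I)) * ((cmod g)\<^sup>2 + (\<Sum>i\<in>I. (cmod (f i))\<^sup>2))"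
proof -
  define h where "h o' = (case o' of None \<Rightarrow> cmod g | Some i \<Rightarrow> cmod (f i))" for o'
  define I' where "I' = insert None (Some ` I)"
  have I': "finite I'" "card I' = Suc (card I)" using assms by (auto simp: I'_def card_insert_if card_image)
  have sums: "(\<Sum>i\<in>I'. \<phi> i) = \<phi> None + (\<Sum>i\<in>I. \<phi> (Some i))" for \<phi> :: "'i option \<Rightarrow> real"
    using assms by (simp add: I'_def sum.reindex)
  have "cmod (g + (\<Sum>i\<in>I. f i)) \<le> cmod g + (\<Sum>i\<in>I. cmod (f i))"
    using norm_triangle_ineq[of g "\<Sum>i\<in>I. f i"] norm_sum[of f I] by linarith
  also have "\<dots> = (\<Sum>i\<in>I'. h i * 1)" by (simp add: sums h_def)
  finally have "(cmod (g + (\<Sum>i\<in>I. f i)))\<^sup>2 \<le> (\<Sum>i\<in>I'. h i * 1)\<^sup>2" by (intro power_mono) auto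
  also have "\<dots> \<le> (\<Sum>i\<in>I'. (h i)\<^sup>2) * (\<Sum>i\<in>I'. 1\<^sup>2)" by (rule Cauchy_Schwarz_ineq_sum)
  also have "\<dots> = (1 + real (card I)) * ((cmod g)\<^sup>2 + (\<Sum>i\<in>I. (cmod (f i))\<^sup>2))"
    using I' by (simp add: sums h_def)
  finally show ?thesis .
qed

text \<open>The weights depend on the random coefficients, but only in an affine way. The branch sum is
  therefore a combination of \<open>1 + card (wave_index N)\<close> branch sums with deterministic weights, and
  the Cauchy-Schwarz inequality reduces it to \<open>mean_square_branch_sum\<close>.\<close>

lemma mean_square_branch_sum_derivative:
  fixes l m q H :: nat and \<epsilon> \<theta> lam s x K :: real
  assumes l: "l \<ge> 2" and lam: "0 < lam" "lam < 1" and N: "transversal_degree l lam N"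
    and F: "\<And>x k. F (x + of_int k) = F x" and \<epsilon>: "\<epsilon> > 0" "\<epsilon> \<le> 1" and \<theta>: "\<theta> > 0" and s: "0 \<le> s" "s \<le> 4" "1 < real l * lam powr s"
    and H: "H > 0" "2 * \<theta> * \<epsilon> / (1 - lam) \<le> real H"
    and M: "\<And>x. \<bar>F' x\<bar> \<le> M" "2 * pi * real N \<le> M"
  defines "T \<equiv> PiE (wave_index N) (\<lambda>_. {..<H})"
  defines "\<Phi> \<equiv> (\<lambda>t. perturb_slope F' N (\<lambda>i. \<epsilon> / real H * real (t i)))"
  shows "(\<Sum>t\<in>T. (cmod (branch_sum l lam (grid_perturb F N \<epsilon> H t) m q
        (\<lambda>w. of_real (cocycle_slope l lam (\<Phi> t) (m + q) (branch l (m + q) x w))) \<theta> x))\<^sup>2)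
    \<le> real (card T) * (((1 + real (card (wave_index N))) * M / (1 - lam))\<^sup>2 *
       moment_bound l lam \<epsilon> s m \<theta>)"
proof -
  define I where "I = wave_index N"
  define V where "V = moment_bound l lam \<epsilon> s m \<theta>"
  define A where "A w = complex_of_real (cocycle_slope l lam F' (m + q) (branch l (m + q) x w))" for w
  define B where "B i w = complex_of_real (cocycle_slope l lam (\<lambda>x. 2 * pi * real (fst i) * wave (fst i) (Suc (fst (snd i))) x) (m + q) (branch l (m + q) x w))" for i :: "nat \<times> nat \<times> nat" and w
  define bs where "bs t a = branch_sum l lam (grid_perturb F N \<epsilon> H t) m q a \<theta> x" for t a
  have M0: "M \<ge> 0" using M(1)[of 0] by linarith
  have finI: "finite I" by (simp add: I_def finite_wave_index)
  have A: "cmod (A w) \<le> M / (1 - lam)" for w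
    using abs_cocycle_slope_le[OF _ lam M(1), of l] l by (simp add: A_def)
  have B: "cmod (B i w) \<le> M / (1 - lam)" if i: "i \<in> I" for i w
  proof -
    have "\<bar>2 * pi * real (fst i) * wave (fst i) (Suc (fst (snd i))) x\<bar> \<le> M" for x
    proof -
      have "\<bar>2 * pi * real (fst i) * wave (fst i) (Suc (fst (snd i))) x\<bar> \<le> 2 * pi * real (fst i) * 1"
        using abs_wave_le[of "fst i" "Suc (fst (snd i))" x] by (simp add: abs_mult mult_left_le)
      also have "\<dots> \<le> 2 * pi * real N" using i by (auto simp: I_def wave_index_def)
      finally show ?thesis using M(2) by linarith
    qed
    then show ?thesis using abs_cocycle_slope_le[OF _ lam, of l _ M] l unfolding B_def norm_of_real by auto
  qed
  have split: "bs t (\<lambda>w. of_real (cocycle_slope l lam (\<Phi> t) (m + q) (branch l (m + q) x w)))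
      = bs t A + (\<Sum>i\<in>I. of_real (\<epsilon> / real H * real (t i)) * bs t (B i))" for t
  proof -
    define e where "e w = cis (\<theta> * cocycle l lam (grid_perturb F N \<epsilon> H t) (m + q) (branch l (m + q) x w))" for w
    have "(\<Sum>w<l ^ m. of_real (cocycle_slope l lam (\<Phi> t) (m + q) (branch l (m + q) x w)) * e w)
        = (\<Sum>w<l ^ m. A w * e w) + (\<Sum>w<l ^ m. \<Sum>i\<in>I. of_real (\<epsilon> / real H * real (t i)) * (B i w * e w))"
      unfolding \<Phi>_def cocycle_slope_perturb of_real_add of_real_sum of_real_mult[of "\<epsilon> / real H * real (_ i)" for i]
        A_def B_def I_def
      by (simp only: distrib_right sum.distrib sum_distrib_right of_real_mult mult.assoc)
    also have "(\<Sum>w<l ^ m. \<Sum>i\<in>I. of_real (\<epsilon> / real H * real (t i)) * (B i w * e w))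
        = (\<Sum>i\<in>I. of_real (\<epsilon> / real H * real (t i)) * (\<Sum>w<l ^ m. B i w * e w))"
      by (subst sum.swap) (simp only: sum_distrib_left)
    finally have eq: "(\<Sum>w<l ^ m. of_real (cocycle_slope l lam (\<Phi> t) (m + q) (branch l (m + q) x w)) * e w)
        = (\<Sum>w<l ^ m. A w * e w) + (\<Sum>i\<in>I. of_real (\<epsilon> / real H * real (t i)) * (\<Sum>w<l ^ m. B i w * e w))" .
    have bs: "bs t f = (\<Sum>w<l ^ m. f w * e w) / of_nat (l ^ m)" for f
      by (simp only: bs_def branch_sum_def e_def)
    show ?thesis
      unfolding bs eq unfolding add_divide_distrib sum_divide_distrib[of _ I] by (simp only: times_divide_eq_right)
  qed
  have each: "(cmod (bs t (\<lambda>w. of_real (cocycle_slope l lam (\<Phi> t) (m + q) (branch l (m + q) x w)))))\<^sup>2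
      \<le> (1 + real (card I)) * ((cmod (bs t A))\<^sup>2 + (\<Sum>i\<in>I. (cmod (bs t (B i)))\<^sup>2))" if t: "t \<in> T" for t
  proof -
    have "(cmod (of_real (\<epsilon> / real H * real (t i)) * bs t (B i)))\<^sup>2 \<le> (cmod (bs t (B i)))\<^sup>2" if i: "i \<in> I" for i
    proof -
      have "t i < H" using t i by (auto simp: T_def I_def PiE_def)
      then have "\<epsilon> * real (t i) \<le> 1 * real H" using \<epsilon> by (intro mult_mono) auto
      then have "\<bar>\<epsilon> / real H * real (t i)\<bar> \<le> 1" using \<epsilon> H by (simp add: abs_mult)
      then have "cmod (of_real (\<epsilon> / real H * real (t i)) * bs t (B i)) \<le> 1 * cmod (bs t (B i))"
        unfolding norm_mult norm_of_real by (intro mult_right_mono) auto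
      then show ?thesis by (intro power_mono) auto
    qed
    then have "(\<Sum>i\<in>I. (cmod (of_real (\<epsilon> / real H * real (t i)) * bs t (B i)))\<^sup>2) \<le> (\<Sum>i\<in>I. (cmod (bs t (B i)))\<^sup>2)"
      by (rule sum_mono)
    then have "(1 + real (card I)) * ((cmod (bs t A))\<^sup>2 + (\<Sum>i\<in>I. (cmod (of_real (\<epsilon> / real H * real (t i)) * bs t (B i)))\<^sup>2))
        \<le> (1 + real (card I)) * ((cmod (bs t A))\<^sup>2 + (\<Sum>i\<in>I. (cmod (bs t (B i)))\<^sup>2))"
      by (intro mult_left_mono add_left_mono) auto
    moreover have "(cmod (bs t A + (\<Sum>i\<in>I. of_real (\<epsilon> / real H * real (t i)) * bs t (B i))))\<^sup>2
        \<le> (1 + real (card I)) * ((cmod (bs t A))\<^sup>2 + (\<Sum>i\<in>I. (cmod (of_real (\<epsilon> / real H * real (t i)) * bs t (B i)))\<^sup>2))"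
      by (rule cmod_sum_square_le[OF finI])
    ultimately show ?thesis unfolding split by (rule order_trans[rotated])
  qed
  have mean: "(\<Sum>t\<in>T. (cmod (bs t a))\<^sup>2) \<le> real (card T) * ((M / (1 - lam))\<^sup>2 * V)"
    if "\<And>w. cmod (a w) \<le> M / (1 - lam)" for a
    unfolding bs_def T_def V_def
    by (rule mean_square_branch_sum[OF l lam N F \<epsilon>(1) \<theta> s H]) (rule that)
  have "(\<Sum>t\<in>T. (cmod (bs t (\<lambda>w. of_real (cocycle_slope l lam (\<Phi> t) (m + q) (branch l (m + q) x w)))))\<^sup>2)
      \<le> (\<Sum>t\<in>T. (1 + real (card I)) * ((cmod (bs t A))\<^sup>2 + (\<Sum>i\<in>I. (cmod (bs t (B i)))\<^sup>2)))"
    using each by (rule sum_mono)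
  also have "\<dots> = (1 + real (card I)) * ((\<Sum>t\<in>T. (cmod (bs t A))\<^sup>2) + (\<Sum>i\<in>I. \<Sum>t\<in>T. (cmod (bs t (B i)))\<^sup>2))"
    by (simp only: sum_distrib_left[symmetric] sum.distrib sum.swap[of _ I])
  also have "\<dots> \<le> (1 + real (card I)) * (real (card T) * ((M / (1 - lam))\<^sup>2 * V) + (\<Sum>i\<in>I. real (card T) * ((M / (1 - lam))\<^sup>2 * V)))"
    by (intro mult_left_mono add_mono sum_mono mean A B) auto
  also have "\<dots> = real (card T) * (((1 + real (card I)) * (M / (1 - lam)))\<^sup>2 * V)"
    unfolding sum_constant power_mult_distrib by (simp add: power2_eq_square[of "1 + real (card I)"] algebra_simps)
  also have "(1 + real (card I)) * (M / (1 - lam)) = (1 + real (card I)) * M / (1 - lam)" by simp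
  finally show ?thesis by (simp only: bs_def I_def V_def)
qed

section \<open>Perturbations with small branch sums\<close>

lemma continuous_on_perturb_slope:
  "continuous_on UNIV F' \<Longrightarrow> continuous_on UNIV (perturb_slope F' N a)"
  unfolding perturb_slope_def wave_def by (intro continuous_intros) auto

text \<open>The bound \<open>u\<close> of the supremum is the integral from the Sobolev inequality, whose mean is the
  integral of the mean.\<close>

lemma mean_square_sup_branch_sum:
  fixes l m q H :: nat and \<epsilon> \<theta> lam s K :: real
  assumes l: "l \<ge> 2" and lam: "0 < lam" "lam < 1" and N: "transversal_degree l lam N"
    and F: "\<And>x k. F (x + of_int k) = F x" "\<And>x. (F has_real_derivative F' x) (at x)" "continuous_on UNIV F'"
    and \<epsilon>: "\<epsilon> > 0" "\<epsilon> \<le> 1" and \<theta>: "\<theta> > 0" and s: "0 \<le> s" "s \<le> 4" "1 < real l * lam powr s"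
    and H: "H > 0" "2 * \<theta> * \<epsilon> / (1 - lam) \<le> real H"
    and M: "\<And>x. \<bar>F' x\<bar> \<le> M" "2 * pi * real N \<le> M"
  defines "T \<equiv> PiE (wave_index N) (\<lambda>_. {..<H})"
  defines "K \<equiv> (1 + real (card (wave_index N))) * M / (1 - lam)"
  shows "\<exists>u. (\<forall>t\<in>T. 0 \<le> u t \<and> (\<forall>x\<in>{0..1}. (cmod (branch_sum l lam (grid_perturb F N \<epsilon> H t) m q (\<lambda>_. 1) \<theta> x))\<^sup>2 \<le> u t)) \<and>
    (\<Sum>t\<in>T. u t) \<le> real (card T) * ((1 + \<theta> + \<theta> * K\<^sup>2) *
       moment_bound l lam \<epsilon> s m \<theta>)"
proof -
  define V where "V = moment_bound l lam \<epsilon> s m \<theta>"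
  define G' where "G' t = perturb_slope F' N (\<lambda>i. \<epsilon> / real H * real (t i))" for t :: "nat \<times> nat \<times> nat \<Rightarrow> nat"
  define c where "c t = branch_sum l lam (grid_perturb F N \<epsilon> H t) m q (\<lambda>_. 1) \<theta>" for t
  define d where "d t x = branch_sum l lam (grid_perturb F N \<epsilon> H t) m q
        (\<lambda>w. of_real (cocycle_slope l lam (G' t) (m + q) (branch l (m + q) x w))) \<theta> x" for t x
  define g where "g t x = (1 + \<theta>) * (cmod (c t x))\<^sup>2 + (cmod (\<i> * of_real \<theta> * d t x))\<^sup>2 / \<theta>" for t x
  have contF: "continuous_on UNIV F"
    using F(2) by (meson DERIV_continuous continuous_at_imp_continuous_on)
  have deriv: "(grid_perturb F N \<epsilon> H t has_real_derivative G' t x) (at x)" for t x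
    unfolding grid_perturb_def G'_def by (rule perturb_has_derivative[OF F(2)])
  have contG: "continuous_on UNIV (grid_perturb F N \<epsilon> H t)" for t
    using deriv by (meson DERIV_continuous continuous_at_imp_continuous_on)
  have contG': "continuous_on UNIV (G' t)" for t
    unfolding G'_def by (rule continuous_on_perturb_slope[OF F(3)])
  have cd: "(c t has_vector_derivative \<i> * of_real \<theta> * d t x) (at x)" for t x
    unfolding c_def d_def by (rule branch_sum_has_derivative[OF deriv])
  have contc: "continuous_on UNIV (c t)" for t
    by (intro continuous_at_imp_continuous_on ballI has_vector_derivative_continuous[OF cd])
  have contd: "continuous_on UNIV (d t)" for t
    unfolding d_def by (intro continuous_on_branch_sum contG continuous_on_of_real continuous_on_cocycle_slope contG')
  have contd': "continuous_on UNIV (\<lambda>x. \<i> * of_real \<theta> * d t x)" for t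
    by (intro continuous_intros contd)
  have int_g: "g t integrable_on {0..1}" for t
    unfolding g_def divide_inverse
    by (intro integrable_continuous_interval continuous_intros continuous_on_subset[OF contc] continuous_on_subset[OF contd]) auto
  define u where "u t = integral {0..1} (g t)" for t
  have bound: "(cmod (c t x))\<^sup>2 \<le> u t" if "x \<in> {0..1}" for t x
    unfolding u_def g_def by (rule sobolev_sup_bound[OF cd contd' \<theta> that])
  have u0: "0 \<le> u t" for t
    using bound[of 0 t] by (meson atLeastAtMost_iff order.refl order_trans zero_le_one zero_le_power2)
  have finT: "finite T" unfolding T_def by (intro finite_PiE finite_wave_index) auto
  have gsum: "(\<Sum>t\<in>T. g t x) \<le> real (card T) * ((1 + \<theta> + \<theta> * K\<^sup>2) * V)" for x
  proof -
    have 1: "(\<Sum>t\<in>T. (cmod (c t x))\<^sup>2) \<le> real (card T) * (1\<^sup>2 * V)"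
      unfolding c_def T_def V_def
      by (rule mean_square_branch_sum[OF l lam N F(1) \<epsilon>(1) \<theta> s H]) simp
    have 2: "(\<Sum>t\<in>T. (cmod (d t x))\<^sup>2) \<le> real (card T) * (K\<^sup>2 * V)"
      unfolding d_def T_def V_def K_def G'_def
      by (rule mean_square_branch_sum_derivative[OF l lam N F(1) \<epsilon> \<theta> s H M])
    have "g t x = (1 + \<theta>) * (cmod (c t x))\<^sup>2 + \<theta> * (cmod (d t x))\<^sup>2" for t
      using \<theta> by (simp add: g_def norm_mult power2_eq_square)
    then have "(\<Sum>t\<in>T. g t x) = (1 + \<theta>) * (\<Sum>t\<in>T. (cmod (c t x))\<^sup>2) + \<theta> * (\<Sum>t\<in>T. (cmod (d t x))\<^sup>2)"
      by (simp add: sum.distrib sum_distrib_left)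
    also have "\<dots> \<le> (1 + \<theta>) * (real (card T) * (1\<^sup>2 * V)) + \<theta> * (real (card T) * (K\<^sup>2 * V))"
      using 1 2 \<theta> by (intro add_mono mult_left_mono) auto
    finally show ?thesis by (simp add: algebra_simps)
  qed
  have "(\<Sum>t\<in>T. u t) = integral {0..1} (\<lambda>x. \<Sum>t\<in>T. g t x)"
    unfolding u_def by (rule integral_sum[OF finT int_g, symmetric])
  also have "\<dots> \<le> integral {0..1} (\<lambda>x::real. real (card T) * ((1 + \<theta> + \<theta> * K\<^sup>2) * V))"
    by (rule Henstock_Kurzweil_Integration.integral_le) (auto intro!: integrable_sum finT int_g gsum)
  also have "\<dots> = real (card T) * ((1 + \<theta> + \<theta> * K\<^sup>2) * V)" by simp
  finally show ?thesis
    using u0 bound by (intro exI[of _ u]) (auto simp: c_def V_def)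
qed

lemma ex_le_of_sum_le:
  fixes g :: "'t \<Rightarrow> real"
  assumes "finite T" "T \<noteq> {}" "(\<Sum>t\<in>T. g t) \<le> real (card T) * c"
  shows "\<exists>t\<in>T. g t \<le> c"
proof (rule ccontr)
  assume "\<not> ?thesis"
  then have "(\<Sum>t\<in>T. c) < (\<Sum>t\<in>T. g t)" using assms by (intro sum_strict_mono) auto
  then show False using assms by simp
qed

text \<open>The constants \<open>C\<close> and \<open>s\<close> do not depend on \<open>m\<close>, \<open>q\<close>, or the range of frequencies; only the
  grid does. This allows \<open>m\<close> to be chosen after the cut-off \<open>J\<close>.\<close>

theorem ex_perturbation_small_branch_sums:
  fixes l :: nat and \<epsilon> \<omega> lam M :: real
  assumes l: "l \<ge> 2" and lam: "0 < lam" "lam < 1" "1 < lam ^ 3 * real l" and N: "transversal_degree l lam N"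
    and F: "\<And>x k. F (x + of_int k) = F x" "\<And>x. (F has_real_derivative F' x) (at x)" "continuous_on UNIV F'"
    and \<epsilon>: "\<epsilon> > 0" "\<epsilon> \<le> 1" and \<omega>: "\<omega> > 0" "\<omega> \<le> 1"
    and M: "\<And>x. \<bar>F' x\<bar> \<le> M" "2 * pi * real N \<le> M"
  shows "\<exists>C>0. \<exists>s>3. \<forall>m q J n \<rho>. 1 \<le> J \<longrightarrow> 0 < \<rho> \<longrightarrow>
    (\<exists>a u. (\<forall>i\<in>wave_index N. \<bar>a i\<bar> \<le> \<epsilon>) \<and>
      (\<forall>j\<in>{J..n}. \<forall>x\<in>{0..1}. cmod (branch_sum l lam (perturb F N a) m q (\<lambda>_. 1) (real j * \<omega>) x) \<le> u j) \<and>
      (\<Sum>j=J..n. \<rho> ^ j * u j) \<le> (\<Sum>j=J..n. \<rho> ^ j * (C * (sqrt (real j) * (sqrt (1 / real l ^ m) + real j powr (- s / 2))))))"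
proof -
  obtain s where s: "3 < s" "s \<le> 4" "1 < real l * lam powr s"
  proof -
    have "((\<lambda>s. real l * lam powr s) \<longlongrightarrow> real l * lam powr 3) (at_right 3)"
      using lam by (intro tendsto_intros) auto
    moreover have "1 < real l * lam powr 3" using lam by (simp add: powr_numeral mult.commute)
    ultimately have "eventually (\<lambda>s. 1 < real l * lam powr s) (at_right 3)" by (rule order_tendstoD)
    moreover have "eventually (\<lambda>s. s \<in> {3<..<4::real}) (at_right 3)" by (rule eventually_at_right_real) simp
    ultimately have "eventually (\<lambda>s. 1 < real l * lam powr s \<and> s \<in> {3<..<4::real}) (at_right 3)" by (rule eventually_conj)
    then obtain s where "1 < real l * lam powr s \<and> s \<in> {3<..<4::real}"
      using eventually_happens'[OF trivial_limit_at_right_real] by blast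
    then show ?thesis by (intro that[of s]) auto
  qed
  define K where "K = (1 + real (card (wave_index N))) * M / (1 - lam)"
  define C1 where "C1 = (16 / \<epsilon>) powr s / (1 - 1 / (real l * lam powr s))"
  have C1: "C1 \<ge> 0" using s by (simp add: C1_def)
  define C where "C = sqrt ((2 + K\<^sup>2) * (1 + C1 * \<omega> powr - s))"
  have C: "C > 0" using C1 by (simp add: C_def add_pos_nonneg)
  show ?thesis
  proof (rule exI[of _ C], rule conjI[OF C], rule exI[of _ s], rule conjI[OF s(1)], intro allI impI)
    fix m q J n :: nat and \<rho> :: real
    assume J: "1 \<le> J" and \<rho>: "0 < \<rho>"
    define H where "H = nat \<lceil>2 * real n * \<epsilon> / (1 - lam)\<rceil> + 1"
    have H: "H > 0" "2 * real n * \<epsilon> / (1 - lam) \<le> real H" unfolding H_def by linarith+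
    define T where "T = PiE (wave_index N) (\<lambda>_. {..<H})"
    have finT: "finite T" unfolding T_def by (intro finite_PiE finite_wave_index) auto
    have neT: "T \<noteq> {}" using H(1) by (auto simp: T_def PiE_eq_empty_iff)
    define B where "B j = C * (sqrt (real j) * (sqrt (1 / real l ^ m) + real j powr (- s / 2)))" for j
    have "\<exists>u. (\<forall>t\<in>T. 0 \<le> u t \<and> (\<forall>x\<in>{0..1}. (cmod (branch_sum l lam (grid_perturb F N \<epsilon> H t) m q (\<lambda>_. 1) (real j * \<omega>) x))\<^sup>2 \<le> u t)) \<and>
        (\<Sum>t\<in>T. u t) \<le> real (card T) * (B j)\<^sup>2" if j: "j \<in> {J..n}" for j
    proof -
      have j1: "1 \<le> real j" using j J by simp
      define \<theta> where "\<theta> = real j * \<omega>"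
      have \<theta>: "\<theta> > 0" "\<theta> \<le> real j" using j1 \<omega> by (auto simp: \<theta>_def mult_le_cancel_left2)
      have "2 * \<theta> * \<epsilon> / (1 - lam) \<le> 2 * real n * \<epsilon> / (1 - lam)"
        using \<theta> j \<epsilon> lam by (intro divide_right_mono mult_right_mono) auto
      then have H2: "2 * \<theta> * \<epsilon> / (1 - lam) \<le> real H" using H(2) by linarith
      obtain u where u: "\<forall>t\<in>T. 0 \<le> u t \<and> (\<forall>x\<in>{0..1}. (cmod (branch_sum l lam (grid_perturb F N \<epsilon> H t) m q (\<lambda>_. 1) \<theta> x))\<^sup>2 \<le> u t)"
          "(\<Sum>t\<in>T. u t) \<le> real (card T) * ((1 + \<theta> + \<theta> * K\<^sup>2) * (1 / real l ^ m + C1 * \<theta> powr - s))"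
        using mean_square_sup_branch_sum[OF l lam(1,2) N F \<epsilon> \<theta>(1) _ s(2,3) H(1) H2 M, of m q] s(1)
        unfolding T_def K_def C1_def by auto
      define P where "P = real j powr (- s)"
      have P: "P = (real j powr (- s / 2))\<^sup>2" using j1 by (simp add: P_def power2_eq_square flip: powr_add)
      have "(1 + \<theta> + \<theta> * K\<^sup>2) * (1 / real l ^ m + C1 * \<theta> powr - s)
          \<le> (real j * (2 + K\<^sup>2)) * ((1 + C1 * \<omega> powr - s) * (1 / real l ^ m + P))"
      proof (rule mult_mono)
        show "1 + \<theta> + \<theta> * K\<^sup>2 \<le> real j * (2 + K\<^sup>2)"
          using \<theta> j1 mult_right_mono[OF \<theta>(2) zero_le_power2[of K]] unfolding distrib_left by linarith
        have "\<theta> powr - s = P * \<omega> powr - s" using \<omega> j1 by (simp add: \<theta>_def P_def powr_mult)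
        moreover have "0 \<le> C1 * \<omega> powr - s * (1 / real l ^ m)" "0 \<le> P" using C1 by (auto simp: P_def)
        ultimately show "1 / real l ^ m + C1 * \<theta> powr - s \<le> (1 + C1 * \<omega> powr - s) * (1 / real l ^ m + P)"
          by (simp add: algebra_simps)
      qed (use C1 \<theta> in auto)
      also have "\<dots> = C\<^sup>2 * real j * (1 / real l ^ m + P)"
        using C1 by (simp add: C_def add_nonneg_nonneg)
      also have "\<dots> \<le> C\<^sup>2 * real j * (sqrt (1 / real l ^ m) + real j powr (- s / 2))\<^sup>2"
        unfolding P by (intro mult_left_mono) (auto simp: power2_sum)
      also have "\<dots> = (B j)\<^sup>2" by (simp add: B_def power_mult_distrib)
      finally have "real (card T) * ((1 + \<theta> + \<theta> * K\<^sup>2) * (1 / real l ^ m + C1 * \<theta> powr - s)) \<le> real (card T) * (B j)\<^sup>2"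
        by (intro mult_left_mono) auto
      then show ?thesis using u unfolding \<theta>_def by (intro exI[of _ u]) auto
    qed
    then obtain U where U: "\<And>j t x. j \<in> {J..n} \<Longrightarrow> t \<in> T \<Longrightarrow> x \<in> {0..1} \<Longrightarrow>
          (cmod (branch_sum l lam (grid_perturb F N \<epsilon> H t) m q (\<lambda>_. 1) (real j * \<omega>) x))\<^sup>2 \<le> U j t"
        "\<And>j t. j \<in> {J..n} \<Longrightarrow> t \<in> T \<Longrightarrow> 0 \<le> U j t"
        "\<And>j. j \<in> {J..n} \<Longrightarrow> (\<Sum>t\<in>T. U j t) \<le> real (card T) * (B j)\<^sup>2"
      by metis
    have B: "B j > 0" if "j \<in> {J..n}" for j
      using C that J l by (auto simp: B_def intro!: mult_pos_pos add_pos_nonneg)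
    \<comment> \<open>A bound for the mean of the square root from the mean of its argument, which is known to be at most \<open>b\<^sup>2\<close>.\<close>
    have sqrt_le: "sqrt x \<le> (x / b + b) / 2" if "b > 0" "x \<ge> 0" for x b :: real
    proof -
      have "0 \<le> (sqrt x - b)\<^sup>2 / b" using that by simp
      also have "\<dots> = x / b + b - 2 * sqrt x" using that by (simp add: power2_diff power2_eq_square field_simps)
      finally show ?thesis by simp
    qed
    have "(\<Sum>t\<in>T. \<Sum>j=J..n. \<rho> ^ j * sqrt (U j t)) = (\<Sum>j=J..n. \<rho> ^ j * (\<Sum>t\<in>T. sqrt (U j t)))"
      by (subst sum.swap) (simp add: sum_distrib_left)
    also have "\<dots> \<le> (\<Sum>j=J..n. \<rho> ^ j * (real (card T) * B j))"
    proof (intro sum_mono mult_left_mono)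
      fix j assume j: "j \<in> {J..n}"
      have "(\<Sum>t\<in>T. sqrt (U j t)) \<le> (\<Sum>t\<in>T. (U j t / B j + B j) / 2)"
        using U(2) j B by (intro sum_mono sqrt_le) auto
      also have "\<dots> = ((\<Sum>t\<in>T. U j t) / B j + real (card T) * B j) / 2"
        by (simp add: sum.distrib sum_divide_distrib add_divide_distrib)
      also have "\<dots> \<le> (real (card T) * (B j)\<^sup>2 / B j + real (card T) * B j) / 2"
        using U(3)[OF j] B[OF j] by (intro divide_right_mono add_right_mono) auto
      also have "\<dots> = real (card T) * B j" using B[OF j] by (simp add: power2_eq_square)
      finally show "(\<Sum>t\<in>T. sqrt (U j t)) \<le> real (card T) * B j" .
    qed (use \<rho> in auto)
    also have "\<dots> = real (card T) * (\<Sum>j=J..n. \<rho> ^ j * B j)"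
      by (simp add: sum_distrib_left mult.left_commute)
    finally obtain t where t: "t \<in> T" "(\<Sum>j=J..n. \<rho> ^ j * sqrt (U j t)) \<le> (\<Sum>j=J..n. \<rho> ^ j * B j)"
      using ex_le_of_sum_le[OF finT neT] by blast
    define a where "a i = \<epsilon> / real H * real (t i)" for i
    have a: "\<bar>a i\<bar> \<le> \<epsilon>" if "i \<in> wave_index N" for i
    proof -
      have "t i < H" using t(1) that by (auto simp: T_def PiE_def)
      then have "\<epsilon> * real (t i) \<le> \<epsilon> * real H" using \<epsilon> by (intro mult_left_mono) auto
      then show ?thesis using \<epsilon> H by (simp add: a_def abs_mult divide_le_eq)
    qed
    have pa: "perturb F N a = grid_perturb F N \<epsilon> H t" by (simp add: grid_perturb_def a_def[abs_def])
    have "cmod (branch_sum l lam (perturb F N a) m q (\<lambda>_. 1) (real j * \<omega>) x) \<le> sqrt (U j t)"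
      if "j \<in> {J..n}" "x \<in> {0..1}" for j x
      unfolding pa using U(1)[OF that(1) t(1) that(2)] by (rule real_le_rsqrt)
    then show "\<exists>a u. (\<forall>i\<in>wave_index N. \<bar>a i\<bar> \<le> \<epsilon>) \<and>
      (\<forall>j\<in>{J..n}. \<forall>x\<in>{0..1}. cmod (branch_sum l lam (perturb F N a) m q (\<lambda>_. 1) (real j * \<omega>) x) \<le> u j) \<and>
      (\<Sum>j=J..n. \<rho> ^ j * u j) \<le> (\<Sum>j=J..n. \<rho> ^ j * (C * (sqrt (real j) * (sqrt (1 / real l ^ m) + real j powr (- s / 2)))))"
      using a t(2) unfolding B_def
      by (intro exI[of _ a] exI[of _ "\<lambda>j. sqrt (U j t)"] conjI ballI) auto
  qed
qed

section \<open>A Poisson kernel minorant\<close>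

definition poisson :: "real \<Rightarrow> real \<Rightarrow> real"
  where "poisson \<rho> v = (1 - \<rho>\<^sup>2) / (1 - 2 * \<rho> * cos v + \<rho>\<^sup>2)"

lemma poisson_denominator_pos:
  fixes \<rho> v :: real
  assumes "0 \<le> \<rho>" "\<rho> < 1"
  shows "0 < 1 - 2 * \<rho> * cos v + \<rho>\<^sup>2"
proof -
  have "0 < (1 - \<rho>)\<^sup>2" using assms by (intro zero_less_power) simp
  also have "\<dots> \<le> 1 - 2 * \<rho> * cos v + \<rho>\<^sup>2"
    using mult_left_mono[OF cos_le_one[of v], of "2 * \<rho>"] assms by (simp add: power2_diff)
  finally show ?thesis .
qed

lemma poisson_sums:
  assumes "0 \<le> \<rho>" "\<rho> < 1"
  shows "(\<lambda>j. 2 * \<rho> ^ Suc j * cos (real (Suc j) * v)) sums (poisson \<rho> v - 1)"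
proof -
  define z where "z = of_real \<rho> * cis v"
  have z: "cmod z < 1" using assms by (simp add: z_def norm_mult)
  have "(\<lambda>j. z ^ Suc j) sums (z * (1 / (1 - z)))"
    using sums_mult[OF geometric_sums[OF z], of z] by simp
  then have "(\<lambda>j. Re (z ^ Suc j)) sums Re (z * (1 / (1 - z)))" by (rule sums_Re)
  moreover have "Re (z ^ Suc j) = \<rho> ^ Suc j * cos (real (Suc j) * v)" for j
    unfolding z_def power_mult_distrib Complex.DeMoivre by (simp flip: of_real_power)
  moreover have "2 * Re (z * (1 / (1 - z))) = poisson \<rho> v - 1"
  proof -
    have den: "(1 - Re z)\<^sup>2 + (Im z)\<^sup>2 = 1 - 2 * \<rho> * cos v + \<rho>\<^sup>2"
    proof -
      have "(1 - \<rho> * cos v)\<^sup>2 + (\<rho> * sin v)\<^sup>2 = 1 - 2 * \<rho> * cos v + (\<rho>\<^sup>2 * (sin v)\<^sup>2 + \<rho>\<^sup>2 * (cos v)\<^sup>2)"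
        by (simp add: power2_eq_square algebra_simps)
      also have "\<rho>\<^sup>2 * (sin v)\<^sup>2 + \<rho>\<^sup>2 * (cos v)\<^sup>2 = \<rho>\<^sup>2" by (simp flip: distrib_left)
      finally show ?thesis by (simp add: z_def)
    qed
    have "Re (z * (1 / (1 - z))) = (Re z * (1 - Re z) - (Im z)\<^sup>2) / (1 - 2 * \<rho> * cos v + \<rho>\<^sup>2)"
      unfolding den[symmetric] by (simp add: Re_divide power2_eq_square)
    also have "Re z * (1 - Re z) - (Im z)\<^sup>2 = \<rho> * cos v - \<rho>\<^sup>2"
    proof -
      have "Re z * (1 - Re z) - (Im z)\<^sup>2 = \<rho> * cos v - (\<rho>\<^sup>2 * (sin v)\<^sup>2 + \<rho>\<^sup>2 * (cos v)\<^sup>2)"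
        by (simp add: z_def power2_eq_square algebra_simps)
      also have "\<rho>\<^sup>2 * (sin v)\<^sup>2 + \<rho>\<^sup>2 * (cos v)\<^sup>2 = \<rho>\<^sup>2" by (simp flip: distrib_left)
      finally show ?thesis .
    qed
    finally show ?thesis
      using poisson_denominator_pos[OF assms, of v] by (simp add: poisson_def field_simps)
  qed
  ultimately show ?thesis
    using sums_mult[of "\<lambda>j. Re (z ^ Suc j)" "Re (z * (1 / (1 - z)))" 2] by (simp add: mult.assoc)
qed

text \<open>Far from 0 the kernel with parameter \<open>1 - 4 \<sigma>\<close> is about four times as large as the one with
  parameter \<open>1 - \<sigma>\<close>, so it dominates even twice the latter. Both have mean 1, so the
  combination still has mean 1, and its Fourier coefficients lie between 0 and \<open>2 (1 - \<sigma>)\<^sup>j\<close>.\<close>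

lemma poisson_minorant_support:
  assumes \<sigma>: "0 < \<sigma>" "\<sigma> \<le> 1 / 8" and pos: "2 * poisson (1 - \<sigma>) v - poisson (1 - 4 * \<sigma>) v > 0"
  shows "1 - cos v < 11 * \<sigma>\<^sup>2"
proof -
  define u where "u = 1 - cos v"
  have u: "u \<ge> 0" by (simp add: u_def)
  have d1: "1 - 2 * (1 - \<sigma>) * cos v + (1 - \<sigma>)\<^sup>2 = \<sigma>\<^sup>2 + 2 * (1 - \<sigma>) * u"
    by (simp add: u_def power2_eq_square algebra_simps)
  have d2: "1 - 2 * (1 - 4 * \<sigma>) * cos v + (1 - 4 * \<sigma>)\<^sup>2 = 16 * \<sigma>\<^sup>2 + 2 * (1 - 4 * \<sigma>) * u"
    by (simp add: u_def power2_eq_square algebra_simps)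
  have p1: "\<sigma>\<^sup>2 + 2 * (1 - \<sigma>) * u > 0" and p2: "16 * \<sigma>\<^sup>2 + 2 * (1 - 4 * \<sigma>) * u > 0"
    using \<sigma> u by (auto intro!: add_pos_nonneg)
  have "(1 - (1 - 4 * \<sigma>)\<^sup>2) / (16 * \<sigma>\<^sup>2 + 2 * (1 - 4 * \<sigma>) * u) < 2 * ((1 - (1 - \<sigma>)\<^sup>2) / (\<sigma>\<^sup>2 + 2 * (1 - \<sigma>) * u))"
    using pos unfolding poisson_def d1 d2 by simp
  then have "(1 - (1 - 4 * \<sigma>)\<^sup>2) * (\<sigma>\<^sup>2 + 2 * (1 - \<sigma>) * u) < 2 * (1 - (1 - \<sigma>)\<^sup>2) * (16 * \<sigma>\<^sup>2 + 2 * (1 - 4 * \<sigma>) * u)"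
    using p1 p2 by (simp add: field_simps)
  also have "2 * (1 - (1 - \<sigma>)\<^sup>2) * (16 * \<sigma>\<^sup>2 + 2 * (1 - 4 * \<sigma>) * u) =
      (2 * \<sigma>) * ((2 - \<sigma>) * (16 * \<sigma>\<^sup>2 + 2 * (1 - 4 * \<sigma>) * u))"
    by (simp add: power2_eq_square algebra_simps)
  also have "(1 - (1 - 4 * \<sigma>)\<^sup>2) * (\<sigma>\<^sup>2 + 2 * (1 - \<sigma>) * u) = (2 * \<sigma>) * (4 * (1 - 2 * \<sigma>) * (\<sigma>\<^sup>2 + 2 * (1 - \<sigma>) * u))"
    by (simp add: power2_eq_square algebra_simps)
  finally have "4 * (1 - 2 * \<sigma>) * (\<sigma>\<^sup>2 + 2 * (1 - \<sigma>) * u) < (2 - \<sigma>) * (16 * \<sigma>\<^sup>2 + 2 * (1 - 4 * \<sigma>) * u)"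
    using \<sigma> by simp
  then have "(4 - 6 * \<sigma> + 8 * \<sigma>\<^sup>2) * u < (28 - 8 * \<sigma>) * \<sigma>\<^sup>2"
    by (simp add: power2_eq_square algebra_simps)
  moreover have "3 * u \<le> (4 - 6 * \<sigma> + 8 * \<sigma>\<^sup>2) * u" 
  proof (rule mult_right_mono[OF _ u])
    have "0 \<le> 8 * \<sigma>\<^sup>2" by simp
    then show "3 \<le> 4 - 6 * \<sigma> + 8 * \<sigma>\<^sup>2" using \<sigma> by linarith
  qed
  moreover have "(28 - 8 * \<sigma>) * \<sigma>\<^sup>2 \<le> 28 * \<sigma>\<^sup>2" using \<sigma> by (intro mult_right_mono) auto
  ultimately have "3 * u < 28 * \<sigma>\<^sup>2" by linarith
  also have "28 * \<sigma>\<^sup>2 \<le> 3 * (11 * \<sigma>\<^sup>2)" by simp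
  finally show ?thesis unfolding u_def by simp
qed

text \<open>The hypothesis on \<open>v\<close> excludes that \<open>v\<close> is close to a nonzero multiple of \<open>2 \<pi>\<close>.\<close>

lemma abs_less_of_cos_near_one:
  assumes \<sigma>: "0 < \<sigma>" "\<sigma> \<le> 1 / 20" and c: "1 - cos v < 11 * \<sigma>\<^sup>2" and v: "\<bar>v\<bar> \<le> pi + 2"
  shows "\<bar>v\<bar> < 10 * \<sigma>"
proof -
  have small: "\<bar>w\<bar> < 10 * \<sigma>" if w: "\<bar>w\<bar> \<le> pi" "1 - cos w < 11 * \<sigma>\<^sup>2" for w
  proof -
    have "1 - cos w = 2 * (sin (w / 2))\<^sup>2" using cos_double_sin[of "w / 2"] by simp
    moreover have "(\<bar>w\<bar> / 4)\<^sup>2 \<le> \<bar>sin (w / 2)\<bar>\<^sup>2"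
      using abs_sin_ge_half[of "w / 2"] w(1) by (intro power_mono) auto
    ultimately have "w\<^sup>2 < 88 * \<sigma>\<^sup>2" using w(2) by (simp add: power_divide)
    also have "\<dots> \<le> (10 * \<sigma>)\<^sup>2" by (simp add: power_mult_distrib)
    finally have "\<bar>w\<bar>\<^sup>2 < (10 * \<sigma>)\<^sup>2" by simp
    then show ?thesis by (rule power2_less_imp_less) (use \<sigma> in simp)
  qed
  show ?thesis
  proof (cases "\<bar>v\<bar> \<le> pi")
    case False
    define w where "w = \<bar>v\<bar> - 2 * pi"
    have pi: "pi > 3" by (rule pi_gt3)
    have "cos w = cos v" by (simp add: w_def cos_diff)
    then have "\<bar>w\<bar> < 10 * \<sigma>" using c v False pi by (intro small) (auto simp: w_def)
    then have False using v \<sigma> pi by (simp add: w_def)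
    then show ?thesis ..
  qed (use small c in auto)
qed

section \<open>Mean value of a trigonometric polynomial\<close>

text \<open>The polynomial has mean 0 over the \<open>J\<close>-th roots of unity.\<close>

lemma ex_trig_poly_nonneg:
  fixes b :: "nat \<Rightarrow> complex"
  assumes J: "J > 0"
  shows "\<exists>v. \<bar>v\<bar> \<le> pi \<and> 0 \<le> (\<Sum>j=1..<J. Re (cis (real j * v) * b j))"
proof -
  define f where "f v = (\<Sum>j=1..<J. Re (cis (real j * v) * b j))" for v
  define p where "p k = 2 * pi * real k / real J" for k
  have zero: "(\<Sum>k<J. cis (real j * p k)) = 0" if j: "j \<in> {1..<J}" for j
  proof -
    define z where "z = cis (2 * pi * real j / real J)"
    have "z \<noteq> 1"
    proof
      assume "z = 1"
      then have "cos (2 * pi * real j / real J) = 1" by (simp add: z_def complex_eq_iff)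
      then obtain n :: int where "2 * pi * real j / real J = of_int n * 2 * pi" by (auto simp: cos_one_2pi_int)
      then have "real j = of_int n * real J" using J by (simp add: field_simps)
      then have "real_of_int (int j) = of_int (n * int J)" by simp
      then have "int j = n * int J" by (simp only: of_int_eq_iff)
      then have "int J dvd int j" by simp
      then show False using j by (auto dest: dvd_imp_le)
    qed
    moreover have "z ^ J = 1" using J by (simp add: z_def Complex.DeMoivre complex_eq_iff)
    moreover have "cis (real j * p k) = z ^ k" for k
      by (simp add: z_def Complex.DeMoivre p_def mult_ac)
    ultimately show ?thesis by (simp add: sum_gp_strict)
  qed
  have "(\<Sum>k<J. f (p k)) = (\<Sum>j=1..<J. Re ((\<Sum>k<J. cis (real j * p k)) * b j))"
    unfolding f_def by (subst sum.swap) (simp only: Re_sum sum_distrib_right)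
  also have "\<dots> = 0" using zero by simp
  finally have "\<exists>k<J. 0 \<le> f (p k)"
    using J sum_strict_mono[of "{..<J}" "\<lambda>k. f (p k)" "\<lambda>_. 0"] by (force simp: not_le)
  then obtain k where k: "k < J" "0 \<le> f (p k)" by blast
  have p: "0 \<le> p k" "p k \<le> 2 * pi" using k J by (auto simp: p_def divide_le_eq)
  have "f (p k - 2 * pi) = f (p k)"
  proof -
    have "cis (real j * (p k - 2 * pi)) = cis (real j * p k)" for j
      by (simp add: right_diff_distrib complex_eq_iff cos_diff sin_diff mult.commute[of "real j"] flip: mult.assoc)
    then show ?thesis by (simp add: f_def)
  qed
  then have "0 \<le> f (p k - 2 * pi)" using k by simp
  moreover have "\<bar>p k\<bar> \<le> pi \<or> \<bar>p k - 2 * pi\<bar> \<le> pi" using p by linarith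
  ultimately show ?thesis using k(2) unfolding f_def[symmetric] by blast
qed

section \<open>From small exponential sums to a recurrent box\<close>

text \<open>If no \<open>S w\<close> is close to \<open>v\<close>, the kernel is nonpositive at all \<open>v - S w\<close>, hence so is
  its average over \<open>w\<close>. In the Fourier series of this average, the constant term is 1 and the low, high
  and very high frequencies contribute at least \<open>- 1 / 4\<close> each, which gives a positive value.\<close>

lemma ex_close_point:
  fixes S :: "nat \<Rightarrow> real" and c :: "nat \<Rightarrow> complex" and v \<sigma> :: real
  assumes L: "L > 0" and c: "\<And>j. c j = (\<Sum>w<L. cis (real j * S w)) / of_nat L"
    and \<sigma>: "0 < \<sigma>" "\<sigma> \<le> 1 / 20"
    and low: "- 1 / 4 \<le> 2 * (\<Sum>j=1..<J. (2 * (1 - \<sigma>) ^ j - (1 - 4 * \<sigma>) ^ j) * Re (cis (real j * v) * cnj (c j)))"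
    and high: "(\<Sum>j=J..n. (1 - \<sigma>) ^ j * u j) \<le> 1 / 16" "\<And>j. j \<in> {J..n} \<Longrightarrow> cmod (c j) \<le> u j"
    and J: "1 \<le> J" "J \<le> n" and tail: "4 * (1 - \<sigma>) ^ n \<le> \<sigma> / 4"
    and near: "\<And>w. w < L \<Longrightarrow> \<bar>v - S w\<bar> \<le> pi + 2"
  shows "\<exists>w<L. \<bar>v - S w\<bar> < 10 * \<sigma>"
proof (rule ccontr)
  assume neg: "\<not> ?thesis"
  define \<rho> \<rho>' where "\<rho> = 1 - \<sigma>" and "\<rho>' = 1 - 4 * \<sigma>"
  have \<rho>: "0 \<le> \<rho>" "\<rho> < 1" "0 \<le> \<rho>'" "\<rho>' < 1" "\<rho>' \<le> \<rho>" using \<sigma> by (auto simp: \<rho>_def \<rho>'_def)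
  define p where "p j = 2 * \<rho> ^ j - \<rho>' ^ j" for j
  have p: "0 \<le> p j" "p j \<le> 2 * \<rho> ^ j" for j
    using power_mono[OF \<rho>(5,3), of j] zero_le_power[OF \<rho>(1), of j] zero_le_power[OF \<rho>(3), of j]
    by (simp_all add: p_def)
  define r where "r j = Re (cis (real j * v) * cnj (c j))" for j
  have r_avg: "r j = (\<Sum>w<L. cos (real j * (v - S w))) / real L" for j
  proof -
    have "cis (real j * v) * cnj (c j) = (\<Sum>w<L. cis (real j * (v - S w))) / of_nat L"
      by (simp add: c sum_distrib_left cis_cnj cis_mult right_diff_distrib)
    then show ?thesis by (simp add: r_def Re_divide_of_nat)
  qed
  have r1: "\<bar>r j\<bar> \<le> cmod (c j)" for j
    unfolding r_def using abs_Re_le_cmod[of "cis (real j * v) * cnj (c j)"] by (simp add: norm_mult)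
  have c1: "cmod (c j) \<le> 1" for j
  proof -
    have "cmod (\<Sum>w<L. cis (real j * S w)) \<le> real L"
      using norm_sum[of "\<lambda>w. cis (real j * S w)" "{..<L}"] by simp
    then show ?thesis using L by (simp add: c norm_divide)
  qed
  have nonpos: "2 * poisson \<rho> (v - S w) - poisson \<rho>' (v - S w) \<le> 0" if w: "w < L" for w
  proof (rule ccontr)
    assume "\<not> ?thesis"
    then have "1 - cos (v - S w) < 11 * \<sigma>\<^sup>2"
      using \<sigma> unfolding \<rho>_def \<rho>'_def by (intro poisson_minorant_support) auto
    then have "\<bar>v - S w\<bar> < 10 * \<sigma>" using near[OF w] \<sigma> by (intro abs_less_of_cos_near_one)
    with neg w show False by blast
  qed
  have ser: "(\<lambda>j. 2 * p (Suc j) * cos (real (Suc j) * x)) sums (2 * poisson \<rho> x - poisson \<rho>' x - 1)" for x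
  proof -
    have "(\<lambda>j. 2 * (2 * \<rho> ^ Suc j * cos (real (Suc j) * x)) - 2 * \<rho>' ^ Suc j * cos (real (Suc j) * x))
        sums (2 * (poisson \<rho> x - 1) - (poisson \<rho>' x - 1))"
      using \<rho> by (intro sums_diff sums_mult poisson_sums) auto
    moreover have "2 * (2 * \<rho> ^ Suc j * cos (real (Suc j) * x)) - 2 * \<rho>' ^ Suc j * cos (real (Suc j) * x)
        = 2 * p (Suc j) * cos (real (Suc j) * x)" for j
      by (simp add: p_def algebra_simps)
    ultimately show ?thesis by simp
  qed
  have "(\<lambda>j. (\<Sum>w<L. 2 * p (Suc j) * cos (real (Suc j) * (v - S w))) / real L)
      sums ((\<Sum>w<L. 2 * poisson \<rho> (v - S w) - poisson \<rho>' (v - S w) - 1) / real L)"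
    by (intro sums_divide sums_sum ser)
  moreover have "(\<Sum>w<L. 2 * p (Suc j) * cos (real (Suc j) * (v - S w))) / real L = 2 * p (Suc j) * r (Suc j)" for j
    by (simp add: r_avg sum_distrib_left)
  ultimately have sums: "(\<lambda>j. 2 * p (Suc j) * r (Suc j)) sums ((\<Sum>w<L. 2 * poisson \<rho> (v - S w) - poisson \<rho>' (v - S w) - 1) / real L)"
    (is "_ sums ?X") by simp
  have "?X \<le> (\<Sum>w<L. - 1) / real L"
    using nonpos by (intro divide_right_mono sum_mono) auto
  then have X: "?X \<le> - 1" using L by simp
  have rest: "(\<lambda>j. 2 * p (Suc (j + n)) * r (Suc (j + n))) sums (?X - (\<Sum>j<n. 2 * p (Suc j) * r (Suc j)))"
    using sums by (rule sums_split_initial_segment)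
  have geo: "(\<lambda>j. - (4 * \<rho> ^ n) * \<rho> ^ j) sums (- (4 * \<rho> ^ n) * (1 / (1 - \<rho>)))"
    using \<rho> by (intro sums_mult geometric_sums) auto
  have lower: "- (4 * \<rho> ^ n) * \<rho> ^ j \<le> 2 * p (Suc (j + n)) * r (Suc (j + n))" for j
  proof -
    have "\<bar>2 * p (Suc (j + n)) * r (Suc (j + n))\<bar> \<le> 2 * (2 * \<rho> ^ Suc (j + n)) * 1"
      unfolding abs_mult using p[of "Suc (j + n)"] r1[of "Suc (j + n)"] c1[of "Suc (j + n)"] 
      by (intro mult_mono) auto
    also have "\<dots> \<le> 4 * \<rho> ^ (j + n)" using \<rho> by (simp add: mult_left_le_one_le)
    also have "\<dots> = 4 * \<rho> ^ n * \<rho> ^ j" by (simp add: power_add)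
    finally show ?thesis by linarith
  qed
  have "- (4 * \<rho> ^ n) * (1 / (1 - \<rho>)) \<le> ?X - (\<Sum>j<n. 2 * p (Suc j) * r (Suc j))"
    by (rule sums_le[OF lower geo rest])
  moreover have "4 * \<rho> ^ n * (1 / (1 - \<rho>)) \<le> 1 / 4"
    using tail \<sigma> by (simp add: \<rho>_def divide_le_eq)
  ultimately have 1: "(\<Sum>j<n. 2 * p (Suc j) * r (Suc j)) \<le> - 3 / 4" using X by simp
  have "(\<Sum>j<n. 2 * p (Suc j) * r (Suc j)) = (\<Sum>j=1..n. 2 * p j * r j)"
    by (rule sum.reindex_bij_witness[where i="\<lambda>j. j - 1" and j=Suc]) auto
  also have "{1..n} = {1..<J} \<union> {J..n}" using J by auto
  also have "(\<Sum>j\<in>{1..<J} \<union> {J..n}. 2 * p j * r j) = (\<Sum>j=1..<J. 2 * p j * r j) + (\<Sum>j=J..n. 2 * p j * r j)"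
    by (rule sum.union_disjoint) auto
  finally have 2: "(\<Sum>j<n. 2 * p (Suc j) * r (Suc j)) = (\<Sum>j=1..<J. 2 * p j * r j) + (\<Sum>j=J..n. 2 * p j * r j)" .
  have "(\<Sum>j=J..n. - (4 * (\<rho> ^ j * u j))) \<le> (\<Sum>j=J..n. 2 * p j * r j)"
  proof (rule sum_mono)
    fix j assume j: "j \<in> {J..n}"
    have "\<bar>2 * p j * r j\<bar> \<le> 2 * (2 * \<rho> ^ j) * u j"
      unfolding abs_mult using p[of j] r1[of j] high(2)[OF j] \<rho> by (intro mult_mono) auto
    then show "- (4 * (\<rho> ^ j * u j)) \<le> 2 * p j * r j" by linarith
  qed
  moreover have "(\<Sum>j=J..n. - (4 * (\<rho> ^ j * u j))) = - 4 * (\<Sum>j=J..n. \<rho> ^ j * u j)"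
    by (simp add: sum_negf sum_distrib_left)
  ultimately have "- 1 / 4 \<le> (\<Sum>j=J..n. 2 * p j * r j)" using high(1) by (simp add: \<rho>_def)
  moreover have "- 1 / 4 \<le> (\<Sum>j=1..<J. 2 * p j * r j)"
    using low unfolding p_def r_def \<rho>_def \<rho>'_def sum_distrib_left mult.assoc .
  ultimately show False using 1 2 by linarith
qed

lemma norm_cis_diff_le: "cmod (cis a - cis b) \<le> \<bar>a - b\<bar>"
proof -
  have "cis a - cis b = cis a * (1 - cis (b - a))" by (simp add: right_diff_distrib cis_mult)
  then have "cmod (cis a - cis b) = 2 * \<bar>sin ((b - a) / 2)\<bar>" by (simp add: norm_mult norm_one_minus_cis)
  also have "\<dots> \<le> 2 * \<bar>(b - a) / 2\<bar>" by (intro mult_left_mono abs_sin_x_le_abs_x) auto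
  finally show ?thesis by simp
qed

text \<open>For bounded \<open>j\<close> the coefficients of the kernel are close to 1, and the remaining deviations
  are those of the base point, which ranges over a short interval, and of \<open>v\<close> from \<open>v0\<close>.\<close>

lemma low_frequency_bound:
  fixes c c0 :: "nat \<Rightarrow> complex" and v v0 \<sigma> \<delta> \<delta>' :: real
  assumes \<sigma>: "0 < \<sigma>" "\<sigma> \<le> 1 / 20"
    and mean: "0 \<le> (\<Sum>j=1..<J. Re (cis (real j * v0) * cnj (c0 j)))"
    and c1: "\<And>j. cmod (c j) \<le> 1" and c: "\<And>j. cmod (c j - c0 j) \<le> real j * \<delta>"
    and v: "\<bar>v - v0\<bar> \<le> \<delta>'" and small: "(6 * \<sigma> + \<delta> + \<delta>') * (real J)\<^sup>2 \<le> 1 / 8"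
  shows "- 1 / 4 \<le> 2 * (\<Sum>j=1..<J. (2 * (1 - \<sigma>) ^ j - (1 - 4 * \<sigma>) ^ j) * Re (cis (real j * v) * cnj (c j)))"
proof -
  define p where "p j = 2 * (1 - \<sigma>) ^ j - (1 - 4 * \<sigma>) ^ j" for j
  define A where "A j = cis (real j * v) * cnj (c j)" for j
  define A0 where "A0 j = cis (real j * v0) * cnj (c0 j)" for j
  define e where "e = 6 * \<sigma> + \<delta> + \<delta>'"
  have "0 \<le> real 1 * \<delta>" using norm_ge_zero c[of 1] by (rule order_trans)
  then have e0: "0 \<le> e" using v \<sigma> by (simp add: e_def)
  have trm: "Re (A0 j) - real J * e \<le> p j * Re (A j)" if j: "j \<in> {1..<J}" for j
  proof -
    have "1 + real j * (- \<sigma>) \<le> (1 + - \<sigma>) ^ j" "1 + real j * (- 4 * \<sigma>) \<le> (1 + - 4 * \<sigma>) ^ j"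
      using \<sigma> by (intro Bernoulli_inequality; simp)+
    moreover have "(1 - \<sigma>) ^ j \<le> 1" "(1 - 4 * \<sigma>) ^ j \<le> 1" using \<sigma> by (intro power_le_one; simp)+
    ultimately have p: "\<bar>p j - 1\<bar> \<le> 6 * (real j * \<sigma>)" by (simp add: p_def abs_le_iff)
    have A1: "\<bar>Re (A j)\<bar> \<le> 1"
      using abs_Re_le_cmod[of "A j"] c1[of j] by (simp add: A_def norm_mult)
    have "A j - A0 j = (cis (real j * v) - cis (real j * v0)) * cnj (c j) + cis (real j * v0) * cnj (c j - c0 j)"
      by (simp add: A_def A0_def algebra_simps)
    then have "cmod (A j - A0 j) \<le> cmod (cis (real j * v) - cis (real j * v0)) * cmod (c j) + cmod (c j - c0 j)"
      by (metis (no_types, lifting) complex_mod_cnj mult_1 norm_cis norm_mult norm_triangle_ineq)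
    also have "\<dots> \<le> (real j * \<delta>') * 1 + real j * \<delta>"
    proof (intro add_mono mult_mono c c1)
      have "cmod (cis (real j * v) - cis (real j * v0)) \<le> real j * \<bar>v - v0\<bar>"
        using norm_cis_diff_le[of "real j * v" "real j * v0"] by (simp add: abs_mult flip: right_diff_distrib)
      also have "\<dots> \<le> real j * \<delta>'" using v by (intro mult_left_mono) auto
      finally show "cmod (cis (real j * v) - cis (real j * v0)) \<le> real j * \<delta>'" .
    qed (use v in auto)
    finally have "\<bar>Re (A j) - Re (A0 j)\<bar> \<le> real j * \<delta>' + real j * \<delta>"
      using abs_Re_le_cmod[of "A j - A0 j"] by simp
    moreover have "\<bar>(p j - 1) * Re (A j)\<bar> \<le> 6 * (real j * \<sigma>) * 1"
      unfolding abs_mult using p A1 by (intro mult_mono) auto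
    moreover have "p j * Re (A j) - Re (A0 j) = (p j - 1) * Re (A j) + (Re (A j) - Re (A0 j))"
      by (simp add: algebra_simps)
    moreover have "real j * e = 6 * (real j * \<sigma>) + real j * \<delta> + real j * \<delta>'" by (simp add: e_def algebra_simps)
    moreover have "real j * e \<le> real J * e" using j e0 by (intro mult_right_mono) auto
    ultimately show ?thesis by linarith
  qed
  have "(\<Sum>j=1..<J. Re (A0 j) - real J * e) \<le> (\<Sum>j=1..<J. p j * Re (A j))" using trm by (rule sum_mono)
  moreover have "(\<Sum>j=1..<J. Re (A0 j) - real J * e) = (\<Sum>j=1..<J. Re (A0 j)) - real (J - 1) * (real J * e)"
    by (simp add: sum_subtractf)
  moreover have "real (J - 1) * (real J * e) \<le> real J * (real J * e)" using e0 by (intro mult_right_mono) auto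
  moreover have "real J * (real J * e) \<le> 1 / 8" using small by (simp add: e_def power2_eq_square mult_ac)
  ultimately show ?thesis using mean unfolding A_def A0_def p_def by linarith
qed

section \<open>Choice of the perturbation\<close>

text \<open>The square root is at most \<open>(1 + \<sigma> j) / sqrt \<sigma>\<close>, and about \<open>1 / \<sigma>\<close> terms matter.\<close>

lemma sum_power_sqrt_le:
  fixes \<sigma> :: real
  assumes \<sigma>: "0 < \<sigma>" "\<sigma> < 1"
  shows "(\<Sum>j=J..n. (1 - \<sigma>) ^ j * sqrt (real j)) \<le> 2 / (\<sigma> * sqrt \<sigma>)"
proof -
  define \<rho> where "\<rho> = 1 - \<sigma>"
  have \<rho>: "0 < \<rho>" "\<rho> < 1" using \<sigma> by (auto simp: \<rho>_def)
  have "(\<lambda>j. \<rho> ^ j) sums (1 / (1 - \<rho>))" using \<rho> by (intro geometric_sums) auto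
  then have 1: "(\<Sum>j=J..n. \<rho> ^ j) \<le> 1 / \<sigma>"
    using \<rho> sum_le_suminf[of "\<lambda>j. \<rho> ^ j" "{J..n}"] by (auto simp: sums_iff \<rho>_def)
  have "(\<lambda>j. real (Suc j) * \<rho> ^ j) sums (1 / (1 - \<rho>)\<^sup>2)" using \<rho> by (intro geometric_deriv_sums) auto
  then have "(\<Sum>j=J..n. real (Suc j) * \<rho> ^ j) \<le> 1 / \<sigma>\<^sup>2"
    using \<rho> sum_le_suminf[of "\<lambda>j. real (Suc j) * \<rho> ^ j" "{J..n}"] by (auto simp: sums_iff \<rho>_def)
  moreover have "(\<Sum>j=J..n. real j * \<rho> ^ j) \<le> (\<Sum>j=J..n. real (Suc j) * \<rho> ^ j)"
    using \<rho> by (intro sum_mono mult_right_mono) auto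
  ultimately have 2: "(\<Sum>j=J..n. real j * \<rho> ^ j) \<le> 1 / \<sigma>\<^sup>2" by linarith
  have "(\<Sum>j=J..n. \<rho> ^ j * sqrt (real j)) \<le> (\<Sum>j=J..n. (\<rho> ^ j + \<sigma> * (real j * \<rho> ^ j)) / sqrt \<sigma>)"
  proof (rule sum_mono)
    fix j
    have "sqrt (real j) * sqrt \<sigma> \<le> 1 + \<sigma> * real j"
    proof -
      have "sqrt (\<sigma> * real j) \<le> sqrt ((1 + \<sigma> * real j)\<^sup>2)"
        using \<sigma> by (intro real_sqrt_le_mono) (simp add: power2_sum)
      then show ?thesis using \<sigma> by (simp add: real_sqrt_mult mult.commute)
    qed
    then have "sqrt (real j) \<le> (1 + \<sigma> * real j) / sqrt \<sigma>" using \<sigma> by (simp add: le_divide_eq)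
    then have "\<rho> ^ j * sqrt (real j) \<le> \<rho> ^ j * ((1 + \<sigma> * real j) / sqrt \<sigma>)"
      using \<rho> by (intro mult_left_mono) auto
    then show "\<rho> ^ j * sqrt (real j) \<le> (\<rho> ^ j + \<sigma> * (real j * \<rho> ^ j)) / sqrt \<sigma>"
      by (simp add: algebra_simps)
  qed
  also have "\<dots> = ((\<Sum>j=J..n. \<rho> ^ j) + \<sigma> * (\<Sum>j=J..n. real j * \<rho> ^ j)) / sqrt \<sigma>"
    by (simp add: sum.distrib sum_distrib_left flip: sum_divide_distrib)
  also have "\<dots> \<le> (1 / \<sigma> + \<sigma> * (1 / \<sigma>\<^sup>2)) / sqrt \<sigma>"
    using 1 2 \<sigma> by (intro divide_right_mono add_mono mult_left_mono) auto
  also have "\<dots> = 2 / (\<sigma> * sqrt \<sigma>)" using \<sigma> by (simp add: power2_eq_square field_simps)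
  finally show ?thesis by (simp add: \<rho>_def)
qed

lemma cocycle_branch_lipschitz:
  assumes l: "l \<ge> 1" and lam: "0 < lam" "lam < 1"
    and G: "\<And>x. (G has_real_derivative G' x) (at x)" and M: "\<And>x. \<bar>G' x\<bar> \<le> M" and x: "0 \<le> x"
  shows "\<bar>cocycle l lam G n ((x + c) / real l ^ n) - cocycle l lam G n ((0 + c) / real l ^ n)\<bar> \<le> M / (1 - lam) * x"
proof (cases "x = 0")
  case False
  then have x: "0 < x" using x by simp
  obtain z where "cocycle l lam G n ((x + c) / real l ^ n) - cocycle l lam G n ((0 + c) / real l ^ n)
      = (x - 0) * cocycle_slope l lam G' n ((z + c) / real l ^ n)"
    using MVT2[OF x, of "\<lambda>x. cocycle l lam G n ((x + c) / real l ^ n)" "\<lambda>x. cocycle_slope l lam G' n ((x + c) / real l ^ n)"]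
      cocycle_branch_has_derivative[OF G] by blast
  moreover have "\<bar>cocycle_slope l lam G' n ((z + c) / real l ^ n)\<bar> \<le> M / (1 - lam)"
    by (rule abs_cocycle_slope_le[OF l lam M])
  ultimately show ?thesis
    using x by (simp add: abs_mult mult.commute[of x] mult_right_mono del: times_divide_eq_left)
qed simp

lemma abs_wave_sum_le:
  assumes "\<And>i. i \<in> wave_index N \<Longrightarrow> \<bar>a i\<bar> \<le> 1" "\<And>i. i \<in> wave_index N \<Longrightarrow> \<bar>g i\<bar> \<le> B" "0 \<le> B"
  shows "\<bar>\<Sum>i\<in>wave_index N. a i * g i\<bar> \<le> real (card (wave_index N)) * B"
proof -
  have "\<bar>\<Sum>i\<in>wave_index N. a i * g i\<bar> \<le> (\<Sum>i\<in>wave_index N. \<bar>a i * g i\<bar>)" by (rule sum_abs)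
  also have "\<dots> \<le> (\<Sum>i\<in>wave_index N. 1 * B)"
    unfolding abs_mult using assms by (intro sum_mono mult_mono) auto
  finally show ?thesis by simp
qed

text \<open>The constants are chosen in this order: the cut-off \<open>J\<close> so that the decay in \<open>j\<close> makes the high
  frequencies small, the size of the box (\<open>\<eta>\<close> and \<open>q\<close>) so that the low frequencies hardly vary over it,
  the time \<open>m\<close> so that the diagonal contribution is small up to the frequency \<open>1 / \<sigma>\<close>, the truncation
  \<open>n\<close> of the Fourier series, and then the perturbation. The height \<open>y0\<close> of the box comes last, as
  it depends on the perturbation.\<close>

theorem ex_recurrent_perturbation:
  fixes l :: nat and \<epsilon> lam M :: real
  assumes l: "l \<ge> 2" and lam: "0 < lam" "lam < 1" "1 < lam ^ 3 * real l" and N: "transversal_degree l lam N"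
    and F: "\<And>x k. F (x + of_int k) = F x" "\<And>x. (F has_real_derivative F' x) (at x)" "continuous_on UNIV F'"
    and M: "\<And>x. \<bar>F x\<bar> \<le> M" "\<And>x. \<bar>F' x\<bar> \<le> M" and \<epsilon>: "\<epsilon> > 0" "\<epsilon> \<le> 1"
  shows "\<exists>a. (\<forall>i\<in>wave_index N. \<bar>a i\<bar> \<le> \<epsilon>) \<and> recurrent_box l lam (perturb F N a)"
proof -
  define M1 where "M1 = M + 2 * pi * real N"
  have M0: "0 \<le> M" using M(1)[of 0] by linarith
  have M1: "\<And>x. \<bar>F' x\<bar> \<le> M1" "2 * pi * real N \<le> M1"
    using M(2) M0 by (auto simp: M1_def intro: add_increasing2)
  define card_I where "card_I = real (card (wave_index N))"
  define R where "R = (M + card_I) / (1 - lam)"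
  define Lip where "Lip = (M + card_I * (2 * pi * real N)) / (1 - lam)"
  have R: "0 \<le> R" using M0 lam by (simp add: R_def card_I_def)
  have Lip: "0 \<le> Lip" using M0 lam by (simp add: Lip_def card_I_def)
  \<comment> \<open>With this unit of frequency all heights \<open>\<omega> S\<close> lie in \<open>[- 1, 1]\<close>, so they are determined by their values modulo \<open>2 \<pi>\<close>.\<close>
  define \<omega> where "\<omega> = 1 / (R + 1)"
  have \<omega>: "0 < \<omega>" "\<omega> \<le> 1" "\<omega> * R \<le> 1" using R by (auto simp: \<omega>_def divide_le_eq)
  obtain C s where C: "C > 0" "3 < s" and small:
    "\<And>m q J n \<rho>. 1 \<le> J \<Longrightarrow> 0 < \<rho> \<Longrightarrow>
    (\<exists>a u. (\<forall>i\<in>wave_index N. \<bar>a i\<bar> \<le> \<epsilon>) \<and>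
      (\<forall>j\<in>{J..n}. \<forall>x\<in>{0..1}. cmod (branch_sum l lam (perturb F N a) m q (\<lambda>_. 1) (real j * \<omega>) x) \<le> u j) \<and>
      (\<Sum>j=J..n. \<rho> ^ j * u j) \<le> (\<Sum>j=J..n. \<rho> ^ j * (C * (sqrt (real j) * (sqrt (1 / real l ^ m) + real j powr (- s / 2))))))"
    using ex_perturbation_small_branch_sums[OF l lam N F \<epsilon> \<omega>(1,2) M1] by blast
  obtain J where J: "1 \<le> J" "\<And>n. (\<Sum>j=J..n. C * (sqrt (real j) * real j powr (- s / 2))) \<le> 1 / 32"
  proof -
    have "summable (\<lambda>j. C * real j powr ((1 - s) / 2))"
      using C by (intro summable_mult) (simp add: summable_real_powr_iff)
    then obtain J0 where J0: "\<And>m n. m \<ge> J0 \<Longrightarrow> norm (\<Sum>j=m..<n. C * real j powr ((1 - s) / 2)) < 1 / 32"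
      using summable_Cauchy[of "\<lambda>j. C * real j powr ((1 - s) / 2)"] by (metis zero_less_divide_1_iff zero_less_numeral)
    have "(\<Sum>j=Suc J0..n. C * (sqrt (real j) * real j powr (- s / 2))) \<le> 1 / 32" for n
    proof -
      have "(\<Sum>j=Suc J0..n. C * (sqrt (real j) * real j powr (- s / 2))) = (\<Sum>j=Suc J0..<Suc n. C * real j powr ((1 - s) / 2))"
      proof (rule sum.cong)
        fix j assume "j \<in> {Suc J0..<Suc n}"
        then have "sqrt (real j) * real j powr (- s / 2) = real j powr ((1 - s) / 2)"
          by (simp add: powr_half_sqrt[symmetric] diff_divide_distrib flip: powr_add)
        then show "C * (sqrt (real j) * real j powr (- s / 2)) = C * real j powr ((1 - s) / 2)" by simp
      qed auto
      also have "\<dots> \<le> norm \<dots>" by simp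
      also have "\<dots> < 1 / 32" by (rule J0) simp
      finally show ?thesis by simp
    qed
    then show ?thesis by (intro that[of "Suc J0"]) auto
  qed
  define \<eta> where "\<eta> = 1 / (32 * \<omega> * (real J)\<^sup>2)"
  have \<eta>: "0 < \<eta>" "\<omega> * \<eta> * (real J)\<^sup>2 = 1 / 32" using \<omega> J by (auto simp: \<eta>_def)
  obtain q where "32 * \<omega> * Lip * (real J)\<^sup>2 < real l ^ q"
    using real_arch_pow[of "real l"] l by auto
  then have q: "\<omega> * Lip / real l ^ q * (real J)\<^sup>2 \<le> 1 / 32" using l by (simp add: field_simps)
  \<comment> \<open>The width \<open>\<sigma> = \<kappa> lam\<^sup>m\<close> of the kernel: \<open>10 \<sigma>\<close> corresponds to half of the admissible distance \<open>lam\<^sup>m\<^sup>+\<^sup>q \<eta>\<close>.\<close>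
  define \<kappa> where "\<kappa> = \<omega> * lam ^ q * \<eta> / 20"
  have \<kappa>: "0 < \<kappa>" using \<omega> lam \<eta> by (simp add: \<kappa>_def)
  obtain m where m: "6 * (\<kappa> * lam ^ m) * (real J)\<^sup>2 \<le> 1 / 32" "4 * lam ^ (m + q) * (real J)\<^sup>2 \<le> 1 / 32"
    "\<kappa> * lam ^ m \<le> 1 / 20" "C * (2 * sqrt (1 / (real l ^ m * (\<kappa> * lam ^ m) ^ 3))) \<le> 1 / 32"
  proof -
    have lam0: "(\<lambda>m. lam ^ m) \<longlonglongrightarrow> 0" using lam by (intro LIMSEQ_power_zero) auto
    have "(\<lambda>m. 6 * (\<kappa> * lam ^ m) * (real J)\<^sup>2) \<longlonglongrightarrow> 6 * (\<kappa> * 0) * (real J)\<^sup>2" by (intro tendsto_intros lam0)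
    then have 1: "eventually (\<lambda>m. 6 * (\<kappa> * lam ^ m) * (real J)\<^sup>2 < 1 / 32) sequentially" by (rule order_tendstoD) simp
    have "(\<lambda>m. 4 * (lam ^ m * lam ^ q) * (real J)\<^sup>2) \<longlonglongrightarrow> 4 * (0 * lam ^ q) * (real J)\<^sup>2" by (intro tendsto_intros lam0)
    then have 2: "eventually (\<lambda>m. 4 * (lam ^ m * lam ^ q) * (real J)\<^sup>2 < 1 / 32) sequentially" by (rule order_tendstoD) simp
    have "(\<lambda>m. \<kappa> * lam ^ m) \<longlonglongrightarrow> \<kappa> * 0" by (intro tendsto_intros lam0)
    then have 3: "eventually (\<lambda>m. \<kappa> * lam ^ m < 1 / 20) sequentially" by (rule order_tendstoD) simp
    have "(\<lambda>m. (1 / (lam ^ 3 * real l)) ^ m) \<longlonglongrightarrow> 0" using lam l by (intro LIMSEQ_power_zero) auto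
    then have "(\<lambda>m. C * (2 * sqrt (1 / \<kappa> ^ 3 * (1 / (lam ^ 3 * real l)) ^ m))) \<longlonglongrightarrow> C * (2 * sqrt (1 / \<kappa> ^ 3 * 0))"
      by (intro tendsto_mult tendsto_const tendsto_real_sqrt)
    then have 4: "eventually (\<lambda>m. C * (2 * sqrt (1 / \<kappa> ^ 3 * (1 / (lam ^ 3 * real l)) ^ m)) < 1 / 32) sequentially"
      by (rule order_tendstoD) simp
    have eq: "1 / (real l ^ m * (\<kappa> * lam ^ m) ^ 3) = 1 / \<kappa> ^ 3 * (1 / (lam ^ 3 * real l)) ^ m" for m
      by (simp add: power_mult_distrib power_divide mult_ac flip: power_mult)
    have "eventually (\<lambda>m. 6 * (\<kappa> * lam ^ m) * (real J)\<^sup>2 \<le> 1 / 32 \<and> 4 * lam ^ (m + q) * (real J)\<^sup>2 \<le> 1 / 32 \<and>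
        \<kappa> * lam ^ m \<le> 1 / 20 \<and> C * (2 * sqrt (1 / (real l ^ m * (\<kappa> * lam ^ m) ^ 3))) \<le> 1 / 32) sequentially"
      using 1 2 3 4 by eventually_elim (auto simp: eq power_add)
    then show ?thesis using that by (auto simp: eventually_sequentially)
  qed
  define \<sigma> where "\<sigma> = \<kappa> * lam ^ m"
  have \<sigma>: "0 < \<sigma>" "\<sigma> \<le> 1 / 20" using \<kappa> lam m(3) by (auto simp: \<sigma>_def)
  have \<sigma>_eq: "10 * \<sigma> = \<omega> * (1 / 2 * lam ^ (m + q) * \<eta>)" by (simp add: \<sigma>_def \<kappa>_def power_add)
  obtain n where n: "J \<le> n" "4 * (1 - \<sigma>) ^ n \<le> \<sigma> / 4"
  proof -
    have "(\<lambda>n. 4 * (1 - \<sigma>) ^ n) \<longlonglongrightarrow> 4 * 0" using \<sigma> by (intro tendsto_intros LIMSEQ_power_zero) auto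
    then have "eventually (\<lambda>n. 4 * (1 - \<sigma>) ^ n < \<sigma> / 4) sequentially"
      by (rule order_tendstoD(2)) (use \<sigma> in simp)
    then have "eventually (\<lambda>n. 4 * (1 - \<sigma>) ^ n < \<sigma> / 4 \<and> J \<le> n) sequentially"
      using eventually_ge_at_top by (rule eventually_conj)
    then show ?thesis using that by (auto simp: eventually_sequentially)
  qed
  have "0 < 1 - \<sigma>" using \<sigma> by simp
  from small[OF J(1) this, of n m q]
  obtain a u where a': "\<forall>i\<in>wave_index N. \<bar>a i\<bar> \<le> \<epsilon>"
    and u': "\<forall>j\<in>{J..n}. \<forall>x\<in>{0..1}. cmod (branch_sum l lam (perturb F N a) m q (\<lambda>_. 1) (real j * \<omega>) x) \<le> u j"
    and usum: "(\<Sum>j=J..n. (1 - \<sigma>) ^ j * u j) \<le> (\<Sum>j=J..n. (1 - \<sigma>) ^ j * (C * (sqrt (real j) * (sqrt (1 / real l ^ m) + real j powr (- s / 2)))))"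
    by blast
  have a: "\<bar>a i\<bar> \<le> \<epsilon>" if "i \<in> wave_index N" for i using a' that by blast
  have u: "cmod (branch_sum l lam (perturb F N a) m q (\<lambda>_. 1) (real j * \<omega>) x) \<le> u j" if "j \<in> {J..n}" "x \<in> {0..1}" for j x
    using u' that by blast
  have high: "(\<Sum>j=J..n. (1 - \<sigma>) ^ j * u j) \<le> 1 / 16"
  proof -
    have "(\<Sum>j=J..n. (1 - \<sigma>) ^ j * (C * (sqrt (real j) * (sqrt (1 / real l ^ m) + real j powr (- s / 2)))))
        \<le> (\<Sum>j=J..n. C * sqrt (1 / real l ^ m) * ((1 - \<sigma>) ^ j * sqrt (real j)) + C * (sqrt (real j) * real j powr (- s / 2)))"
    proof (rule sum_mono)
      fix j
      have "(1 - \<sigma>) ^ j * (C * (sqrt (real j) * real j powr (- s / 2))) \<le> 1 * (C * (sqrt (real j) * real j powr (- s / 2)))"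
        using \<sigma> C by (intro mult_right_mono power_le_one) auto
      then show "(1 - \<sigma>) ^ j * (C * (sqrt (real j) * (sqrt (1 / real l ^ m) + real j powr (- s / 2))))
          \<le> C * sqrt (1 / real l ^ m) * ((1 - \<sigma>) ^ j * sqrt (real j)) + C * (sqrt (real j) * real j powr (- s / 2))"
        by (simp add: algebra_simps)
    qed
    also have "\<dots> = C * sqrt (1 / real l ^ m) * (\<Sum>j=J..n. (1 - \<sigma>) ^ j * sqrt (real j)) + (\<Sum>j=J..n. C * (sqrt (real j) * real j powr (- s / 2)))"
      by (simp only: sum.distrib sum_distrib_left)
    also have "\<dots> \<le> C * sqrt (1 / real l ^ m) * (2 / (\<sigma> * sqrt \<sigma>)) + 1 / 32"
      using \<sigma> C l by (intro add_mono J mult_left_mono sum_power_sqrt_le) auto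
    also have "C * sqrt (1 / real l ^ m) * (2 / (\<sigma> * sqrt \<sigma>)) = C * (2 * sqrt (1 / (real l ^ m * \<sigma> ^ 3)))"
    proof -
      have "sqrt (\<sigma> ^ 3) = \<sigma> * sqrt \<sigma>" using \<sigma> by (simp add: power3_eq_cube real_sqrt_mult)
      then show ?thesis by (simp add: real_sqrt_divide real_sqrt_mult)
    qed
    also have "\<dots> \<le> 1 / 32" using m(4) by (simp add: \<sigma>_def)
    finally show ?thesis using usum by simp
  qed
  define G where "G = perturb F N a"
  define k where "k = m + q"
  define S where "S x w = \<omega> * cocycle l lam G k (branch l k x w)" for x w
  define c where "c x j = (\<Sum>w<l ^ m. cis (real j * S x w)) / of_nat (l ^ m)" for x j
  have c_eq: "c x j = branch_sum l lam G m q (\<lambda>_. 1) (real j * \<omega>) x" for x j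
    by (simp add: c_def S_def branch_sum_def k_def mult.assoc)
  have a1: "\<bar>a i\<bar> \<le> 1" if "i \<in> wave_index N" for i using a[OF that] \<epsilon> by linarith
  have G_le: "norm (G x) \<le> M + card_I" for x
  proof -
    have "\<bar>\<Sum>i\<in>wave_index N. a i * wave_at i x\<bar> \<le> card_I * 1"
      unfolding card_I_def by (rule abs_wave_sum_le[OF a1]) (auto simp: wave_at_def abs_wave_le)
    then show ?thesis using M(1)[of x] by (simp add: G_def perturb_def)
  qed
  have S_le: "\<bar>S x w\<bar> \<le> 1" for x w
  proof -
    have "\<bar>cocycle l lam G k (branch l k x w)\<bar> \<le> R"
      using norm_cocycle_le[OF lam(1,2) G_le] by (simp add: R_def)
    then have "\<omega> * \<bar>cocycle l lam G k (branch l k x w)\<bar> \<le> \<omega> * R" using \<omega> by (intro mult_left_mono) auto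
    then have "\<omega> * \<bar>cocycle l lam G k (branch l k x w)\<bar> \<le> 1" using \<omega>(3) by linarith
    then show ?thesis using \<omega> by (simp add: S_def abs_mult)
  qed
  have S_lip: "\<bar>S x w - S 0 w\<bar> \<le> \<omega> * Lip / real l ^ q" if x: "x \<in> {0..1 / real l ^ q}" for x w
  proof -
    have "\<bar>perturb_slope F' N a x\<bar> \<le> M + card_I * (2 * pi * real N)" for x
    proof -
      have "\<bar>\<Sum>i\<in>wave_index N. a i * (2 * pi * real (fst i) * wave (fst i) (Suc (fst (snd i))) x)\<bar> \<le> card_I * (2 * pi * real N)"
        unfolding card_I_def
      proof (rule abs_wave_sum_le[OF a1])
        fix i assume "i \<in> wave_index N"
        then have "real (fst i) \<le> real N" by (auto simp: wave_index_def)
        then have "2 * pi * real (fst i) * \<bar>wave (fst i) (Suc (fst (snd i))) x\<bar> \<le> (2 * pi * real N) * 1"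
          by (intro mult_mono abs_wave_le) auto
        then show "\<bar>2 * pi * real (fst i) * wave (fst i) (Suc (fst (snd i))) x\<bar> \<le> 2 * pi * real N"
          by (simp add: abs_mult)
      qed auto
      then show ?thesis using M(2)[of x] by (simp add: perturb_slope_def)
    qed
    then have "\<bar>cocycle l lam G k (branch l k x w) - cocycle l lam G k (branch l k 0 w)\<bar> \<le> Lip * x"
      unfolding Lip_def G_def using l x by (intro cocycle_branch_lipschitz[OF _ lam(1,2) perturb_has_derivative[OF F(2)]]) auto
    also have "\<dots> \<le> Lip * (1 / real l ^ q)" using x Lip by (intro mult_left_mono) auto
    finally have "\<omega> * \<bar>cocycle l lam G k (branch l k x w) - cocycle l lam G k (branch l k 0 w)\<bar> \<le> \<omega> * (Lip * (1 / real l ^ q))"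
      using \<omega> by (intro mult_left_mono) auto
    then show ?thesis using \<omega> by (simp add: S_def abs_mult flip: right_diff_distrib)
  qed
  have lm: "l ^ m > 0" using l by simp
  have avg_le: "cmod ((\<Sum>w<l ^ m. g w) / of_nat (l ^ m)) \<le> b" if "\<And>w. cmod (g w) \<le> b" for g :: "nat \<Rightarrow> complex" and b
  proof -
    have "cmod (\<Sum>w<l ^ m. g w) \<le> (\<Sum>w<l ^ m. b)" using that by (intro sum_norm_le)
    then have "cmod (\<Sum>w<l ^ m. g w) \<le> b * real (l ^ m)" by (simp add: mult.commute)
    then show ?thesis using lm unfolding norm_divide norm_of_nat by (simp add: divide_le_eq)
  qed
  have c1: "cmod (c x j) \<le> 1" for x j unfolding c_def by (rule avg_le) simp
  have c_lip: "cmod (c x j - c 0 j) \<le> real j * (\<omega> * Lip / real l ^ q)" if x: "x \<in> {0..1 / real l ^ q}" for x j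
  proof -
    have diff: "c x j - c 0 j = (\<Sum>w<l ^ m. cis (real j * S x w) - cis (real j * S 0 w)) / of_nat (l ^ m)"
      by (simp add: c_def sum_subtractf diff_divide_distrib)
    have "cmod (cis (real j * S x w) - cis (real j * S 0 w)) \<le> real j * (\<omega> * Lip / real l ^ q)" for w
    proof -
      have "cmod (cis (real j * S x w) - cis (real j * S 0 w)) \<le> real j * \<bar>S x w - S 0 w\<bar>"
        using norm_cis_diff_le[of "real j * S x w" "real j * S 0 w"] by (simp add: abs_mult flip: right_diff_distrib)
      also have "\<dots> \<le> real j * (\<omega> * Lip / real l ^ q)" using S_lip[OF x] by (intro mult_left_mono) auto
      finally show ?thesis .
    qed
    then show ?thesis unfolding diff by (rule avg_le)
  qed
  obtain v0 where v0: "\<bar>v0\<bar> \<le> pi" "0 \<le> (\<Sum>j=1..<J. Re (cis (real j * v0) * cnj (c 0 j)))"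
    using ex_trig_poly_nonneg[of J "\<lambda>j. cnj (c 0 j)"] J by auto
  define y0 where "y0 = v0 / \<omega>"
  have "box_cover l lam G m q \<eta> y0 (1 / 2)"
    unfolding box_cover_def
  proof (intro ballI)
    fix x y assume x: "x \<in> {0..1 / real l ^ q}" and y: "y \<in> {y0 - \<eta>..y0 + \<eta>}"
    define v where "v = \<omega> * (y - lam ^ k * y0)"
    define \<delta>' where "\<delta>' = \<omega> * \<eta> + 4 * lam ^ k"
    have x01: "x \<in> {0..1}"
      using x l by (auto intro: order_trans simp: divide_le_eq)
    have vv0: "\<bar>v - v0\<bar> \<le> \<delta>'"
    proof -
      have "v - v0 = \<omega> * (y - y0) - lam ^ k * v0" using \<omega> by (simp add: v_def y0_def field_simps)
      moreover have "\<bar>\<omega> * (y - y0)\<bar> \<le> \<omega> * \<eta>" using y \<omega> by (auto simp: abs_mult abs_le_iff intro!: mult_left_mono)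
      moreover have "\<bar>lam ^ k * v0\<bar> \<le> lam ^ k * 4"
        using v0(1) lam pi_less_4 by (simp add: abs_mult)
      ultimately show ?thesis unfolding \<delta>'_def by linarith
    qed
    have J1: "1 \<le> (real J)\<^sup>2" using J(1) by simp
    have budget: "(6 * \<sigma> + \<omega> * Lip / real l ^ q + \<delta>') * (real J)\<^sup>2 \<le> 1 / 8"
      using m(1,2) q \<eta>(2) unfolding \<sigma>_def[symmetric] \<delta>'_def k_def distrib_right by linarith
    have "0 \<le> (6 * \<sigma> + \<omega> * Lip / real l ^ q)" using \<sigma> \<omega> Lip by simp
    moreover have \<delta>'0: "0 \<le> \<delta>'" using \<omega> \<eta> lam by (simp add: \<delta>'_def)
    ultimately have "\<delta>' * 1 \<le> (6 * \<sigma> + \<omega> * Lip / real l ^ q + \<delta>') * (real J)\<^sup>2"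
      using J1 by (intro mult_mono) auto
    then have \<delta>'1: "\<delta>' \<le> 1" using budget by linarith
    have "\<exists>w<l ^ m. \<bar>v - S x w\<bar> < 10 * \<sigma>"
    proof (rule ex_close_point[OF lm c_def \<sigma> _ high _ J(1) n])
      show "- 1 / 4 \<le> 2 * (\<Sum>j=1..<J. (2 * (1 - \<sigma>) ^ j - (1 - 4 * \<sigma>) ^ j) * Re (cis (real j * v) * cnj (c x j)))"
        by (rule low_frequency_bound[OF \<sigma> v0(2) c1 c_lip[OF x] vv0 budget])
      show "cmod (c x j) \<le> u j" if "j \<in> {J..n}" for j
        using u[OF that x01] by (simp add: c_eq G_def)
      show "\<bar>v - S x w\<bar> \<le> pi + 2" for w
        using vv0 \<delta>'1 v0(1) S_le[of x w] by linarith
    qed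
    then obtain w where w: "w < l ^ m" "\<bar>v - S x w\<bar> < 10 * \<sigma>" by blast
    define Y where "Y = y - cocycle l lam G k (branch l k x w) - lam ^ k * y0"
    have "v - S x w = \<omega> * Y" by (simp add: v_def S_def Y_def algebra_simps)
    then have "\<omega> * \<bar>Y\<bar> < \<omega> * (1 / 2 * lam ^ k * \<eta>)"
      using w(2) \<omega> unfolding \<sigma>_eq k_def by (simp add: abs_mult)
    then have "\<bar>Y\<bar> < 1 / 2 * lam ^ k * \<eta>" using \<omega> by (simp only: mult_less_cancel_left_pos)
    then show "\<exists>w<l ^ m. \<bar>y - cocycle l lam G (m + q) (branch l (m + q) x w) - lam ^ (m + q) * y0\<bar> \<le> 1 / 2 * lam ^ (m + q) * \<eta>"
      using w(1) unfolding Y_def k_def by (intro exI[of _ w]) simp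
  qed
  moreover have "0 < m + q"
  proof (rule ccontr)
    assume "\<not> 0 < m + q"
    then have "4 * (real J)\<^sup>2 \<le> 1 / 32" using m(2) by simp
    moreover have "1 \<le> (real J)\<^sup>2" using J(1) by simp
    ultimately show False by linarith
  qed
  ultimately have "recurrent_box l lam G"
    unfolding recurrent_box_def using \<eta>(1) by (intro exI[of _ m] exI[of _ q] exI[of _ \<eta>] exI[of _ y0] exI[of _ "1 / 2"]) auto
  then show ?thesis using a unfolding G_def by blast
qed

section \<open>\<open>C\<^sup>r\<close> functions on the circle\<close>

lemma Cr_differentiable: "f \<in> Cr r \<Longrightarrow> k < r \<Longrightarrow> circle_deriv k f differentiable (at x)"
  by (simp add: Cr_def)

lemma circle_deriv_Suc: "circle_deriv (Suc k) f = deriv (circle_deriv k f)"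
  by (simp add: circle_deriv_def)

lemma Cr_has_derivative:
  assumes "f \<in> Cr r" "k < r"
  shows "(circle_deriv k f has_real_derivative circle_deriv (Suc k) f x) (at x)"
proof -
  have "circle_deriv k f field_differentiable at x"
    using Cr_differentiable[OF assms, of x] by (simp add: field_differentiable_def real_differentiable_def)
  then show ?thesis unfolding circle_deriv_Suc by (rule field_differentiable_derivI)
qed

lemma circle_deriv_continuous:
  assumes "f \<in> Cr r" "k \<le> r"
  shows "continuous_on UNIV (circle_deriv k f)"
proof (cases "k = r")
  case True
  then show ?thesis using assms by (simp add: Cr_def)
next
  case False
  then show ?thesis using Cr_has_derivative[OF assms(1), of k] assms(2)
    by (intro continuous_at_imp_continuous_on ballI) (auto intro: DERIV_isCont)
qed

lemma circle_deriv_periodic: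
  assumes "f \<in> Cr r" "k \<le> r"
  shows "circle_deriv k f (x + of_int n) = circle_deriv k f x"
  using assms(2)
proof (induction k arbitrary: x)
  case 0
  show ?case by (simp add: circle_deriv_def to_circle_eq_iff)
next
  case (Suc k)
  have k: "k < r" using Suc.prems by simp
  have "((\<lambda>x. circle_deriv k f (x + of_int n)) has_real_derivative circle_deriv (Suc k) f (x + of_int n)) (at x)"
    using Cr_has_derivative[OF assms(1) k, of "x + of_int n"] by (simp add: DERIV_shift)
  moreover have "(\<lambda>x. circle_deriv k f (x + of_int n)) = circle_deriv k f"
    using Suc by (intro ext) simp
  ultimately have "(circle_deriv k f has_real_derivative circle_deriv (Suc k) f (x + of_int n)) (at x)" by simp
  then show ?case using DERIV_unique Cr_has_derivative[OF assms(1) k] by blast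
qed

lemma circle_deriv_bounded:
  assumes "f \<in> Cr r" "k \<le> r"
  shows "\<exists>M. \<forall>x. \<bar>circle_deriv k f x\<bar> \<le> M"
proof -
  have "compact (circle_deriv k f ` {0..1})"
    using circle_deriv_continuous[OF assms] continuous_on_subset by (intro compact_continuous_image) auto
  then obtain M where "\<forall>y\<in>circle_deriv k f ` {0..1}. norm y \<le> M"
    using compact_imp_bounded bounded_iff by blast
  then have M: "\<bar>circle_deriv k f x\<bar> \<le> M" if "x \<in> {0..1}" for x using that by auto
  have "\<bar>circle_deriv k f x\<bar> \<le> M" for x
  proof -
    have "circle_deriv k f x = circle_deriv k f (x + of_int (- \<lfloor>x\<rfloor>))"
      by (rule circle_deriv_periodic[OF assms, symmetric])
    moreover have "x + of_int (- \<lfloor>x\<rfloor>) \<in> {0..1}" by (simp add: frac_def[symmetric] less_imp_le[OF frac_lt_1])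
    ultimately show ?thesis using M by metis
  qed
  then show ?thesis by blast
qed

text \<open>Repeated derivatives are identified by exhibiting a candidate for each order.\<close>

lemma circle_deriv_unique:
  assumes "\<And>x. D 0 x = f (to_circle x)" "\<And>k x. k < r \<Longrightarrow> (D k has_real_derivative D (Suc k) x) (at x)"
    and "k \<le> r"
  shows "circle_deriv k f = D k"
  using assms(3)
proof (induction k)
  case 0
  show ?case by (simp add: circle_deriv_def fun_eq_iff assms(1))
next
  case (Suc k)
  then have "circle_deriv (Suc k) f = deriv (D k)" by (simp add: circle_deriv_Suc)
  also have "\<dots> = D (Suc k)" using assms(2)[of k] Suc.prems by (intro ext DERIV_imp_deriv) auto
  finally show ?case .
qed

lemma Cr_I:
  assumes "\<And>x. D 0 x = f (to_circle x)" "\<And>k x. k < r \<Longrightarrow> (D k has_real_derivative D (Suc k) x) (at x)"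
    and "continuous_on UNIV (D r)"
  shows "f \<in> Cr r"
proof -
  have D: "circle_deriv k f = D k" if "k \<le> r" for k by (rule circle_deriv_unique[OF assms(1,2) that])
  have "circle_deriv k f differentiable (at x)" if "k < r" for k x
    using assms(2)[OF that] D[of k] that by (auto simp: real_differentiable_def)
  then show ?thesis using assms(3) D[of r] by (simp add: Cr_def)
qed

text \<open>The waves are 1-periodic, so any representative of a point of the circle may be used.\<close>

definition perturb_circle :: "(circle \<Rightarrow> real) \<Rightarrow> nat \<Rightarrow> (nat \<times> nat \<times> nat \<Rightarrow> real) \<Rightarrow> circle \<Rightarrow> real"
  where "perturb_circle f N a c = f c + (\<Sum>i\<in>wave_index N. a i * wave_at i (inv to_circle c))"

lemma wave_at_to_circle: "wave_at i (inv to_circle (to_circle x)) = wave_at i x"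
proof -
  have "to_circle (inv to_circle (to_circle x)) = to_circle x" by (rule surj_f_inv_f[OF surj_to_circle])
  then obtain n where "inv to_circle (to_circle x) - x = of_int n" by (auto simp: to_circle_eq_iff elim: Ints_cases)
  then have "inv to_circle (to_circle x) = x + of_int n" by simp
  then show ?thesis by (simp add: wave_at_def wave_periodic)
qed

lemma perturb_circle_to_circle: "perturb_circle f N a (to_circle x) = perturb (\<lambda>x. f (to_circle x)) N a x"
  by (simp add: perturb_circle_def perturb_def wave_at_to_circle)

lemma perturb_circle_Cr:
  assumes f: "f \<in> Cr r"
  shows "perturb_circle f N a \<in> Cr r" (is ?mem)
    and "k \<le> r \<Longrightarrow> circle_deriv k (perturb_circle f N a) x = circle_deriv k f x +
      (\<Sum>i\<in>wave_index N. a i * ((2 * pi * real (fst i)) ^ k * wave (fst i) (fst (snd i) + k) x))" (is "_ \<Longrightarrow> ?eq")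
proof -
  define D where "D k x = circle_deriv k f x +
      (\<Sum>i\<in>wave_index N. a i * ((2 * pi * real (fst i)) ^ k * wave (fst i) (fst (snd i) + k) x))" for k x
  have 0: "D 0 x = perturb_circle f N a (to_circle x)" for x
    by (simp add: D_def perturb_circle_def wave_at_to_circle circle_deriv_def) (simp add: wave_at_def)
  have Suc: "(D k has_real_derivative D (Suc k) x) (at x)" if "k < r" for k x
  proof -
    have "((\<lambda>x. a i * ((2 * pi * real (fst i)) ^ k * wave (fst i) (fst (snd i) + k) x)) has_real_derivative
        a i * ((2 * pi * real (fst i)) ^ Suc k * wave (fst i) (fst (snd i) + Suc k) x)) (at x)" for i :: "nat \<times> nat \<times> nat"
    proof -
      have "((\<lambda>x. a i * ((2 * pi * real (fst i)) ^ k * wave (fst i) (fst (snd i) + k) x)) has_real_derivative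
          a i * ((2 * pi * real (fst i)) ^ k * (2 * pi * real (fst i) * wave (fst i) (Suc (fst (snd i) + k)) x))) (at x)"
        by (intro DERIV_cmult wave_has_derivative)
      then show ?thesis by (simp add: mult_ac)
    qed
    then show ?thesis
      unfolding D_def[abs_def] by (intro DERIV_add DERIV_sum Cr_has_derivative[OF f that])
  qed
  have "continuous_on UNIV (D r)"
    unfolding D_def[abs_def] wave_def using circle_deriv_continuous[OF f order.refl]
    by (intro continuous_intros) auto
  then show ?mem using 0 Suc by (intro Cr_I[of D])
  show ?eq if "k \<le> r"
    using circle_deriv_unique[OF 0 Suc that] by (simp add: D_def)
qed

lemma perturb_circle_near:
  assumes f: "f \<in> Cr r" and \<delta>: "\<delta> > 0"
  shows "\<exists>\<epsilon>>0. \<epsilon> \<le> 1 \<and> (\<forall>a. (\<forall>i\<in>wave_index N. \<bar>a i\<bar> \<le> \<epsilon>) \<longrightarrow> Cr_near r \<delta> f (perturb_circle f N a))"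
proof -
  define A where "A = real (card (wave_index N)) * (1 + 2 * pi * real N) ^ r"
  have A: "A \<ge> 0" by (simp add: A_def)
  define \<epsilon> where "\<epsilon> = min 1 (\<delta> / (A + 1))"
  have \<epsilon>: "\<epsilon> > 0" "\<epsilon> \<le> 1" using \<delta> A by (auto simp: \<epsilon>_def)
  have "\<epsilon> * A \<le> \<delta> / (A + 1) * A" using A by (intro mult_right_mono) (auto simp: \<epsilon>_def)
  also have "\<dots> < \<delta>" using A \<delta> by (simp add: divide_less_eq)
  finally have \<epsilon>A: "\<epsilon> * A < \<delta>" .
  have "Cr_near r \<delta> f (perturb_circle f N a)" if a: "\<forall>i\<in>wave_index N. \<bar>a i\<bar> \<le> \<epsilon>" for a
    unfolding Cr_near_def
  proof (intro allI impI)
    fix k x assume k: "k \<le> r"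
    have "\<bar>circle_deriv k (perturb_circle f N a) x - circle_deriv k f x\<bar>
        = \<bar>\<Sum>i\<in>wave_index N. a i * ((2 * pi * real (fst i)) ^ k * wave (fst i) (fst (snd i) + k) x)\<bar>"
      using perturb_circle_Cr(2)[OF f k] by simp
    also have "\<dots> \<le> (\<Sum>i\<in>wave_index N. \<epsilon> * (1 + 2 * pi * real N) ^ r)"
    proof (rule order_trans[OF sum_abs sum_mono])
      fix i assume i: "i \<in> wave_index N"
      have "(2 * pi * real (fst i)) ^ k \<le> (1 + 2 * pi * real N) ^ k"
        using i by (intro power_mono) (auto simp: wave_index_def intro!: add_increasing)
      also have "\<dots> \<le> (1 + 2 * pi * real N) ^ r" using k by (intro power_increasing) auto
      finally have "(2 * pi * real (fst i)) ^ k * \<bar>wave (fst i) (fst (snd i) + k) x\<bar> \<le> (1 + 2 * pi * real N) ^ r * 1"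
        by (intro mult_mono abs_wave_le) auto
      then show "\<bar>a i * ((2 * pi * real (fst i)) ^ k * wave (fst i) (fst (snd i) + k) x)\<bar> \<le> \<epsilon> * (1 + 2 * pi * real N) ^ r"
        using a i \<epsilon> unfolding abs_mult by (intro mult_mono) (auto simp: abs_mult)
    qed
    also have "\<dots> = \<epsilon> * A" by (simp add: A_def)
    finally show "\<bar>circle_deriv k (perturb_circle f N a) x - circle_deriv k f x\<bar> < \<delta>" using \<epsilon>A by simp
  qed
  then show ?thesis using \<epsilon> by blast
qed

section \<open>The open dense set\<close>

text \<open>The open set consists of the functions with a recurrent box. The degree \<open>N\<close> of the perturbations
  depends only on \<open>l\<close> and \<open>lam\<close>, so that perturbations with small coefficients are small in \<open>C\<^sup>r\<close>.\<close>

theorem corollary2: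
  fixes r l :: nat and lam :: real
  assumes "r \<ge> 4" and "l \<ge> 2"
    and "0 < lam" and "lam < 1" and "lam ^ 3 * real l > 1"
  shows "\<exists>U. openin (Cr_topology r) U
    \<and> Cr_topology r closure_of U = topspace (Cr_topology r)
    \<and> (\<forall>f\<in>U. \<exists>A. is_attractor (skew_map l lam f) A \<and> interior A \<noteq> {})"
proof -
  note l = assms(2) and lam = assms(3,4)
  have r: "0 < r" "1 \<le> r" using assms(1) by auto
  define U where "U = {f \<in> Cr r. recurrent_box l lam (\<lambda>x. f (to_circle x))}"
  have lift: "circle_deriv 0 f = (\<lambda>x. f (to_circle x))" for f by (simp add: circle_deriv_def)
  have bounded: "\<exists>M. \<forall>c. \<bar>f c\<bar> \<le> M" if f: "f \<in> Cr r" for f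
  proof -
    obtain M where "\<forall>x. \<bar>circle_deriv 0 f x\<bar> \<le> M" using circle_deriv_bounded[OF f, of 0] by auto
    then show ?thesis unfolding lift using surj_to_circle by (metis surjD)
  qed
  have "openin (Cr_topology r) U"
    unfolding openin_Cr_topology
  proof (intro conjI ballI)
    show "U \<subseteq> Cr r" by (auto simp: U_def)
    fix f assume "f \<in> U"
    then obtain \<epsilon> where \<epsilon>: "\<epsilon> > 0"
        "\<And>G. (\<And>x. \<bar>G x - f (to_circle x)\<bar> \<le> \<epsilon>) \<Longrightarrow> recurrent_box l lam G"
      using recurrent_box_stable[OF lam, of l "\<lambda>x. f (to_circle x)"] by (auto simp: U_def)
    have "g \<in> U" if g: "g \<in> Cr r" "Cr_near r \<epsilon> f g" for g
    proof -
      have "\<bar>g (to_circle x) - f (to_circle x)\<bar> \<le> \<epsilon>" for x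
        using g(2) unfolding Cr_near_def by (metis le0 less_imp_le lift)
      then show ?thesis using g(1) \<epsilon>(2) by (simp add: U_def)
    qed
    then show "\<exists>\<epsilon>>0. \<forall>g\<in>Cr r. Cr_near r \<epsilon> f g \<longrightarrow> g \<in> U" using \<epsilon>(1) by blast
  qed
  moreover have "Cr_topology r closure_of U = topspace (Cr_topology r)"
  proof (rule antisym[OF closure_of_subset_topspace], rule subsetI)
    fix f assume "f \<in> topspace (Cr_topology r)"
    then have f: "f \<in> Cr r" by (simp add: topspace_Cr_topology)
    show "f \<in> Cr_topology r closure_of U"
      unfolding in_closure_of
    proof (intro conjI allI impI)
      show "f \<in> topspace (Cr_topology r)" using f by (simp add: topspace_Cr_topology)
      fix W assume "f \<in> W \<and> openin (Cr_topology r) W"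
      then obtain \<delta> where \<delta>: "\<delta> > 0" "\<And>g. g \<in> Cr r \<Longrightarrow> Cr_near r \<delta> f g \<Longrightarrow> g \<in> W"
        unfolding openin_Cr_topology by blast
      define F where "F = (\<lambda>x. f (to_circle x))"
      have F': "(F has_real_derivative circle_deriv 1 f x) (at x)" for x
        using Cr_has_derivative[OF f r(1), of x] by (simp add: lift F_def)
      obtain M0 where M0: "\<And>c. \<bar>f c\<bar> \<le> M0" using bounded[OF f] by blast
      obtain M1 where M1: "\<And>x. \<bar>circle_deriv 1 f x\<bar> \<le> M1" using circle_deriv_bounded[OF f r(2)] by blast
      define M where "M = max M0 M1"
      have M: "\<bar>F x\<bar> \<le> M" "\<bar>circle_deriv 1 f x\<bar> \<le> M" for x
        using M0[of "to_circle x"] M1[of x] by (auto simp: M_def F_def)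
      obtain N where N: "transversal_degree l lam N" using ex_transversal_degree[OF l lam] by blast
      obtain \<epsilon> where \<epsilon>: "\<epsilon> > 0" "\<epsilon> \<le> 1"
          "\<And>a. (\<forall>i\<in>wave_index N. \<bar>a i\<bar> \<le> \<epsilon>) \<Longrightarrow> Cr_near r \<delta> f (perturb_circle f N a)"
        using perturb_circle_near[OF f \<delta>(1), of N] by blast
      have "F (x + of_int k) = F x" for x k by (simp add: F_def)
      then obtain a where a: "\<forall>i\<in>wave_index N. \<bar>a i\<bar> \<le> \<epsilon>" "recurrent_box l lam (perturb F N a)"
        using ex_recurrent_perturbation[OF l lam assms(5) N _ F' circle_deriv_continuous[OF f r(2)] M \<epsilon>(1,2)] by blast
      have g: "perturb_circle f N a \<in> Cr r" by (rule perturb_circle_Cr(1)[OF f])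
      have "(\<lambda>x. perturb_circle f N a (to_circle x)) = perturb F N a"
        unfolding perturb_circle_to_circle F_def by simp
      then have "perturb_circle f N a \<in> U" using g a(2) by (simp add: U_def)
      moreover have "perturb_circle f N a \<in> W" using g a(1) \<epsilon>(3) \<delta>(2) by blast
      ultimately show "\<exists>g. g \<in> U \<and> g \<in> W" by blast
    qed
  qed
  moreover have "\<exists>A. is_attractor (skew_map l lam f) A \<and> interior A \<noteq> {}" if "f \<in> U" for f
  proof -
    have f: "f \<in> Cr r" "recurrent_box l lam (\<lambda>x. f (to_circle x))" using that by (auto simp: U_def)
    obtain M where M: "\<And>c. \<bar>f c\<bar> \<le> M" using bounded[OF f(1)] by blast
    obtain R where R: "M / (1 - lam) < R" "interior (maximal_attractor l lam f R) \<noteq> {}"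
      using interior_maximal_attractor[OF l lam f(2) M] by blast
    have "continuous_on UNIV (\<lambda>x. f (to_circle x))"
      using circle_deriv_continuous[OF f(1), of 0] by (simp add: lift)
    then have "is_attractor (skew_map l lam f) (maximal_attractor l lam f R)"
      by (rule is_attractor_maximal_attractor[OF l lam _ M R(1)])
    then show ?thesis using R(2) by blast
  qed
  ultimately show ?thesis by blast
qed

end
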